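(* Let $n\ge1$, $0<q<1$, let $\lambda$ be a nonnegative integer, $t=q^\lambda$, let $a,b$ be real parameters, put $x=-b-\lambda(n-1)$ and $y=a+b+1$ (so that $x,y$ are arbitrary real parameters), and let $\eta\in\mathbb{Z}_{\ge0}^n$ be a composition. Then $$\prod_{i=1}^n\int_0^1 d_qs_i\,s_i^{x-1}\frac{(qs_i;q)_\infty}{(q^{a+b+1}s_i;q)_\infty}\;E_\eta(s;q,t)\prod_{1\le i<j\le n}s_i^{2\lambda}\left(q^{1-\lambda}\tfrac{s_j}{s_i};q\right)_{2\lambda}$$ $$=E_\eta(t^{\underline\delta};q,t)\,\frac{[q^{x+\lambda(n-1)}]_{\eta^+}}{[q^{x+y+2\lambda(n-1)}]_{\eta^+}}\;\prod_{i=1}^n\int_0^1 d_qs_i\,s_i^{x-1}\frac{(qs_i;q)_\infty}{(q^{a+b+1}s_i;q)_\infty}\prod_{1\le i<j\le n}s_i^{2\lambda}\left(q^{1-\lambda}\tfrac{s_j}{s_i};q\right)_{2\lambda},$$ where both sides contain $n$-fold $q$-integrals over $s=(s_1,\ldots,s_n)$ of the whole integrand.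
   Context: Non-symmetric Macdonald polynomials in variables $x_1,\ldots,x_n$ (here evaluated at $s$). The operator $\mathsf{s}_i$ interchanges $x_i$ and $x_{i+1}$ ($1\le i\le n-1$); $(\tau_i f)(x_1,\ldots,x_n)=f(x_1,\ldots,qx_i,\ldots,x_n)$; $T_i=t+\frac{tx_i-x_{i+1}}{x_i-x_{i+1}}(\mathsf{s}_i-1)$; $\omega=\mathsf{s}_{n-1}\cdots \mathsf{s}_1\tau_1$; $Y_i=t^{-n+i}T_i\cdots T_{n-1}\,\omega\,T_1^{-1}\cdots T_{i-1}^{-1}$ for $1\le i\le n$. For $\eta\in\mathbb{Z}_{\ge0}^n$ let $x^\eta=x_1^{\eta_1}\cdots x_n^{\eta_n}$, $|\eta|=\sum_i\eta_i$, $\eta^+$ the partition obtained by permuting the parts of $\eta$, and $l'_\eta(i)=\#\{k<i:\eta_k\ge\eta_i\}+\#\{k>i:\eta_k>\eta_i\}$. Dominance order on $n$-tuples: $\nu<\eta$ iff $\nu\ne\eta$ and $\sum_{i=1}^p(\eta_i-\nu_i)\ge0$ for all $1\le p\le n$. For $|\nu|=|\eta|$: $\nu\prec\eta$ iff $\nu^+<\eta^+$, or $\nu^+=\eta^+$ and $\nu<\eta$. $E_\eta(x;q,t)$ is the unique polynomial of the form $x^\eta+\sum_{\nu\prec\eta}b_{\eta\nu}x^\nu$ with $Y_iE_\eta=q^{\eta_i}t^{-l'_\eta(i)}E_\eta$ for all $1\le i\le n$ (for $\lambda=0$ it is understood as the limit $t\to1$). Further notation. $(z;q)_\infty=\prod_{i\ge0}(1-zq^i)$,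 $(z;q)_m=\prod_{i=0}^{m-1}(1-zq^i)$. $q$-integral: $\int_0^1f(s)\,d_qs=(1-q)\sum_{j=0}^\infty f(q^j)q^j$, iterated in each variable. $t^{\underline\delta}=(1,t,\ldots,t^{n-1})$. For a partition $\kappa=(\kappa_1,\ldots,\kappa_n)$, $[q^u]_\kappa=\prod_{i=1}^n\prod_{j=1}^{\kappa_i}\left(t^{i-1}-q^{j-1+u}\right)$.
   Formalization: Instead of arbitrary real x, y, it is assumed that x>0 (otherwise the right-hand q-integral diverges), that a+b+1 is not a nonpositive integer (otherwise the integrand has a zero denominator), and that [q^{x+y+2λ(n-1)}]_{η^+} is nonzero. *)

theory Defs
  imports "HOL-Analysis.Analysis" "HOL-Library.Poly_Mapping" "HOL-Combinatorics.Transposition"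
begin

section \<open>Polynomials\<close>

text \<open>
  Exponents are finitely supported maps from variable indices to \<open>nat\<close>, and polynomials are finitely
  supported real-valued maps on exponents. The variables \<open>x\<^sub>1, \<dots>, x\<^sub>n\<close> carry the indices \<open>1, \<dots>, n\<close>;
  an \<open>n\<close>-tuple of natural numbers is an exponent with support in \<open>{1..n}\<close>.
\<close>

type_synonym expo = "nat \<Rightarrow>\<^sub>0 nat"
type_synonym mpol = "expo \<Rightarrow>\<^sub>0 real"

definition var :: "nat \<Rightarrow> mpol"
  where "var i = Poly_Mapping.single (Poly_Mapping.single i 1) 1"

definition cst :: "real \<Rightarrow> mpol"
  where "cst c = Poly_Mapping.single 0 c"

definition ev :: "mpol \<Rightarrow> (nat \<Rightarrow> real) \<Rightarrow> real"
  where "ev p x = (\<Sum>m\<in>Poly_Mapping.keys p. Poly_Mapping.lookup p m *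
           (\<Prod>i\<in>Poly_Mapping.keys m. x i ^ Poly_Mapping.lookup m i))"


section \<open>The operators\<close>

definition swap_var :: "nat \<Rightarrow> mpol \<Rightarrow> mpol"
  where "swap_var i f = Poly_Mapping.map_key (Poly_Mapping.map_key (Transposition.transpose i (i + 1))) f"

definition qshift :: "real \<Rightarrow> nat \<Rightarrow> mpol \<Rightarrow> mpol"
  where "qshift q i f = Poly_Mapping.mapp (\<lambda>m c. q ^ Poly_Mapping.lookup m i * c) f"

text \<open>The quotient \<open>(s\<^sub>i f - f) / (x\<^sub>i - x\<^sub>i\<^sub>+\<^sub>1)\<close>, which is a polynomial since \<open>s\<^sub>i f - f\<close> vanishes on
  \<open>x\<^sub>i = x\<^sub>i\<^sub>+\<^sub>1\<close>.\<close>

definition ddiff :: "nat \<Rightarrow> mpol \<Rightarrow> mpol"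
  where "ddiff i f = (THE g. (var i - var (i + 1)) * g = swap_var i f - f)"

definition T_op :: "real \<Rightarrow> nat \<Rightarrow> mpol \<Rightarrow> mpol"
  where "T_op t i f = cst t * f + (cst t * var i - var (i + 1)) * ddiff i f"

text \<open>Operator products are compositions, so the rightmost factor acts first.\<close>

definition op_prod :: "('a \<Rightarrow> 'a) list \<Rightarrow> 'a \<Rightarrow> 'a"
  where "op_prod fs = foldr (\<circ>) fs id"

definition omega_op :: "nat \<Rightarrow> real \<Rightarrow> mpol \<Rightarrow> mpol"
  where "omega_op n q = op_prod (map swap_var (rev [1..<n])) \<circ> qshift q 1"

text \<open>For \<open>t \<noteq> 0\<close> the operator \<open>T\<^sub>i\<close> is bijective, because \<open>(T\<^sub>i - t) (T\<^sub>i + 1) = 0\<close>; hence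
  \<open>inv\<close> below is its two-sided inverse.\<close>

definition Y_op :: "nat \<Rightarrow> real \<Rightarrow> real \<Rightarrow> nat \<Rightarrow> mpol \<Rightarrow> mpol"
  where "Y_op n q t i f = cst (t powi (int i - int n)) *
           (op_prod (map (T_op t) [i..<n]) \<circ> omega_op n q
             \<circ> op_prod (map (\<lambda>k. inv (T_op t k)) [1..<i])) f"


section \<open>Orders on tuples\<close>

definition parts_sorted :: "nat \<Rightarrow> (nat \<Rightarrow> nat) \<Rightarrow> nat \<Rightarrow> nat"
  where "parts_sorted n \<eta> i =
           (if i \<in> {1..n} then rev (sort (map \<eta> [1..<n + 1])) ! (i - 1) else 0)"

definition dom_less :: "nat \<Rightarrow> (nat \<Rightarrow> nat) \<Rightarrow> (nat \<Rightarrow> nat) \<Rightarrow> bool"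
  where "dom_less n \<nu> \<eta> \<longleftrightarrow> (\<exists>i\<in>{1..n}. \<nu> i \<noteq> \<eta> i) \<and>
           (\<forall>p\<in>{1..n}. 0 \<le> (\<Sum>i=1..p. int (\<eta> i) - int (\<nu> i)))"

definition prec :: "nat \<Rightarrow> (nat \<Rightarrow> nat) \<Rightarrow> (nat \<Rightarrow> nat) \<Rightarrow> bool"
  where "prec n \<nu> \<eta> \<longleftrightarrow> (\<Sum>i=1..n. \<nu> i) = (\<Sum>i=1..n. \<eta> i) \<and>
           (dom_less n (parts_sorted n \<nu>) (parts_sorted n \<eta>) \<or>
            parts_sorted n \<nu> = parts_sorted n \<eta> \<and> dom_less n \<nu> \<eta>)"

definition leg' :: "nat \<Rightarrow> (nat \<Rightarrow> nat) \<Rightarrow> nat \<Rightarrow> nat"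
  where "leg' n \<eta> i = card {k\<in>{1..<i}. \<eta> k \<ge> \<eta> i} + card {k\<in>{i<..n}. \<eta> k > \<eta> i}"


section \<open>Non-symmetric Macdonald polynomials\<close>

definition is_nonsym_macdonald :: "nat \<Rightarrow> real \<Rightarrow> real \<Rightarrow> expo \<Rightarrow> mpol \<Rightarrow> bool"
  where "is_nonsym_macdonald n q t \<eta> E \<longleftrightarrow>
           Poly_Mapping.lookup E \<eta> = 1 \<and>
           (\<forall>\<nu>\<in>Poly_Mapping.keys E - {\<eta>}. Poly_Mapping.keys \<nu> \<subseteq> {1..n} \<and>
              prec n (Poly_Mapping.lookup \<nu>) (Poly_Mapping.lookup \<eta>)) \<and>
           (\<forall>i\<in>{1..n}. Y_op n q t i E =
              cst (q ^ Poly_Mapping.lookup \<eta> i *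
                   t powi (- int (leg' n (Poly_Mapping.lookup \<eta>) i))) * E)"

definition nonsym_macdonald_gen :: "nat \<Rightarrow> real \<Rightarrow> real \<Rightarrow> expo \<Rightarrow> mpol"
  where "nonsym_macdonald_gen n q t \<eta> = (THE E. is_nonsym_macdonald n q t \<eta> E)"

text \<open>At \<open>t = 1\<close> the polynomial is the coefficientwise limit.\<close>

definition nonsym_macdonald :: "nat \<Rightarrow> real \<Rightarrow> real \<Rightarrow> expo \<Rightarrow> mpol"
  where "nonsym_macdonald n q t \<eta> =
           (if t = 1
            then THE E. \<forall>\<nu>. ((\<lambda>u. Poly_Mapping.lookup (nonsym_macdonald_gen n q u \<eta>) \<nu>)
                               \<longlongrightarrow> Poly_Mapping.lookup E \<nu>) (at 1)
            else nonsym_macdonald_gen n q t \<eta>)"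


section \<open>Basic hypergeometric notation\<close>

definition qpoch_inf :: "real \<Rightarrow> real \<Rightarrow> real"
  where "qpoch_inf z q = prodinf (\<lambda>i. 1 - z * q ^ i)"

definition qpoch :: "real \<Rightarrow> real \<Rightarrow> nat \<Rightarrow> real"
  where "qpoch z q m = (\<Prod>i<m. 1 - z * q ^ i)"

definition qint :: "real \<Rightarrow> (real \<Rightarrow> real) \<Rightarrow> real"
  where "qint q f = (1 - q) * suminf (\<lambda>j. f (q ^ j) * q ^ j)"

text \<open>The iterated integral over \<open>s\<^sub>1, \<dots>, s\<^sub>n\<close>, outermost in \<open>s\<^sub>1\<close>; the value of \<open>s\<close> outside
  \<open>{1..n}\<close> is a dummy.\<close>

primrec qint_iter :: "real \<Rightarrow> nat \<Rightarrow> ((nat \<Rightarrow> real) \<Rightarrow> real) \<Rightarrow> real"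
  where
    "qint_iter q 0 f = f (\<lambda>_. 0)"
  | "qint_iter q (Suc n) f = qint_iter q n (\<lambda>s. qint q (\<lambda>u. f (s(Suc n := u))))"

text \<open>\<open>[q\<^sup>u]\<^sub>\<kappa>\<close>, as a function of the exponent \<open>u\<close>.\<close>

definition qbracket :: "nat \<Rightarrow> real \<Rightarrow> real \<Rightarrow> real \<Rightarrow> (nat \<Rightarrow> nat) \<Rightarrow> real"
  where "qbracket n q t u \<kappa> =
           (\<Prod>i=1..n. \<Prod>j=1..\<kappa> i. t ^ (i - 1) - q powr (real j - 1 + u))"

end

theory Submission
  imports Defs
begin

text \<open>
  Every \<open>E\<^sub>\<eta>\<close> arises from the constant 1 by two kinds of steps: \<open>f \<mapsto> x\<^sub>n \<omega> f\<close>, which sends the composition \<open>\<eta>\<close>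
  to \<open>(\<eta>\<^sub>2, \<dots>, \<eta>\<^sub>n, \<eta>\<^sub>1 + 1)\<close>, and \<open>f \<mapsto> T\<^sub>i f + c f\<close>, which exchanges \<open>\<eta>\<^sub>i < \<eta>\<^sub>i\<^sub>+\<^sub>1\<close>.
  Two functionals on polynomials satisfy \<open>K (T\<^sub>i f) = t K f\<close>: evaluation at \<open>(1, t, \<dots>, t\<^sup>n\<^sup>-\<^sup>1)\<close>, where
  \<open>t x\<^sub>i - x\<^sub>i\<^sub>+\<^sub>1\<close> vanishes, and integration against the weight, by its behaviour under exchange of
  variables. So the quotient of their values at \<open>E\<^sub>\<eta>\<close> is unchanged by the second kind of step. For the
  first kind, the substitution \<open>s \<mapsto> q s\<close> in one variable relates the integrals of \<open>f\<close>, \<open>x\<^sub>1 f\<close>, \<open>\<omega> f\<close>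
  and \<open>x\<^sub>n \<omega> f\<close>; if \<open>Y\<^sub>1 f = e f\<close>, then the integrals of \<open>\<omega> f\<close> and \<open>x\<^sub>1 f\<close> are multiples of those of
  \<open>f\<close> and \<open>x\<^sub>n \<omega> f\<close>, and what remains is the factor that the added box contributes to the quotient of
  brackets.
\<close>


text \<open>E_\<eta> is given by a definite description, through its support and its eigenvalues,
  and for t = 1 by a limit from both sides. So the created polynomials have to be identified with
  it. The eigenvalues follow step by step from Hecke relations between the T_i and omega. The
  supports do not, since \<open>prec\<close> is lost on the way; a stronger relation is carried
  instead. Uniqueness rests on distinct compositions having distinct spectral vectors, which holds
  for t in (0, 1] and slightly above 1. For the limit, creation yields whole families in t,
  continuous at 1. As to the integral, the product over i < j agrees with a polynomial when all s_i
  are powers of q, so integration becomes a linear functional on polynomials that only knows the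
  one-variable moments. The analysis is confined to these: x > 0 makes their series converge, and y
  outside {0, -1, -2, ...} keeps the denominators of the weight nonzero. All else is algebra with
  one recursion for the moments.\<close>

abbreviation "lookup \<equiv> Poly_Mapping.lookup"
abbreviation "keys \<equiv> Poly_Mapping.keys"
abbreviation "single \<equiv> Poly_Mapping.single"

section \<open>Additive maps on polynomials\<close>

lemma poly_mapping_eq_sum_single: "f = (\<Sum>m\<in>keys f. single m (lookup f m))"
proof (rule poly_mapping_eqI)
  fix k
  have "lookup (\<Sum>m\<in>keys f. single m (lookup f m)) k = (\<Sum>m\<in>keys f. if k = m then lookup f k else 0)"
    by (auto simp: lookup_sum lookup_single when_def intro!: sum.cong)
  also have "\<dots> = lookup f k"
    by (auto simp: in_keys_iff)
  finally show "lookup f k = lookup (\<Sum>m\<in>keys f. single m (lookup f m)) k" by simp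
qed

lemma mpol_induct [case_names single add]:
  fixes f :: mpol
  assumes single: "\<And>m c. P (single m c)" and add: "\<And>f g. P f \<Longrightarrow> P g \<Longrightarrow> P (f + g)"
  shows "P f"
proof -
  have "P (\<Sum>m\<in>A. single m (lookup f m))" if "finite A" for A
    using that
  proof (induction A)
    case empty
    have "P (single 0 0)" by (rule single)
    then show ?case by simp
  next
    case (insert x A)
    then show ?case by (simp add: single add)
  qed
  from this[of "keys f"] show ?thesis
    by (simp flip: poly_mapping_eq_sum_single)
qed

lemma additive_eqI:
  fixes A B :: "mpol \<Rightarrow> 'b::ab_group_add"
  assumes "Modules.additive A" "Modules.additive B" "\<And>m c. A (single m c) = B (single m c)"
  shows "A f = B f"
  by (induction f rule: mpol_induct) (simp_all add: assms additive.add)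

lemma additive_mult:
  fixes A :: "mpol \<Rightarrow> 'b::comm_ring"
  assumes A: "Modules.additive A"
    and s: "\<And>m c m' c'. A (single m c * single m' c') = A (single m c) * A (single m' c')"
  shows "A (f * g) = A f * A g"
proof (induction f rule: mpol_induct)
  case (single m c)
  show ?case
    by (induction g rule: mpol_induct) (simp_all add: s distrib_left additive.add[OF A])
next
  case (add f1 f2)
  then show ?case by (simp add: distrib_right additive.add[OF A])
qed

text \<open>The common form of evaluation and of the moment functional, so that additivity is shown
  once for both.\<close>

definition linext :: "(expo \<Rightarrow> real) \<Rightarrow> mpol \<Rightarrow> real"
  where "linext \<phi> f = (\<Sum>m\<in>keys f. lookup f m * \<phi> m)"

lemma linext_superset:
  assumes "finite A" "keys f \<subseteq> A"
  shows "linext \<phi> f = (\<Sum>m\<in>A. lookup f m * \<phi> m)"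
  unfolding linext_def by (rule sum.mono_neutral_left) (use assms in \<open>auto simp: in_keys_iff\<close>)

lemma additive_linext: "Modules.additive (linext \<phi>)"
proof
  fix f g :: mpol
  let ?A = "keys f \<union> keys g"
  have "linext \<phi> (f + g) = (\<Sum>m\<in>?A. lookup (f + g) m * \<phi> m)"
    by (rule linext_superset) (simp_all add: keys_add)
  also have "\<dots> = (\<Sum>m\<in>?A. lookup f m * \<phi> m) + (\<Sum>m\<in>?A. lookup g m * \<phi> m)"
    by (simp add: lookup_add distrib_right sum.distrib)
  also have "\<dots> = linext \<phi> f + linext \<phi> g"
    by (simp add: linext_superset[of ?A])
  finally show "linext \<phi> (f + g) = linext \<phi> f + linext \<phi> g" .
qed

lemma linext_single [simp]: "linext \<phi> (single m c) = c * \<phi> m"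
  by (cases "c = 0") (simp_all add: linext_def)

lemma cst_mult_single [simp]: "cst c * single m d = single m (c * d)"
  by (simp add: cst_def mult_single)

lemma cst_0 [simp]: "cst 0 = 0" and cst_1 [simp]: "cst 1 = 1"
  by (simp_all add: cst_def)

lemma cst_add: "cst (a + b) = cst a + cst b" and cst_diff: "cst (a - b) = cst a - cst b"
  and cst_mult: "cst (a * b) = cst a * cst b" and cst_minus: "cst (- a) = - cst a"
  by (simp_all add: cst_def single_add single_diff mult_single single_uminus)

lemma cst_power: "cst (a ^ k) = cst a ^ k"
  by (induction k) (simp_all add: cst_mult)

lemma cst_cancel: "a \<noteq> 0 \<Longrightarrow> cst (inverse a) * cst a = 1" "a \<noteq> 0 \<Longrightarrow> cst a * cst (inverse a) = 1"
  by (simp_all flip: cst_mult)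

lemma linext_cst_mult: "linext \<phi> (cst c * f) = c * linext \<phi> f"
  by (induction f rule: mpol_induct)
    (simp_all add: distrib_left additive.add[OF additive_linext])

lemma lookup_cst_mult: "lookup (cst c * f) m = c * lookup f m"
  by (induction f rule: mpol_induct)
    (simp_all add: distrib_left lookup_add lookup_single when_def)

lemma var_mult_single: "var i * single m c = single (m + single i 1) c"
  by (simp add: var_def mult_single add.commute)

lemma var_diff_nonzero: "i \<noteq> j \<Longrightarrow> var i - var j \<noteq> 0"
proof
  assume ij: "i \<noteq> j" and "var i - var j = 0"
  then have "lookup (var i) (single i 1) = lookup (var j) (single i 1)" by simp
  moreover have "single j 1 \<noteq> single i (1::nat)"
    using ij by (metis lookup_single_eq lookup_single_not_eq zero_neq_one)
  ultimately show False by (simp add: var_def lookup_single when_def)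
qed


subsection \<open>Evaluation\<close>

lemma ev_linext: "ev p x = linext (\<lambda>m. \<Prod>i\<in>keys m. x i ^ lookup m i) p"
  by (simp add: ev_def linext_def)

lemma expo_prod_superset:
  fixes x :: "nat \<Rightarrow> real"
  assumes "finite A" "keys m \<subseteq> A"
  shows "(\<Prod>i\<in>keys m. x i ^ lookup m i) = (\<Prod>i\<in>A. x i ^ lookup m i)"
  by (rule prod.mono_neutral_left) (use assms in \<open>auto simp: in_keys_iff\<close>)

lemma expo_prod_add:
  fixes x :: "nat \<Rightarrow> real"
  shows "(\<Prod>i\<in>keys (m + m'). x i ^ lookup (m + m') i) =
    (\<Prod>i\<in>keys m. x i ^ lookup m i) * (\<Prod>i\<in>keys m'. x i ^ lookup m' i)"
proof -
  let ?A = "keys m \<union> keys m'"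
  have "(\<Prod>i\<in>keys (m + m'). x i ^ lookup (m + m') i) = (\<Prod>i\<in>?A. x i ^ lookup (m + m') i)"
    by (rule expo_prod_superset) (simp_all add: keys_add)
  then show ?thesis
    by (simp add: expo_prod_superset[of ?A] lookup_add power_add prod.distrib)
qed

lemma additive_ev: "Modules.additive (\<lambda>p. ev p x)"
  unfolding ev_linext by (rule additive_linext)

lemma ev_add: "ev (f + g) x = ev f x + ev g x"
  by (simp add: additive.add[OF additive_ev])

lemma ev_diff: "ev (f - g) x = ev f x - ev g x"
  by (simp add: additive.diff[OF additive_ev])

lemma ev_mult: "ev (f * g) x = ev f x * ev g x"
  by (rule additive_mult[OF additive_ev]) (simp add: mult_single ev_linext expo_prod_add)

lemma ev_cst [simp]: "ev (cst c) x = c"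
  by (simp add: ev_linext cst_def)

lemma ev_1 [simp]: "ev 1 x = 1"
  using ev_cst[of 1] by simp

lemma ev_var [simp]: "ev (var i) x = x i"
  by (simp add: ev_linext var_def)

lemma ev_prod: "ev (prod f A) x = (\<Prod>a\<in>A. ev (f a) x)"
  by (induction A rule: infinite_finite_induct) (simp_all add: ev_mult)


section \<open>Renaming of variables\<close>

abbreviation adj :: "nat \<Rightarrow> nat \<Rightarrow> nat"
  where "adj i \<equiv> Transposition.transpose i (Suc i)"

lemma lookup_map_key: "inj \<pi> \<Longrightarrow> lookup (Poly_Mapping.map_key \<pi> m) k = lookup m (\<pi> k)"
  by (simp add: map_key.rep_eq)

lemma map_key_adj_adj [simp]: "Poly_Mapping.map_key (adj i) (Poly_Mapping.map_key (adj i) m) = m"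
  by (rule poly_mapping_eqI) (simp add: lookup_map_key)

lemma inj_map_key_adj: "inj (Poly_Mapping.map_key (adj i) :: expo \<Rightarrow> expo)"
  by (rule inj_on_inverseI) (rule map_key_adj_adj)

lemma swap_var_eq: "swap_var i f = Poly_Mapping.map_key (Poly_Mapping.map_key (adj i)) f"
  by (simp add: swap_var_def)

lemma swap_var_single [simp]: "swap_var i (single m c) = single (Poly_Mapping.map_key (adj i) m) c"
  unfolding swap_var_eq
  by (rule poly_mapping_eqI) (auto simp: lookup_map_key[OF inj_map_key_adj] lookup_single when_def)

lemma additive_swap_var: "Modules.additive (swap_var i)"
  by standard (simp add: swap_var_eq map_key_plus[OF inj_map_key_adj])

lemmas swap_var_add = additive.add[OF additive_swap_var]
  and swap_var_diff = additive.diff[OF additive_swap_var]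

lemma map_key_add: "inj \<pi> \<Longrightarrow> Poly_Mapping.map_key \<pi> (m + m' :: expo) =
    Poly_Mapping.map_key \<pi> m + Poly_Mapping.map_key \<pi> m'"
  by (rule map_key_plus)

lemma swap_var_mult: "swap_var i (f * g) = swap_var i f * swap_var i g"
  by (rule additive_mult[OF additive_swap_var]) (simp add: mult_single map_key_add)

lemma swap_var_cst [simp]: "swap_var i (cst c) = cst c"
  by (simp add: cst_def)

lemma swap_var_var [simp]: "swap_var i (var j) = var (adj i j)"
proof -
  have "Poly_Mapping.map_key (adj i) (single j 1) = single (adj i j) (1::nat)"
    by (rule poly_mapping_eqI) (auto simp: lookup_map_key lookup_single when_def transpose_eq_iff)
  then show ?thesis by (simp add: var_def)
qed

lemma swap_var_swap_var [simp]: "swap_var i (swap_var i f) = f"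
  by (rule additive_eqI[where A = "\<lambda>f. swap_var i (swap_var i f)"])
    (simp_all add: Modules.additive_def swap_var_add)

section \<open>The rotation omega and its commutation with exchanges of variables\<close>

definition cyc :: "nat \<Rightarrow> nat \<Rightarrow> nat"
  where "cyc n k = (if 1 \<le> k \<and> k < n then k + 1 else if k = n then 1 else k)"

lemma bij_cyc: "n \<ge> 1 \<Longrightarrow> bij (cyc n)"
  by (rule bij_betw_byWitness[where f' = "\<lambda>k. if 1 < k \<and> k \<le> n then k - 1 else if k = 1 then n else k"])
    (auto simp: cyc_def)

lemma inj_cyc: "n \<ge> 1 \<Longrightarrow> inj (cyc n)"
  using bij_cyc bij_is_inj by blast

lemma op_prod_Nil [simp]: "op_prod [] = id"
  by (simp add: op_prod_def)

lemma op_prod_Cons [simp]: "op_prod (f # fs) = f \<circ> op_prod fs"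
  by (simp add: op_prod_def)

lemma op_prod_append: "op_prod (fs @ gs) = op_prod fs \<circ> op_prod gs"
  by (induction fs) (simp_all add: comp_assoc)

text \<open>Precomposition reverses products: the exchange acting last is the first to be applied to
  an index, so \<open>cyc (Suc n)\<close> is \<open>cyc n\<close> after \<open>adj n\<close>. As
  \<open>cyc n\<close> fixes the indices above n, it is injective on all of nat, as
  \<open>map_key\<close> demands.\<close>

lemma op_prod_swap_single:
  assumes "n \<ge> 1"
  shows "op_prod (map swap_var (rev [1..<n])) (single m c) = single (Poly_Mapping.map_key (cyc n) m) c"
  using assms
proof (induction n rule: dec_induct)
  case base
  have "cyc 1 = id" by (auto simp: cyc_def)
  then show ?case by (simp add: map_key_id[unfolded id_def] id_def)
next
  case (step n)
  have "cyc (Suc n) = cyc n \<circ> adj n"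
    using step.hyps by (auto simp: cyc_def fun_eq_iff Transposition.transpose_def)
  from fun_cong[OF this]
  have "Poly_Mapping.map_key (adj n) (Poly_Mapping.map_key (cyc n) m) = Poly_Mapping.map_key (cyc (Suc n)) m"
    using step.hyps by (intro poly_mapping_eqI) (simp add: lookup_map_key inj_cyc)
  then show ?case using step by simp
qed

lemma qshift_single [simp]: "qshift q i (single m c) = single m (q ^ lookup m i * c)"
  by (rule poly_mapping_eqI)
    (auto simp: qshift_def lookup_mapp lookup_single when_def in_keys_iff split: if_splits)

lemma additive_qshift: "Modules.additive (qshift q i)"
proof
  fix f g
  have lk: "lookup (qshift q i h) m = q ^ lookup m i * lookup h m" for h m
    by (simp add: qshift_def lookup_mapp when_def in_keys_iff)
  show "qshift q i (f + g) = qshift q i f + qshift q i g"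
    by (rule poly_mapping_eqI) (simp add: lk lookup_add distrib_left)
qed

lemma additive_op_prod:
  assumes "\<And>A. A \<in> set As \<Longrightarrow> Modules.additive A"
  shows "Modules.additive (op_prod As)"
  using assms
proof (induction As)
  case Nil then show ?case by (simp add: Modules.additive_def)
next
  case (Cons A As)
  then have "Modules.additive A" "Modules.additive (op_prod As)" by auto
  then show ?case by (simp add: Modules.additive_def)
qed

lemma additive_omega: "Modules.additive (omega_op n q)"
proof -
  have "Modules.additive (op_prod (map swap_var (rev [1..<n])))"
    by (rule additive_op_prod) (auto simp: additive_swap_var)
  with additive_qshift[of q 1] show ?thesis by (simp add: Modules.additive_def omega_op_def)
qed

lemmas omega_add = additive.add[OF additive_omega] and omega_diff = additive.diff[OF additive_omega]

lemma omega_single: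
  "n \<ge> 1 \<Longrightarrow> omega_op n q (single m c) = single (Poly_Mapping.map_key (cyc n) m) (q ^ lookup m 1 * c)"
  by (simp only: omega_op_def o_apply qshift_single op_prod_swap_single)

lemma omega_mult: "n \<ge> 1 \<Longrightarrow> omega_op n q (f * g) = omega_op n q f * omega_op n q g"
  by (rule additive_mult[OF additive_omega])
    (simp add: mult_single omega_single map_key_add inj_cyc lookup_add power_add mult_ac)

lemma omega_cst [simp]: "n \<ge> 1 \<Longrightarrow> omega_op n q (cst c) = cst c"
  by (simp add: cst_def omega_single inj_cyc)

lemma omega_1 [simp]: "n \<ge> 1 \<Longrightarrow> omega_op n q 1 = 1"
  using omega_cst[of n q 1] by simp

lemma omega_var_1: assumes "n \<ge> 1" shows "omega_op n q (var 1) = cst q * var n"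
proof -
  have "Poly_Mapping.map_key (cyc n) (single 1 1) = single n (1::nat)"
    using assms by (intro poly_mapping_eqI) (auto simp: lookup_map_key inj_cyc lookup_single when_def cyc_def)
  then show ?thesis using assms by (simp add: var_def omega_single)
qed

lemma omega_var_Suc: assumes "1 \<le> i" "i < n" shows "omega_op n q (var (Suc i)) = var i"
proof -
  have "Poly_Mapping.map_key (cyc n) (single (Suc i) 1) = single i (1::nat)"
    using assms by (intro poly_mapping_eqI) (auto simp: lookup_map_key inj_cyc lookup_single when_def cyc_def)
  then show ?thesis using assms by (simp add: var_def omega_single lookup_single)
qed

lemma swap_omega:
  assumes "1 \<le> i" "Suc i < n"
  shows "swap_var i (omega_op n q f) = omega_op n q (swap_var (Suc i) f)"
proof (rule additive_eqI[where A = "\<lambda>f. swap_var i (omega_op n q f)" and B = "\<lambda>f. omega_op n q (swap_var (Suc i) f)"])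
  fix m :: expo and c :: real
  have eq: "cyc n \<circ> adj i = adj (Suc i) \<circ> cyc n"
    using assms by (auto simp: cyc_def fun_eq_iff Transposition.transpose_def)
  have "Poly_Mapping.map_key (adj i) (Poly_Mapping.map_key (cyc n) m)
      = Poly_Mapping.map_key (cyc n) (Poly_Mapping.map_key (adj (Suc i)) m)"
    using assms fun_cong[OF eq] by (intro poly_mapping_eqI) (simp add: lookup_map_key inj_cyc)
  moreover have "adj (Suc i) 1 = 1" using assms by (simp add: Transposition.transpose_def)
  ultimately show "swap_var i (omega_op n q (single m c)) = omega_op n q (swap_var (Suc i) (single m c))"
    using assms by (simp add: omega_single lookup_map_key)
qed (simp_all add: Modules.additive_def swap_var_add omega_add)

text \<open>One rotation turns the pair (1, 2) into the wrapped pair (n, 1), of which only one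
  variable carries the factor q. Two rotations move it to (n - 1, n), both variables being scaled
  alike.\<close>

lemma swap_omega_omega:
  assumes "2 \<le> n"
  shows "swap_var (n - 1) (omega_op n q (omega_op n q f)) = omega_op n q (omega_op n q (swap_var 1 f))"
proof (rule additive_eqI[where A = "\<lambda>f. swap_var (n - 1) (omega_op n q (omega_op n q f))"
      and B = "\<lambda>f. omega_op n q (omega_op n q (swap_var 1 f))"])
  fix m :: expo and c :: real
  have eq: "cyc n (cyc n (adj (n - 1) k)) = adj 1 (cyc n (cyc n k))" for k
  proof -
    consider "k = 0" | "k = n" | "Suc k = n" | "1 \<le> k" "Suc k < n" | "k > n" by linarith
    then show ?thesis using assms by cases (auto simp: cyc_def Transposition.transpose_def)
  qed
  have "Poly_Mapping.map_key (adj (n - 1)) (Poly_Mapping.map_key (cyc n) (Poly_Mapping.map_key (cyc n) m))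
      = Poly_Mapping.map_key (cyc n) (Poly_Mapping.map_key (cyc n) (Poly_Mapping.map_key (adj 1) m))"
    using assms eq by (intro poly_mapping_eqI) (simp add: lookup_map_key inj_cyc)
  moreover have 2: "omega_op n q (omega_op n q (single m c)) =
      single (Poly_Mapping.map_key (cyc n) (Poly_Mapping.map_key (cyc n) m)) (q ^ lookup m 2 * (q ^ lookup m 1 * c))" for m c
  proof -
    have "cyc n 1 = 2" using assms by (simp add: cyc_def)
    then show ?thesis using assms by (simp only: omega_single lookup_map_key inj_cyc)
  qed
  moreover have "lookup (Poly_Mapping.map_key (adj 1) m) 2 = lookup m 1" "lookup (Poly_Mapping.map_key (adj 1) m) 1 = lookup m 2"
    by (simp_all add: lookup_map_key numeral_2_eq_2)
  ultimately show "swap_var (n - 1) (omega_op n q (omega_op n q (single m c)))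
      = omega_op n q (omega_op n q (swap_var 1 (single m c)))"
    using assms apply (simp only: 2 swap_var_single)
    apply (simp only: mult.left_commute) done
next
  show "Modules.additive (\<lambda>f. swap_var (n - 1) (omega_op n q (omega_op n q f)))"
    by standard (simp only: swap_var_add omega_add)
  show "Modules.additive (\<lambda>f. omega_op n q (omega_op n q (swap_var 1 f)))"
    by standard (simp only: swap_var_add omega_add)
qed

section \<open>The operators $T_i$\<close>

text \<open>If \<nu>_i \<le> \<nu>_(i+1), the quotient is a geometric sum and its product with x_i -
  x_(i+1) telescopes; exchanging the two parts of \<nu> only changes the sign. The bounds on the
  exponents serve later to locate the monomials of T_i x^\<nu>.\<close>

lemma ddiff_single_ex:
  fixes \<nu> :: expo and c :: real
  shows "\<exists>g. (var i - var (Suc i)) * g = swap_var i (single \<nu> c) - single \<nu> c \<and>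
    (\<forall>\<mu>\<in>keys g. (\<forall>k. k \<noteq> i \<and> k \<noteq> Suc i \<longrightarrow> lookup \<mu> k = lookup \<nu> k) \<and>
      lookup \<mu> i + lookup \<mu> (Suc i) + 1 = lookup \<nu> i + lookup \<nu> (Suc i) \<and>
      min (lookup \<nu> i) (lookup \<nu> (Suc i)) \<le> lookup \<mu> i \<and>
      min (lookup \<nu> i) (lookup \<nu> (Suc i)) \<le> lookup \<mu> (Suc i))"
    (is "\<exists>g. ?D * g = _ \<and> (\<forall>\<mu>\<in>keys g. ?Q \<nu> \<mu>)")
proof -
  have main: "\<exists>g. ?D * g = swap_var i (single \<nu> c) - single \<nu> c \<and> (\<forall>\<mu>\<in>keys g. ?Q \<nu> \<mu>)"
    if le: "lookup \<nu> i \<le> lookup \<nu> (Suc i)" for \<nu> :: expo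
  proof -
    define a b where "a = lookup \<nu> i" and "b = lookup \<nu> (Suc i)"
    define r where "r u v = Poly_Mapping.update (Suc i) v (Poly_Mapping.update i u \<nu>)" for u v
    have r: "lookup (r u v) k = (if k = i then u else if k = Suc i then v else lookup \<nu> k)" for u v k
      by (simp add: r_def lookup_update)
    define g where "g = (\<Sum>k<b - a. single (r (a + k) (b - Suc k)) c)"
    define h where "h k = single (r (a + k) (b - k)) c" for k
    have "?D * single (r (a + k) (b - Suc k)) c = h (Suc k) - h k" if "k < b - a" for k
    proof -
      have "r (a + k) (b - Suc k) + single i 1 = r (a + Suc k) (b - Suc k)"
        by (rule poly_mapping_eqI) (simp add: r lookup_add lookup_single when_def)
      moreover have "r (a + k) (b - Suc k) + single (Suc i) 1 = r (a + k) (b - k)"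
        using that by (intro poly_mapping_eqI) (auto simp: r lookup_add lookup_single when_def)
      ultimately show ?thesis by (simp add: left_diff_distrib var_mult_single h_def)
    qed
    then have "?D * g = (\<Sum>k<b - a. h (Suc k) - h k)"
      by (simp add: g_def sum_distrib_left)
    also have "\<dots> = h (b - a) - h 0" by (rule sum_lessThan_telescope)
    also have "h 0 = single \<nu> c"
      unfolding h_def by (intro arg_cong2[where f = single] poly_mapping_eqI) (simp_all add: r a_def b_def)
    also have "h (b - a) = swap_var i (single \<nu> c)"
      using le unfolding h_def swap_var_single
      by (intro arg_cong2[where f = single] poly_mapping_eqI)
        (simp_all add: r a_def b_def lookup_map_key Transposition.transpose_def)
    finally have "?D * g = swap_var i (single \<nu> c) - single \<nu> c" .
    moreover have "?Q \<nu> \<mu>" if "\<mu> \<in> keys g" for \<mu>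
    proof -
      have "\<mu> \<in> (\<Union>k<b - a. keys (single (r (a + k) (b - Suc k)) c))"
        using that keys_sum unfolding g_def by fast
      then obtain k where k: "k < b - a" "\<mu> \<in> keys (single (r (a + k) (b - Suc k)) c)" by blast
      then have "\<mu> = r (a + k) (b - Suc k)" by (simp split: if_splits)
      with k le show ?thesis by (auto simp: r a_def b_def)
    qed
    ultimately show ?thesis by blast
  qed
  show ?thesis
  proof (cases "lookup \<nu> i \<le> lookup \<nu> (Suc i)")
    case True
    then show ?thesis by (rule main)
  next
    case False
    define \<nu>' where "\<nu>' = Poly_Mapping.map_key (adj i) \<nu>"
    have l: "lookup \<nu>' k = lookup \<nu> (adj i k)" for k by (simp add: \<nu>'_def lookup_map_key)
    from False have "lookup \<nu>' i \<le> lookup \<nu>' (Suc i)" by (simp add: l)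
    from main[OF this] obtain g where g: "?D * g = swap_var i (single \<nu>' c) - single \<nu>' c"
      "\<forall>\<mu>\<in>keys g. ?Q \<nu>' \<mu>" by blast
    have "?D * (- g) = swap_var i (single \<nu> c) - single \<nu> c"
      using g(1) by (simp add: \<nu>'_def)
    moreover have "?Q \<nu> \<mu>" if "\<mu> \<in> keys (- g)" for \<mu>
    proof -
      have "\<mu> \<in> keys g" using that by (simp add: in_keys_iff)
      with g(2) have "?Q \<nu>' \<mu>" by blast
      then show ?thesis by (simp add: l Transposition.transpose_def min.commute add.commute)
    qed
    ultimately show ?thesis by blast
  qed
qed

lemma ddiff_ex: "\<exists>g. (var i - var (Suc i)) * g = swap_var i f - f"
proof (induction f rule: mpol_induct)
  case (single m c)
  show ?case using ddiff_single_ex[of i m c] by blast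
next
  case (add f1 f2)
  then obtain g1 g2 where "(var i - var (Suc i)) * g1 = swap_var i f1 - f1"
    "(var i - var (Suc i)) * g2 = swap_var i f2 - f2" by blast
  then have "(var i - var (Suc i)) * (g1 + g2) = swap_var i (f1 + f2) - (f1 + f2)"
    by (simp add: distrib_left swap_var_add)
  then show ?case by blast
qed

text \<open>Polynomials form an integral domain. So \<open>ddiff\<close> is well defined, and
  relations between the T_i may be checked after multiplication by their denominators.\<close>

lemma D_cancel:
  "(var i - var (Suc i)) * g = (var i - var (Suc i)) * h \<Longrightarrow> g = h"
  using var_diff_nonzero[of i "Suc i"] by simp

lemma ddiff_eqI:
  assumes "(var i - var (Suc i)) * g = swap_var i f - f"
  shows "ddiff i f = g"
  unfolding ddiff_def
  by (rule the_equality) (use assms in \<open>auto intro: D_cancel[of i]\<close>)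

lemma D_mult_ddiff: "(var i - var (Suc i)) * ddiff i f = swap_var i f - f"
  using ddiff_ex[of i f] ddiff_eqI[of i _ f] by metis

text \<open>With the denominator cleared, T_i f is a combination of f and s_i f with polynomial
  coefficients; in this form the relations below become identities in a commutative ring.\<close>

lemma D_mult_T: "(var i - var (Suc i)) * T_op t i f =
  (cst t * var i - var (Suc i)) * swap_var i f + (1 - cst t) * var (Suc i) * f"
proof -
  have "(var i - var (Suc i)) * T_op t i f =
      (var i - var (Suc i)) * (cst t * f) + (cst t * var i - var (Suc i)) * ((var i - var (Suc i)) * ddiff i f)"
    by (simp add: T_op_def algebra_simps)
  then show ?thesis by (simp only: D_mult_ddiff) (simp add: algebra_simps)
qed

lemma T_op_eqI:
  assumes "(var i - var (Suc i)) * g =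
    (cst t * var i - var (Suc i)) * swap_var i f + (1 - cst t) * var (Suc i) * f"
  shows "T_op t i f = g"
  by (rule D_cancel[of i]) (simp add: D_mult_T assms)

lemma T_op_1_left: "T_op 1 i f = swap_var i f"
  by (rule T_op_eqI) simp

lemma T_op_add: "T_op t i (f + g) = T_op t i f + T_op t i g"
  by (rule T_op_eqI) (simp only: distrib_left D_mult_T swap_var_add, simp add: algebra_simps)

lemma additive_T_op: "Modules.additive (T_op t i)"
  by standard (rule T_op_add)

lemmas T_op_diff = additive.diff[OF additive_T_op] and T_op_sum = additive.sum[OF additive_T_op]

lemma T_op_mult_symmetric:
  assumes "swap_var i g = g"
  shows "T_op t i (g * f) = g * T_op t i f"
proof (rule T_op_eqI)
  have "(var i - var (Suc i)) * (g * T_op t i f) = g * ((var i - var (Suc i)) * T_op t i f)"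
    by (simp only: mult_ac)
  then show "(var i - var (Suc i)) * (g * T_op t i f) =
      (cst t * var i - var (Suc i)) * swap_var i (g * f) + (1 - cst t) * var (Suc i) * (g * f)"
    by (simp only: D_mult_T swap_var_mult assms) (simp add: algebra_simps)
qed

lemma T_op_cst_mult: "T_op t i (cst c * f) = cst c * T_op t i f"
  by (rule T_op_mult_symmetric) simp

lemma T_op_var_mult: "k \<noteq> i \<Longrightarrow> k \<noteq> Suc i \<Longrightarrow> T_op t i (var k * f) = var k * T_op t i f"
  by (rule T_op_mult_symmetric) (simp add: Transposition.transpose_def)

lemma T_op_1: "T_op t i 1 = cst t"
  by (rule T_op_eqI) (use swap_var_cst[of i 1] in \<open>simp add: algebra_simps\<close>)

lemma D_mult_swap_T: "(var i - var (Suc i)) * swap_var i (T_op t i f) =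
  - (cst t * var (Suc i) - var i) * f - (1 - cst t) * var i * swap_var i f"
proof -
  have "swap_var i ((var i - var (Suc i)) * T_op t i f) =
    swap_var i ((cst t * var i - var (Suc i)) * swap_var i f + (1 - cst t) * var (Suc i) * f)"
    by (simp only: D_mult_T)
  then show ?thesis
    by (simp add: swap_var_mult swap_var_add swap_var_diff algebra_simps swap_var_cst[of i 1, simplified])
qed

text \<open>The quadratic Hecke relation. Both T_i f and s_i T_i f have the denominator x_i -
  x_(i+1), so clearing it twice leaves an identity that is linear in f and s_i f.\<close>

lemma T_op_quadratic: "T_op t i (T_op t i f) = (cst t - 1) * T_op t i f + cst t * f"
proof (rule T_op_eqI, rule D_cancel[of i])
  note 1 = D_mult_T[of i t f] and 2 = D_mult_swap_T[of i t f]
  show "(var i - var (Suc i)) * ((var i - var (Suc i)) * ((cst t - 1) * T_op t i f + cst t * f)) =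
    (var i - var (Suc i)) * ((cst t * var i - var (Suc i)) * swap_var i (T_op t i f) +
      (1 - cst t) * var (Suc i) * T_op t i f)"
    using 1 2 by algebra
qed

text \<open>The rule for carrying a variable past T_i. It moves the factor x_n of \<open>psi\<close>
  through the products that make up the Y_i.\<close>

lemma T_op_var_T_op: "T_op t i (var i * T_op t i f) = cst t * var (Suc i) * f"
proof (rule T_op_eqI, rule D_cancel[of i])
  note 1 = D_mult_T[of i t f] and 2 = D_mult_swap_T[of i t f]
  show "(var i - var (Suc i)) * ((var i - var (Suc i)) * (cst t * var (Suc i) * f)) =
    (var i - var (Suc i)) * ((cst t * var i - var (Suc i)) * swap_var i (var i * T_op t i f) +
      (1 - cst t) * var (Suc i) * (var i * T_op t i f))"
    unfolding swap_var_mult swap_var_var transpose_apply_first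
    using 1 2 by algebra
qed

section \<open>Commutation and braid relations of the T_i, also with omega\<close>

lemma swap_swap_commute: "Suc i < j \<Longrightarrow> swap_var i (swap_var j f) = swap_var j (swap_var i f)"
proof (rule additive_eqI[where A = "\<lambda>f. swap_var i (swap_var j f)" and B = "\<lambda>f. swap_var j (swap_var i f)"])
  fix m :: expo and c :: real
  assume "Suc i < j"
  then have "Poly_Mapping.map_key (adj i) (Poly_Mapping.map_key (adj j) m) = Poly_Mapping.map_key (adj j) (Poly_Mapping.map_key (adj i) m)"
    by (intro poly_mapping_eqI) (auto simp: lookup_map_key Transposition.transpose_def)
  then show "swap_var i (swap_var j (single m c)) = swap_var j (swap_var i (single m c))" by simp
qed (simp_all add: Modules.additive_def swap_var_add)

lemma swap_braid: "swap_var i (swap_var (Suc i) (swap_var i f)) = swap_var (Suc i) (swap_var i (swap_var (Suc i) f))"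
proof (rule additive_eqI[where A = "\<lambda>f. swap_var i (swap_var (Suc i) (swap_var i f))"
    and B = "\<lambda>f. swap_var (Suc i) (swap_var i (swap_var (Suc i) f))"])
  fix m :: expo and c :: real
  have "Poly_Mapping.map_key (adj i) (Poly_Mapping.map_key (adj (Suc i)) (Poly_Mapping.map_key (adj i) m)) =
     Poly_Mapping.map_key (adj (Suc i)) (Poly_Mapping.map_key (adj i) (Poly_Mapping.map_key (adj (Suc i)) m))"
    by (intro poly_mapping_eqI) (auto simp: lookup_map_key Transposition.transpose_def)
  then show "swap_var i (swap_var (Suc i) (swap_var i (single m c))) =
      swap_var (Suc i) (swap_var i (swap_var (Suc i) (single m c)))" by simp
qed (simp_all add: Modules.additive_def swap_var_add)

lemma swap_var_1 [simp]: "swap_var i 1 = 1"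
  using swap_var_cst[of i 1] by simp

lemma T_op_commute:
  assumes "Suc i < j"
  shows "T_op t i (T_op t j f) = T_op t j (T_op t i f)"
proof (rule T_op_eqI, rule D_cancel[of j])
  note 1 = D_mult_T[of i t f] and 2 = D_mult_T[of j t f] and 3 = D_mult_T[of j t "T_op t i f"]
  have 4: "(var j - var (Suc j)) * swap_var i (T_op t j f) =
      (cst t * var j - var (Suc j)) * swap_var i (swap_var j f) + (1 - cst t) * var (Suc j) * swap_var i f"
    using arg_cong[OF D_mult_T[of j t f], of "swap_var i"] assms
    by (simp add: swap_var_mult swap_var_add swap_var_diff Transposition.transpose_def)
  have 5: "(var i - var (Suc i)) * swap_var j (T_op t i f) =
      (cst t * var i - var (Suc i)) * swap_var i (swap_var j f) + (1 - cst t) * var (Suc i) * swap_var j f"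
    using arg_cong[OF D_mult_T[of i t f], of "swap_var j"] assms
    by (simp add: swap_var_mult swap_var_add swap_var_diff Transposition.transpose_def swap_swap_commute[OF assms])
  show "(var j - var (Suc j)) * ((var i - var (Suc i)) * T_op t j (T_op t i f)) =
    (var j - var (Suc j)) * ((cst t * var i - var (Suc i)) * swap_var i (T_op t j f) +
      (1 - cst t) * var (Suc i) * T_op t j f)"
    using 1 2 3 4 5 by algebra
qed

lemma T_omega:
  assumes "1 \<le> i" "Suc i < n"
  shows "T_op t i (omega_op n q f) = omega_op n q (T_op t (Suc i) f)"
proof (rule T_op_eqI)
  have 1: "omega_op n q (var (Suc i)) = var i" "omega_op n q (var (Suc (Suc i))) = var (Suc i)"
    using assms by (simp_all add: omega_var_Suc)
  show "(var i - var (Suc i)) * omega_op n q (T_op t (Suc i) f) =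
    (cst t * var i - var (Suc i)) * swap_var i (omega_op n q f) + (1 - cst t) * var (Suc i) * omega_op n q f"
    using arg_cong[OF D_mult_T[of "Suc i" t f], of "omega_op n q"] assms
    by (simp add: omega_mult omega_add omega_diff 1 swap_omega)
qed

lemma T_omega_omega:
  assumes "2 \<le> n" "q \<noteq> 0"
  shows "T_op t (n - 1) (omega_op n q (omega_op n q f)) = omega_op n q (omega_op n q (T_op t 1 f))"
proof -
  have S: "Suc (n - 1) = n" using assms by simp
  have 1: "omega_op n q (omega_op n q (var 1)) = cst q * var (n - 1)"
    using assms omega_var_Suc[of "n - 1" n q] by (simp add: omega_var_1 omega_mult del: One_nat_def)
  have 2: "omega_op n q (omega_op n q (var 2)) = cst q * var n"
    using assms omega_var_Suc[of 1 n q] by (simp add: omega_var_1 Suc_1 del: One_nat_def)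
  \<comment> \<open>The images of x_1 and x_2 under two rotations share the factor q, so it cancels
    from the whole identity.\<close>
  have "cst q * ((var (n - 1) - var n) * omega_op n q (omega_op n q (T_op t 1 f))) =
    cst q * ((cst t * var (n - 1) - var n) * swap_var (n - 1) (omega_op n q (omega_op n q f))
      + (1 - cst t) * var n * omega_op n q (omega_op n q f))"
    using arg_cong[OF D_mult_T[of 1 t f], of "\<lambda>h. omega_op n q (omega_op n q h)"] assms
    unfolding swap_omega_omega[OF assms(1)]
    by (simp add: omega_mult omega_add omega_diff 1 2 algebra_simps del: One_nat_def)
  moreover have "cst q \<noteq> 0"
    using assms cst_cancel(1)[of q] by auto
  ultimately show ?thesis by (intro T_op_eqI, unfold S) simp
qed

text \<open>With f0 = f, f1 = s_i f, f2 = s_(i+1) f, f12 = s_i s_(i+1) f, f21 = s_(i+1) s_i f and F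
  = s_i s_(i+1) s_i f, this is the braid relation with denominators cleared and all images taken as
  independent ring elements. Here h, g, X are the successive stages of one side, h', g', Y those of
  the other. Multiplying by \<open>?D\<close> eliminates the inner stages in advance, so that the
  last call of \<open>algebra\<close> only has to compare the coefficients of six unknowns.\<close>

lemma braid_identity:
  fixes x y z c :: "'a::idom"
  assumes ne: "x \<noteq> y" "y \<noteq> z" "x \<noteq> z"
    and h: "(x - y) * h = (c * x - y) * f1 + (1 - c) * y * f0"
    and s1h: "(x - y) * s1h = - (c * y - x) * f0 - (1 - c) * x * f1"
    and s2h: "(x - z) * s2h = (c * x - z) * f21 + (1 - c) * z * f2"
    and s12h: "(y - z) * s12h = (c * y - z) * F + (1 - c) * z * f12"
    and g: "(y - z) * g = (c * y - z) * s2h + (1 - c) * z * h"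
    and s1g: "(x - z) * s1g = (c * x - z) * s12h + (1 - c) * z * s1h"
    and X: "(x - y) * X = (c * x - y) * s1g + (1 - c) * y * g"
    and h': "(y - z) * h' = (c * y - z) * f2 + (1 - c) * z * f0"
    and s2h': "(y - z) * s2h' = - (c * z - y) * f0 - (1 - c) * y * f2"
    and s1h': "(x - z) * s1h' = (c * x - z) * f12 + (1 - c) * z * f1"
    and s21h': "(x - y) * s21h' = (c * x - y) * F + (1 - c) * y * f21"
    and g': "(x - y) * g' = (c * x - y) * s1h' + (1 - c) * y * h'"
    and s2g': "(x - z) * s2g' = (c * x - z) * s21h' + (1 - c) * z * s2h'"
    and Y: "(y - z) * Y = (c * y - z) * s2g' + (1 - c) * z * g'"
  shows "X = Y"
proof -
  let ?D = "(x - y) * (x - z) * (y - z)"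
  have "?D * s1g = (x - y) * (y - z) * ((c * x - z) * s12h + (1 - c) * z * s1h)"
    unfolding s1g[symmetric] by (simp add: mult_ac)
  also have "\<dots> = (x - y) * (c * x - z) * ((y - z) * s12h) + (y - z) * (1 - c) * z * ((x - y) * s1h)"
    by (simp add: algebra_simps)
  finally have 1: "?D * s1g = (x - y) * (c * x - z) * ((c * y - z) * F + (1 - c) * z * f12)
      + (y - z) * (1 - c) * z * (- (c * y - x) * f0 - (1 - c) * x * f1)"
    unfolding s12h s1h .
  have "?D * g = (x - y) * (x - z) * ((c * y - z) * s2h + (1 - c) * z * h)"
    unfolding g[symmetric] by (simp add: mult_ac)
  also have "\<dots> = (x - y) * (c * y - z) * ((x - z) * s2h) + (x - z) * (1 - c) * z * ((x - y) * h)"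
    by (simp add: algebra_simps)
  finally have 2: "?D * g = (x - y) * (c * y - z) * ((c * x - z) * f21 + (1 - c) * z * f2)
      + (x - z) * (1 - c) * z * ((c * x - y) * f1 + (1 - c) * y * f0)"
    unfolding s2h h .
  have "?D * s2g' = (x - y) * (y - z) * ((c * x - z) * s21h' + (1 - c) * z * s2h')"
    unfolding s2g'[symmetric] by (simp add: mult_ac)
  also have "\<dots> = (y - z) * (c * x - z) * ((x - y) * s21h') + (x - y) * (1 - c) * z * ((y - z) * s2h')"
    by (simp add: algebra_simps)
  finally have 3: "?D * s2g' = (y - z) * (c * x - z) * ((c * x - y) * F + (1 - c) * y * f21)
      + (x - y) * (1 - c) * z * (- (c * z - y) * f0 - (1 - c) * y * f2)"
    unfolding s21h' s2h' .
  have "?D * g' = (x - z) * (y - z) * ((c * x - y) * s1h' + (1 - c) * y * h')"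
    unfolding g'[symmetric] by (simp add: mult_ac)
  also have "\<dots> = (y - z) * (c * x - y) * ((x - z) * s1h') + (x - z) * (1 - c) * y * ((y - z) * h')"
    by (simp add: algebra_simps)
  finally have 4: "?D * g' = (y - z) * (c * x - y) * ((c * x - z) * f12 + (1 - c) * z * f1)
      + (x - z) * (1 - c) * y * ((c * y - z) * f2 + (1 - c) * z * f0)"
    unfolding s1h' h' .
  have X': "?D * ((x - y) * X) = (c * x - y) * (?D * s1g) + (1 - c) * y * (?D * g)"
    unfolding X by (simp add: algebra_simps)
  have Y': "?D * ((y - z) * Y) = (c * y - z) * (?D * s2g') + (1 - c) * z * (?D * g')"
    unfolding Y by (simp add: algebra_simps)
  have "?D * ((x - y) * (y - z)) * X = (y - z) * (?D * ((x - y) * X))" by (simp only: mult_ac)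
  also have "\<dots> = (x - y) * (?D * ((y - z) * Y))"
    unfolding X' Y' 1 2 3 4 by algebra
  also have "\<dots> = ?D * ((x - y) * (y - z)) * Y" by (simp only: mult_ac)
  finally show ?thesis using ne by simp
qed

lemma T_braid: "T_op t i (T_op t (Suc i) (T_op t i f)) = T_op t (Suc i) (T_op t i (T_op t (Suc i) f))"
proof -
  have ne: "var i \<noteq> var (Suc i)" "var (Suc i) \<noteq> var (Suc (Suc i))" "var i \<noteq> var (Suc (Suc i))"
    using var_diff_nonzero[of i "Suc i"] var_diff_nonzero[of "Suc i" "Suc (Suc i)"] var_diff_nonzero[of i "Suc (Suc i)"]
    by auto
  let ?D = "D_mult_T"
  have s1: "swap_var i (var i) = var (Suc i)" "swap_var i (var (Suc i)) = var i"
    "swap_var i (var (Suc (Suc i))) = var (Suc (Suc i))"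
    and s2: "swap_var (Suc i) (var i) = var i" "swap_var (Suc i) (var (Suc i)) = var (Suc (Suc i))"
    "swap_var (Suc i) (var (Suc (Suc i))) = var (Suc i)"
    by (simp_all add: Transposition.transpose_def)
  note hom = swap_var_mult swap_var_add swap_var_diff swap_var_1 swap_var_cst s1 s2
  have S: "(var i - var (Suc (Suc i))) * swap_var i (T_op t (Suc i) k) =
      (cst t * var i - var (Suc (Suc i))) * swap_var i (swap_var (Suc i) k) + (1 - cst t) * var (Suc (Suc i)) * swap_var i k"
    for k using arg_cong[OF D_mult_T[of "Suc i" t k], of "swap_var i"] unfolding hom .
  have S': "(var i - var (Suc (Suc i))) * swap_var (Suc i) (T_op t i k) =
      (cst t * var i - var (Suc (Suc i))) * swap_var (Suc i) (swap_var i k) + (1 - cst t) * var (Suc (Suc i)) * swap_var (Suc i) k"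
    for k using arg_cong[OF D_mult_T[of i t k], of "swap_var (Suc i)"] unfolding hom .
  have S2: "(var (Suc i) - var (Suc (Suc i))) * swap_var i (swap_var (Suc i) (T_op t i k)) =
      (cst t * var (Suc i) - var (Suc (Suc i))) * swap_var i (swap_var (Suc i) (swap_var i k))
        + (1 - cst t) * var (Suc (Suc i)) * swap_var i (swap_var (Suc i) k)"
    for k using arg_cong[OF S'[of k], of "swap_var i"] unfolding hom .
  have S2': "(var i - var (Suc i)) * swap_var (Suc i) (swap_var i (T_op t (Suc i) k)) =
      (cst t * var i - var (Suc i)) * swap_var i (swap_var (Suc i) (swap_var i k))
        + (1 - cst t) * var (Suc i) * swap_var (Suc i) (swap_var i k)"
    for k using arg_cong[OF S[of k], of "swap_var (Suc i)"] unfolding hom swap_braid .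
  show ?thesis
    by (rule braid_identity[OF ne D_mult_T D_mult_swap_T S' S2 D_mult_T S D_mult_T
        D_mult_T D_mult_swap_T S S2' D_mult_T S' D_mult_T])
qed

lemma inv_intertwine:
  assumes "\<And>f. A (S f) = S' (A f)" "\<And>f. S (inv S f) = f" "\<And>f. inv S' (S' f) = f"
  shows "A (inv S f) = inv S' (A f)"
  by (metis assms)

lemma T_op_inverse:
  assumes "t \<noteq> 0"
  shows "T_op t i (inv (T_op t i) f) = f" and "inv (T_op t i) (T_op t i f) = f"
proof -
  \<comment> \<open>The Hecke relation T^2 = (t - 1) T + t, solved for the inverse of T.\<close>
  define R where "R f = cst (inverse t) * (T_op t i f - (cst t - 1) * f)" for f
  have "swap_var i (cst t - 1) = cst t - 1" by (simp add: swap_var_diff)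
  then have "T_op t i (R f) = cst (inverse t) * (T_op t i (T_op t i f) - (cst t - 1) * T_op t i f)" for f
    by (simp add: R_def T_op_cst_mult T_op_diff T_op_mult_symmetric)
  then have 1: "T_op t i (R f) = f" for f
    by (simp add: T_op_quadratic mult.assoc[symmetric] cst_cancel assms)
  have 2: "R (T_op t i f) = f" for f
    by (simp add: R_def T_op_quadratic mult.assoc[symmetric] cst_cancel assms)
  have "inv (T_op t i) = R" by (rule inv_equality) (simp_all add: 1 2)
  with 1 2 show "T_op t i (inv (T_op t i) f) = f" "inv (T_op t i) (T_op t i f) = f" by auto
qed

lemma inv_T_op_cst_mult: "t \<noteq> 0 \<Longrightarrow> inv (T_op t i) (cst c * f) = cst c * inv (T_op t i) f"
  by (rule inv_intertwine[symmetric, where A = "\<lambda>f. cst c * f"]) (simp_all add: T_op_inverse T_op_cst_mult)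

lemma T_op_commute': "Suc i < j \<or> Suc j < i \<Longrightarrow> T_op t i (T_op t j f) = T_op t j (T_op t i f)"
  by (metis T_op_commute)

lemma inv_T_op_commute:
  assumes "t \<noteq> 0" "Suc i < j \<or> Suc j < i"
  shows "T_op t i (inv (T_op t j) f) = inv (T_op t j) (T_op t i f)"
  using assms by (intro inv_intertwine[where A = "T_op t i"]) (auto simp: T_op_inverse T_op_commute')

section \<open>Products of the T_i and the Cherednik operators Y_i\<close>

definition T_chain :: "real \<Rightarrow> nat \<Rightarrow> nat \<Rightarrow> mpol \<Rightarrow> mpol"
  where "T_chain t i j = op_prod (map (T_op t) [i..<j])"

definition Ti_chain :: "real \<Rightarrow> nat \<Rightarrow> nat \<Rightarrow> mpol \<Rightarrow> mpol"
  where "Ti_chain t i j = op_prod (map (\<lambda>k. inv (T_op t k)) [i..<j])"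

lemma Y_op_eq: "Y_op n q t i f =
    cst (t powi (int i - int n)) * T_chain t i n (omega_op n q (Ti_chain t 1 i f))"
  by (simp add: Y_op_def T_chain_def Ti_chain_def)

lemma T_chain_refl [simp]: "T_chain t i i f = f" and Ti_chain_refl [simp]: "Ti_chain t i i f = f"
  by (simp_all add: T_chain_def Ti_chain_def)

lemma T_chain_Cons: "i < j \<Longrightarrow> T_chain t i j f = T_op t i (T_chain t (Suc i) j f)"
  and Ti_chain_Cons: "i < j \<Longrightarrow> Ti_chain t i j f = inv (T_op t i) (Ti_chain t (Suc i) j f)"
  by (simp_all add: T_chain_def Ti_chain_def upt_conv_Cons)

lemma T_chain_append: "i \<le> k \<Longrightarrow> k \<le> j \<Longrightarrow> T_chain t i j f = T_chain t i k (T_chain t k j f)"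
  and Ti_chain_append: "i \<le> k \<Longrightarrow> k \<le> j \<Longrightarrow> Ti_chain t i j f = Ti_chain t i k (Ti_chain t k j f)"
  using upt_add_eq_append[of i k "j - k"] by (simp_all add: T_chain_def Ti_chain_def op_prod_append)

lemma T_chain_snoc: "i \<le> j \<Longrightarrow> T_chain t i (Suc j) f = T_chain t i j (T_op t j f)"
  and Ti_chain_snoc: "i \<le> j \<Longrightarrow> Ti_chain t i (Suc j) f = Ti_chain t i j (inv (T_op t j) f)"
  by (simp_all add: T_chain_def Ti_chain_def op_prod_append)

lemma op_prod_commute:
  assumes "\<And>S g. S \<in> set Ss \<Longrightarrow> A (S g) = S (A g)"
  shows "A (op_prod Ss g) = op_prod Ss (A g)"
  using assms by (induction Ss) auto

lemma T_chain_cst_mult: "T_chain t i j (cst c * f) = cst c * T_chain t i j f"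
  unfolding T_chain_def by (rule op_prod_commute[symmetric]) (auto simp: T_op_cst_mult)

lemma Ti_chain_cst_mult: "t \<noteq> 0 \<Longrightarrow> Ti_chain t i j (cst c * f) = cst c * Ti_chain t i j f"
  unfolding Ti_chain_def by (rule op_prod_commute[symmetric]) (auto simp: inv_T_op_cst_mult)

lemma omega_cst_mult: "n \<ge> 1 \<Longrightarrow> omega_op n q (cst c * f) = cst c * omega_op n q f"
  by (simp add: omega_mult)

lemma T_T_chain_commute:
  assumes "Suc i < j \<or> m < i"
  shows "T_op t i (T_chain t j m f) = T_chain t j m (T_op t i f)"
  unfolding T_chain_def
proof (rule op_prod_commute)
  fix S g assume "S \<in> set (map (T_op t) [j..<m])"
  then obtain k where "S = T_op t k" "j \<le> k" "k < m" by auto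
  with assms show "T_op t i (S g) = S (T_op t i g)" by (auto intro: T_op_commute')
qed

lemma T_Ti_chain_commute:
  assumes "t \<noteq> 0" "Suc i < j \<or> m < i"
  shows "T_op t i (Ti_chain t j m f) = Ti_chain t j m (T_op t i f)"
  unfolding Ti_chain_def
proof (rule op_prod_commute)
  fix S g assume "S \<in> set (map (\<lambda>k. inv (T_op t k)) [j..<m])"
  then obtain k where "S = inv (T_op t k)" "j \<le> k" "k < m" by auto
  with assms show "T_op t i (S g) = S (T_op t i g)" by (auto simp: inv_T_op_commute)
qed

text \<open>T_(k+1) commutes with the factors before T_k, the braid relation turns T_(k+1) T_k
  T_(k+1) into T_k T_(k+1) T_k, and the T_k on the right commutes with the remaining
  factors.\<close>

lemma T_T_chain_shift:
  assumes "j \<le> k" "Suc k < m"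
  shows "T_op t (Suc k) (T_chain t j m f) = T_chain t j m (T_op t k f)"
proof -
  have split: "T_chain t j m f = T_chain t j k (T_op t k (T_op t (Suc k) (T_chain t (Suc (Suc k)) m f)))" for f
    using assms by (simp add: T_chain_append[of j k m] T_chain_Cons[of k m] T_chain_Cons[of "Suc k" m])
  have "T_chain t (Suc (Suc k)) m (T_op t k f) = T_op t k (T_chain t (Suc (Suc k)) m f)"
    by (rule T_T_chain_commute[symmetric]) simp
  then show ?thesis unfolding split
    by (simp add: T_T_chain_commute[of "Suc k" j k] T_braid)
qed

lemma T_Ti_chain_shift:
  assumes "t \<noteq> 0" "j \<le> k" "Suc k < m"
  shows "T_op t (Suc k) (Ti_chain t j m f) = Ti_chain t j m (T_op t k f)"
proof -
  have split: "Ti_chain t j m f =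
      Ti_chain t j k (inv (T_op t k) (inv (T_op t (Suc k)) (Ti_chain t (Suc (Suc k)) m f)))" for f
    using assms by (simp add: Ti_chain_append[of j k m] Ti_chain_Cons[of k m] Ti_chain_Cons[of "Suc k" m])
  have "T_op t (Suc k) (inv (T_op t k) (inv (T_op t (Suc k)) f)) =
      inv (T_op t k) (inv (T_op t (Suc k)) (T_op t k f))" for f
  proof -
    \<comment> \<open>Writing f as T_(k+1) T_k w removes the inverses and leaves the braid
      relation.\<close>
    define w where "w = inv (T_op t k) (inv (T_op t (Suc k)) f)"
    have "f = T_op t (Suc k) (T_op t k w)" by (simp add: w_def T_op_inverse assms(1))
    then have "T_op t k f = T_op t (Suc k) (T_op t k (T_op t (Suc k) w))" by (simp add: T_braid)
    then show ?thesis by (simp add: T_op_inverse assms(1) flip: w_def)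
  qed
  then show ?thesis unfolding split using assms
    by (simp add: T_Ti_chain_commute)
qed

text \<open>The T_i on the right cancels the last inverse in Y_(i+1), the one on the left prolongs
  its leading product, and the prefactors differ by one power of t.\<close>

lemma Y_step:
  assumes "t \<noteq> 0" "1 \<le> i" "i < n"
  shows "T_op t i (Y_op n q t (Suc i) (T_op t i f)) = cst t * Y_op n q t i f"
proof -
  have "cst (t powi (int (Suc i) - int n)) = cst t * cst (t powi (int i - int n))"
    using power_int_add_1'[of t "int i - int n"] assms
    by (simp flip: cst_mult add: algebra_simps)
  then show ?thesis using assms
    by (simp add: Y_op_eq Ti_chain_snoc T_op_inverse T_op_cst_mult T_chain_Cons[of i n] mult.assoc)
qed

text \<open>On its way to the right T_i gains one index at omega and loses one at the product in
  which T_i occurs: the leading product if j < i, the product of inverses if i + 1 < j. With the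
  other product it commutes.\<close>

lemma T_Y_commute:
  assumes "t \<noteq> 0" "1 \<le> i" "i < n" "1 \<le> j" "j \<le> n" "j \<noteq> i" "j \<noteq> Suc i"
  shows "T_op t i (Y_op n q t j f) = Y_op n q t j (T_op t i f)"
proof (cases "j < i")
  case True
  then obtain k where i: "i = Suc k" by (cases i) auto
  from True assms have "T_op t k (omega_op n q g) = omega_op n q (T_op t i g)" for g
    unfolding i by (intro T_omega) auto
  then show ?thesis using True assms
    by (simp add: Y_op_eq T_op_cst_mult i T_T_chain_shift T_Ti_chain_commute)
next
  case False
  then have "Suc i < j" using assms by auto
  then show ?thesis using assms
    by (simp add: Y_op_eq T_op_cst_mult T_T_chain_commute T_omega T_Ti_chain_shift)
qed

section \<open>The raising step x_n omega and its effect on the Y_i\<close>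

definition psi :: "nat \<Rightarrow> real \<Rightarrow> mpol \<Rightarrow> mpol"
  where "psi n q f = var n * omega_op n q f"

lemma psi_cst_mult: "n \<ge> 1 \<Longrightarrow> psi n q (cst c * f) = cst c * psi n q f"
  by (simp add: psi_def omega_cst_mult mult.left_commute)

lemma T_psi:
  assumes "1 \<le> i" "Suc i < n"
  shows "T_op t i (psi n q f) = psi n q (T_op t (Suc i) f)"
  using assms by (simp add: psi_def T_op_var_mult T_omega)

lemma inv_T_psi:
  assumes "t \<noteq> 0" "1 \<le> i" "Suc i < n"
  shows "inv (T_op t i) (psi n q f) = psi n q (inv (T_op t (Suc i)) f)"
  using assms by (intro inv_intertwine[symmetric, where A = "psi n q"]) (simp_all add: T_psi T_op_inverse)

lemma T_chain_psi:
  assumes "1 \<le> j" "m < n" "j \<le> m"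
  shows "T_chain t j m (psi n q f) = psi n q (T_chain t (Suc j) (Suc m) f)"
  using assms(3,1,2)
  by (induction m arbitrary: f rule: dec_induct) (simp_all add: T_chain_snoc T_psi)

lemma Ti_chain_psi:
  assumes "t \<noteq> 0" "1 \<le> j" "m < n" "j \<le> m"
  shows "Ti_chain t j m (psi n q f) = psi n q (Ti_chain t (Suc j) (Suc m) f)"
  using assms(4,1,2,3)
  by (induction m arbitrary: f rule: dec_induct) (simp_all add: Ti_chain_snoc inv_T_psi)

text \<open>Write g = T_1 g'. Two rotations carry T_1 to T_(n-1), and omega sends x_n to x_(n-1); so
  T_(n-1) x_(n-1) T_(n-1) appears, which is t x_n.\<close>

lemma T_omega_psi:
  assumes "t \<noteq> 0" "q \<noteq> 0" "2 \<le> n"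
  shows "T_op t (n - 1) (omega_op n q (psi n q g)) = cst t * psi n q (omega_op n q (inv (T_op t 1) g))"
proof -
  define g' where "g' = inv (T_op t 1) g"
  have g: "g = T_op t 1 g'" by (simp only: g'_def T_op_inverse(1)[OF assms(1)])
  have S: "Suc (n - 1) = n" using assms by simp
  have "omega_op n q (psi n q g) = var (n - 1) * T_op t (n - 1) (omega_op n q (omega_op n q g'))"
    using assms omega_var_Suc[of "n - 1" n q]
    by (simp only: psi_def g T_omega_omega[OF assms(3,2)] omega_mult) (simp add: omega_mult)
  then show ?thesis
    by (simp only: T_op_var_T_op S psi_def mult.assoc flip: g'_def)
qed

text \<open>The last factor T_(n-1) of the leading product becomes the inverse of T_1 that Y_(j+1)
  has in addition, together with a t that corrects the prefactor. All other factors just gain one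
  index on passing \<open>psi\<close>.\<close>

lemma Y_psi:
  assumes "t \<noteq> 0" "q \<noteq> 0" "1 \<le> j" "j < n"
  shows "Y_op n q t j (psi n q f) = psi n q (Y_op n q t (Suc j) f)"
proof -
  have "Ti_chain t 1 j (psi n q f) = psi n q (Ti_chain t (Suc 1) (Suc j) f)"
    by (rule Ti_chain_psi) (use assms in auto)
  moreover have "2 \<le> n" using assms by simp
  moreover have "inv (T_op t 1) (Ti_chain t (Suc 1) (Suc j) f) = Ti_chain t 1 (Suc j) f"
    using assms Ti_chain_Cons[of 1 "Suc j" t f] by simp
  moreover have "T_chain t j n g = T_chain t j (n - 1) (T_op t (n - 1) g)" for g
    using assms T_chain_snoc[of j "n - 1" t g] by simp
  ultimately have "Y_op n q t j (psi n q f) = cst (t powi (int j - int n)) *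
      T_chain t j (n - 1) (cst t * psi n q (omega_op n q (Ti_chain t 1 (Suc j) f)))"
    by (simp only: Y_op_eq T_omega_psi[OF assms(1,2)])
  also have "\<dots> = cst (t powi (int j - int n)) * cst t *
      psi n q (T_chain t (Suc j) n (omega_op n q (Ti_chain t 1 (Suc j) f)))"
    using assms by (simp add: T_chain_cst_mult T_chain_psi mult.assoc)
  also have "cst (t powi (int j - int n)) * cst t = cst (t powi (int (Suc j) - int n))"
    using power_int_add_1[of t "int j - int n"] assms
    by (simp flip: cst_mult add: algebra_simps)
  also have "\<dots> * psi n q (T_chain t (Suc j) n (omega_op n q (Ti_chain t 1 (Suc j) f))) =
      psi n q (Y_op n q t (Suc j) f)"
    using assms by (simp add: Y_op_eq psi_cst_mult)
  finally show ?thesis .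
qed

lemma inv_T_var:
  assumes "t \<noteq> 0"
  shows "inv (T_op t j) (var (Suc j) * g) = cst (inverse t) * (var j * T_op t j g)"
proof -
  have "T_op t j (cst (inverse t) * (var j * T_op t j g)) = var (Suc j) * g"
    by (simp only: T_op_cst_mult T_op_var_T_op) (simp add: mult.assoc[symmetric] cst_cancel assms)
  then show ?thesis using T_op_inverse(2)[OF assms] by metis
qed

text \<open>Each inverse of T_k takes x_(k+1) to x_k T_k with a factor 1/t, so the product of
  inverses turns into the product of the T_k themselves, to the right of x_1.\<close>

lemma Ti_chain_var:
  assumes "t \<noteq> 0" "1 \<le> j"
  shows "Ti_chain t 1 j (var j * g) = cst (inverse t ^ (j - 1)) * (var 1 * T_chain t 1 j g)"
  using assms(2)
proof (induction j arbitrary: g rule: dec_induct)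
  case base
  then show ?case by simp
next
  case (step j)
  then have "inverse t ^ (Suc j - 1) = inverse t * inverse t ^ (j - 1)" by (cases j) auto
  with step assms show ?case
    by (simp only: Ti_chain_snoc T_chain_snoc inv_T_var[OF assms(1)] Ti_chain_cst_mult[OF assms(1)] cst_mult mult.assoc)
qed

lemma Y_1_eq: "Y_op n q t 1 f = cst (t powi (1 - int n)) * T_chain t 1 n (omega_op n q f)"
  by (simp only: Y_op_eq Ti_chain_refl) simp

lemma powi_1_minus:
  fixes t :: real
  assumes "n \<ge> 1"
  shows "t powi (1 - int n) = inverse t ^ (n - 1)"
proof -
  have "1 - int n = - int (n - 1)" using assms by simp
  then show ?thesis by (simp only: power_int_minus power_int_of_nat power_inverse)
qed

lemma Ti_chain_psi_full:
  assumes "t \<noteq> 0" "n \<ge> 1"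
  shows "Ti_chain t 1 n (psi n q f) = var 1 * Y_op n q t 1 f"
  unfolding psi_def Ti_chain_var[OF assms] Y_1_eq powi_1_minus[OF assms(2)] by (rule mult.left_commute)

text \<open>The product of inverses in Y_n turns x_n omega into x_1 Y_1; then omega maps x_1 to q
  x_n. This q accounts for the box added to the last part.\<close>

lemma Y_n_psi:
  assumes "t \<noteq> 0" "q \<noteq> 0" "n \<ge> 1"
  shows "Y_op n q t n (psi n q f) = cst q * psi n q (Y_op n q t 1 f)"
  by (simp only: Y_op_eq[of n q t n] Ti_chain_psi_full[OF assms(1,3)] omega_mult[OF assms(3)]
    omega_var_1[OF assms(3)]) (simp add: psi_def mult.assoc)

text \<open>Under K every T_i counts as t, so a product of n - 1 of them cancels the prefactor of
  Y_1. The first claim comes from Y_1 f itself, the second from \<open>Ti_chain_psi_full\<close>,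
  where the inverses count as 1/t.\<close>

lemma functional_omega:
  fixes K :: "mpol \<Rightarrow> real"
  assumes t: "t \<noteq> 0" and n: "n \<ge> 1"
    and K_cst: "\<And>c f. K (cst c * f) = c * K f"
    and K_T: "\<And>i f. 1 \<le> i \<Longrightarrow> i < n \<Longrightarrow> K (T_op t i f) = t * K f"
    and Y: "Y_op n q t 1 f = cst e * f"
  shows "K (omega_op n q f) = e * K f"
    and "K (psi n q f) = t ^ (n - 1) * e * K (var 1 * f)"
proof -
  have 1: "K (T_chain t 1 m g) = t ^ (m - 1) * K g" if "1 \<le> m" "m \<le> n" for m g
    using that
  proof (induction m arbitrary: g rule: dec_induct)
    case (step m)
    then have "t ^ (Suc m - 1) = t * t ^ (m - 1)" by (cases m) auto
    with step show ?case by (simp add: T_chain_snoc K_T)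
  qed simp
  have K_inv: "K (inv (T_op t i) f) = inverse t * K f" if "1 \<le> i" "i < n" for i f
    using K_T[OF that, of "inv (T_op t i) f"] t by (simp add: T_op_inverse field_simps)
  have 2: "K (Ti_chain t 1 m g) = inverse t ^ (m - 1) * K g" if "1 \<le> m" "m \<le> n" for m g
    using that
  proof (induction m arbitrary: g rule: dec_induct)
    case (step m)
    then have "inverse t ^ (Suc m - 1) = inverse t * inverse t ^ (m - 1)" by (cases m) auto
    with step show ?case by (simp add: Ti_chain_snoc K_inv)
  qed simp
  have "e * K f = K (Y_op n q t 1 f)" by (simp only: Y K_cst)
  also have "\<dots> = inverse t ^ (n - 1) * (t ^ (n - 1) * K (omega_op n q f))"
    using n by (simp only: Y_1_eq K_cst 1 order_refl powi_1_minus)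
  finally show "K (omega_op n q f) = e * K f" using t by (simp add: power_inverse)
  have "K (Ti_chain t 1 n (psi n q f)) = K (cst e * (var 1 * f))"
    using n by (simp only: Ti_chain_psi_full[OF t] Y mult.left_commute)
  then have "inverse t ^ (n - 1) * K (psi n q f) = e * K (var 1 * f)"
    using n by (simp only: 2 K_cst order_refl)
  then show "K (psi n q f) = t ^ (n - 1) * e * K (var 1 * f)"
    using t by (simp add: power_inverse field_simps)
qed

lemma Y_cst_mult: "t \<noteq> 0 \<Longrightarrow> n \<ge> 1 \<Longrightarrow> Y_op n q t i (cst c * f) = cst c * Y_op n q t i f"
  by (simp add: Y_op_eq Ti_chain_cst_mult omega_cst_mult T_chain_cst_mult mult.left_commute)

lemma inv_T_op_add: "t \<noteq> 0 \<Longrightarrow> inv (T_op t i) (f + g) = inv (T_op t i) f + inv (T_op t i) g"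
  using T_op_inverse(2)[of t i "inv (T_op t i) f + inv (T_op t i) g"]
  by (simp add: T_op_add T_op_inverse)

lemma additive_Y: 
  assumes "t \<noteq> 0"
  shows "Modules.additive (Y_op n q t i)"
proof -
  have "Modules.additive (T_chain t i n)" "Modules.additive (Ti_chain t 1 i)"
    unfolding T_chain_def Ti_chain_def
    by (rule additive_op_prod; use assms in \<open>auto simp: Modules.additive_def T_op_add inv_T_op_add\<close>)+
  then show ?thesis
    by (simp add: Modules.additive_def Y_op_eq[abs_def] omega_add distrib_left)
qed

text \<open>On the span of f and T_i f one has Y_i T_i f = e_(i+1) T_i f + (t - 1) e_i f. Asking for
  T_i f + c f to have the eigenvalue e_(i+1) gives the condition on c; the same c serves Y_(i+1),
  and the other Y_j commute with T_i.\<close>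

lemma Y_intertwiner:
  assumes t: "t \<noteq> 0" and i: "1 \<le> i" "i < n"
    and Y: "\<And>j. 1 \<le> j \<Longrightarrow> j \<le> n \<Longrightarrow> Y_op n q t j f = cst (e j) * f"
    and c: "c * (e (Suc i) - e i) = (t - 1) * e i"
    and j: "1 \<le> j" "j \<le> n"
  shows "Y_op n q t j (T_op t i f + cst c * f) = cst (e (adj i j)) * (T_op t i f + cst c * f)"
proof -
  have add: "Y_op n q t j (T_op t i f + cst c * f) = Y_op n q t j (T_op t i f) + cst c * Y_op n q t j f" for j
    using t i by (simp add: additive.add[OF additive_Y] Y_cst_mult)
  have cc: "cst c * (cst (e (Suc i)) - cst (e i)) = (cst t - 1) * cst (e i)"
    using arg_cong[OF c, of cst] by (simp add: cst_mult cst_diff)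
  have Yt: "cst t * Y_op n q t i g = T_op t i (Y_op n q t (Suc i) (T_op t i g))" for g
    using Y_step[of t i n q g] t i by simp
  have T: "T_op t i f = (cst t - 1) * f + cst t * inv (T_op t i) f"
    using arg_cong[OF T_op_quadratic[of t i "inv (T_op t i) f"], of id]
    by (simp add: T_op_inverse t)
  consider "j = i" | "j = Suc i" | "j \<noteq> i" "j \<noteq> Suc i" by blast
  then show ?thesis
  proof cases
    case 1
    have "Y_op n q t i (T_op t i f) = (cst t - 1) * Y_op n q t i f + cst t * Y_op n q t i (inv (T_op t i) f)"
      using t i Y_cst_mult[of t n q i "t - 1" f]
      by (subst T) (simp add: additive.add[OF additive_Y] Y_cst_mult cst_diff)
    also have "cst t * Y_op n q t i (inv (T_op t i) f) = T_op t i (cst (e (Suc i)) * f)"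
      using Y[of "Suc i"] i by (simp add: Yt T_op_inverse t)
    finally have "Y_op n q t i (T_op t i f) = (cst t - 1) * cst (e i) * f + cst (e (Suc i)) * T_op t i f"
      using Y[of i] i by (simp add: T_op_cst_mult mult.assoc)
    moreover have "Y_op n q t i f = cst (e i) * f" using Y[of i] i by simp
    ultimately show ?thesis using cc unfolding add 1 transpose_apply_first by algebra
  next
    case 2
    have "T_op t i (Y_op n q t (Suc i) (T_op t i f)) = T_op t i (cst (e i) * (T_op t i f - (cst t - 1) * f))"
    proof -
      have "T_op t i (Y_op n q t (Suc i) (T_op t i f)) = cst t * cst (e i) * f"
        using Y[of i] i by (simp add: Yt[symmetric] mult.assoc)
      moreover have "T_op t i (cst (e i) * (T_op t i f - (cst t - 1) * f)) = cst (e i) * (cst t * f)"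
        using T_op_cst_mult[of t i "t - 1" f]
        by (simp add: T_op_cst_mult T_op_diff T_op_quadratic cst_diff)
      ultimately show ?thesis by (simp add: mult_ac)
    qed
    then have "Y_op n q t (Suc i) (T_op t i f) = cst (e i) * (T_op t i f - (cst t - 1) * f)"
      using T_op_inverse(2)[OF t] by metis
    moreover have "Y_op n q t (Suc i) f = cst (e (Suc i)) * f" using Y[of "Suc i"] i by simp
    ultimately show ?thesis using cc unfolding add 2 transpose_apply_second by algebra
  next
    case 3
    then have "Y_op n q t j (T_op t i f) = cst (e j) * T_op t i f"
      using T_Y_commute[of t i n j q f] t i j Y[of j] by (simp add: T_op_cst_mult)
    moreover have "adj i j = j" using 3 by (simp add: Transposition.transpose_def)
    ultimately show ?thesis using Y[of j] j unfolding add by (simp add: algebra_simps)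
  qed
qed

section \<open>Compositions\<close>

lemma bij_betw_adj: "1 \<le> i \<Longrightarrow> i < n \<Longrightarrow> bij_betw (adj i) {1..n} {1..n}"
  by (rule bij_betw_byWitness[where f' = "adj i"]) (auto simp: Transposition.transpose_def)

lemma bij_betw_cyc: "bij_betw (cyc n) {1..n} {1..n}"
  by (rule bij_betw_byWitness[where f' = "\<lambda>k. if 1 < k \<and> k \<le> n then k - 1 else n"])
    (auto simp: cyc_def)

definition rot :: "nat \<Rightarrow> (nat \<Rightarrow> nat) \<Rightarrow> nat \<Rightarrow> nat"
  where "rot n f k = f (cyc n k) + (if k = n then 1 else 0)"

subsection \<open>Leg lengths and sorting\<close>

text \<open>In this form \<open>leg'\<close> is visibly a ranking: it counts the predecessors of i
  when indices are ordered by decreasing parts, ties from left to right.\<close>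

lemma leg'_eq:
  assumes "i \<in> {1..n}"
  shows "leg' n f i = card {k\<in>{1..n}. f k > f i \<or> f k = f i \<and> k < i}"
proof -
  have "{k\<in>{1..n}. f k > f i \<or> f k = f i \<and> k < i} =
      {k\<in>{1..<i}. f k \<ge> f i} \<union> {k\<in>{i<..n}. f k > f i}"
  proof (rule set_eqI)
    fix k
    show "k \<in> {k\<in>{1..n}. f k > f i \<or> f k = f i \<and> k < i} \<longleftrightarrow>
        k \<in> {k\<in>{1..<i}. f k \<ge> f i} \<union> {k\<in>{i<..n}. f k > f i}"
      using assms by (cases k i rule: linorder_cases) auto
  qed
  moreover have "card ({k\<in>{1..<i}. f k \<ge> f i} \<union> {k\<in>{i<..n}. f k > f i}) = leg' n f i"
    unfolding leg'_def by (rule card_Un_disjoint) auto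
  ultimately show ?thesis by (simp only:)
qed

lemma leg'_mono:
  assumes "i \<in> {1..n}" "k \<in> {1..n}" "f k > f i \<or> f k = f i \<and> k < i"
  shows "leg' n f k < leg' n f i"
  unfolding leg'_eq[OF assms(1)] leg'_eq[OF assms(2)]
  by (rule psubset_card_mono) (use assms in auto)

lemma leg'_less: "i \<in> {1..n} \<Longrightarrow> leg' n f i < n"
proof -
  assume i: "i \<in> {1..n}"
  have "card {k\<in>{1..n}. f k > f i \<or> f k = f i \<and> k < i} \<le> card ({1..n} - {i})"
    by (rule card_mono) auto
  then have "leg' n f i \<le> n - 1" using i by (simp add: leg'_eq)
  then show ?thesis using i by auto
qed

lemma bij_betw_leg': "bij_betw (leg' n f) {1..n} {0..<n}"
proof -
  have "inj_on (leg' n f) {1..n}"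
  proof (rule inj_onI)
    fix i k assume "i \<in> {1..n}" "k \<in> {1..n}" "leg' n f i = leg' n f k"
    then show "i = k"
      using leg'_mono[of i n k f] leg'_mono[of k n i f] by (metis less_irrefl linorder_less_linear)
  qed
  moreover have "leg' n f ` {1..n} \<subseteq> {0..<n}" using leg'_less by auto
  moreover from calculation have "leg' n f ` {1..n} = {0..<n}"
    by (intro card_subset_eq) (simp_all add: card_image)
  ultimately show ?thesis by (simp add: bij_betw_def)
qed

lemma bij_betw_Suc_leg': "bij_betw (\<lambda>i. Suc (leg' n f i)) {1..n} {1..n}"
proof -
  have "bij_betw Suc {0..<n} {1..n}"
    by (rule bij_betw_byWitness[where f' = "\<lambda>k. k - 1"]) auto
  from bij_betw_trans[OF bij_betw_leg' this] show ?thesis by (simp add: o_def)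
qed

text \<open>Listing the indices by leg length puts the parts in decreasing order, and a multiset has
  only one such list. Positions count from 1 and leg lengths from 0, hence
  \<open>Suc\<close>.\<close>

lemma parts_sorted_leg':
  assumes "i \<in> {1..n}"
  shows "parts_sorted n f (Suc (leg' n f i)) = f i"
proof -
  define g where "g = inv_into {1..n} (leg' n f)"
  have g: "bij_betw g {0..<n} {1..n}" unfolding g_def by (rule bij_betw_inv_into[OF bij_betw_leg'])
  have g': "g r \<in> {1..n}" "leg' n f (g r) = r" if "r < n" for r
    using that bij_betw_apply[OF g] bij_betw_inv_into_right[OF bij_betw_leg', of r n f] by (auto simp: g_def)
  have gi: "g (leg' n f i) = i"
    unfolding g_def using assms by (rule bij_betw_inv_into_left[OF bij_betw_leg'])
  define ys where "ys = map (\<lambda>r. f (g r)) [0..<n]"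
  have "sorted_wrt (\<ge>) ys"
    unfolding ys_def sorted_wrt_iff_nth_less
  proof (intro allI impI)
    fix a b assume ab: "a < b" "b < length (map (\<lambda>r. f (g r)) [0..<n])"
    then have b: "a < n" "b < n" by auto
    have "f (g b) \<le> f (g a)"
    proof (rule ccontr)
      assume "\<not> f (g b) \<le> f (g a)"
      then have "leg' n f (g b) < leg' n f (g a)"
        using g'(1)[OF b(1)] g'(1)[OF b(2)] by (intro leg'_mono) auto
      then show False using b ab by (simp add: g'(2))
    qed
    then show "map (\<lambda>r. f (g r)) [0..<n] ! a \<ge> map (\<lambda>r. f (g r)) [0..<n] ! b" using ab by simp
  qed
  then have "sorted (rev ys)" by (simp add: sorted_wrt_rev)
  moreover have "mset (rev ys) = mset (map f [1..<n + 1])"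
  proof -
    have "mset (rev ys) = image_mset f (image_mset g (mset_set {0..<n}))"
      by (simp add: ys_def image_mset.compositionality o_def)
    also have "image_mset g (mset_set {0..<n}) = mset_set {1..n}"
      using g by (simp add: bij_betw_def image_mset_mset_set)
    also have "{1..n} = {1..<n + 1}" by auto
    finally show ?thesis by (simp only: mset_map mset_upt)
  qed
  ultimately have "rev (sort (map f [1..<n + 1])) = ys"
    using properties_for_sort[of "rev ys" "map f [1..<n + 1]"] by simp
  then show ?thesis using leg'_less[OF assms, of f] gi
    by (simp add: parts_sorted_def ys_def)
qed

lemma sum_parts_sorted: "(\<Sum>r=1..n. h (parts_sorted n f r)) = (\<Sum>i=1..n. h (f i))"
proof -
  have "(\<Sum>r=1..n. h (parts_sorted n f r)) = (\<Sum>i=1..n. h (parts_sorted n f (Suc (leg' n f i))))"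
    by (rule sum.reindex_bij_betw[OF bij_betw_Suc_leg', symmetric])
  then show ?thesis by (simp add: parts_sorted_leg')
qed

lemma parts_sorted_antimono:
  assumes "1 \<le> r" "r \<le> r'" "r' \<le> n"
  shows "parts_sorted n f r' \<le> parts_sorted n f r"
proof (cases "r = r'")
  case False
  from assms have "r \<in> (\<lambda>i. Suc (leg' n f i)) ` {1..n}" "r' \<in> (\<lambda>i. Suc (leg' n f i)) ` {1..n}"
    unfolding bij_betw_imp_surj_on[OF bij_betw_Suc_leg'] by auto
  then obtain i i' where i: "i \<in> {1..n}" "r = Suc (leg' n f i)" "i' \<in> {1..n}" "r' = Suc (leg' n f i')"
    by blast
  have "\<not> f i < f i'"
  proof
    assume "f i < f i'"
    then have "leg' n f i' < leg' n f i" using i by (intro leg'_mono) auto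
    then show False using i assms by simp
  qed
  with i show ?thesis by (simp add: parts_sorted_leg')
qed simp

text \<open>The product now runs over the boxes of the composition itself, with the leg length in
  the role of the row number, so the effect of a step can be followed without sorting.\<close>

lemma qbracket_parts_sorted:
  "qbracket n q t u (parts_sorted n f) =
    (\<Prod>i=1..n. \<Prod>j=1..f i. t ^ leg' n f i - q powr (real j - 1 + u))"
proof -
  have "qbracket n q t u (parts_sorted n f) = (\<Prod>i=1..n. \<Prod>j=1..parts_sorted n f (Suc (leg' n f i)).
      t ^ (Suc (leg' n f i) - 1) - q powr (real j - 1 + u))"
    unfolding qbracket_def by (rule prod.reindex_bij_betw[OF bij_betw_Suc_leg', symmetric])
  then show ?thesis by (simp add: parts_sorted_leg')
qed

lemma leg'_reindex:
  assumes \<sigma>: "bij_betw \<sigma> {1..n} {1..n}" and j: "j \<in> {1..n}"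
    and key: "\<And>k. k \<in> {1..n} \<Longrightarrow> (f (\<sigma> k) > f (\<sigma> j) \<or> f (\<sigma> k) = f (\<sigma> j) \<and> \<sigma> k < \<sigma> j) =
      (g k > g j \<or> g k = g j \<and> k < j)"
  shows "leg' n g j = leg' n f (\<sigma> j)"
proof -
  have "bij_betw \<sigma> {k\<in>{1..n}. g k > g j \<or> g k = g j \<and> k < j}
      {k\<in>{1..n}. f k > f (\<sigma> j) \<or> f k = f (\<sigma> j) \<and> k < \<sigma> j}"
    using \<sigma> key by (rule bij_betw_Collect)
  moreover have "\<sigma> j \<in> {1..n}" using bij_betw_apply[OF \<sigma> j] .
  ultimately show ?thesis by (simp only: leg'_eq j bij_betw_same_card)
qed

text \<open>For distinct parts the exchange keeps the ranking. For equal neighbours it would not,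
  ties being decided by position.\<close>

lemma leg'_swap:
  assumes "1 \<le> i" "i < n" "f i < f (Suc i)" "j \<in> {1..n}"
  shows "leg' n (\<lambda>k. f (adj i k)) j = leg' n f (adj i j)"
proof (rule leg'_reindex[OF bij_betw_adj[OF assms(1,2)] assms(4)])
  fix k
  show "(f (adj i k) > f (adj i j) \<or> f (adj i k) = f (adj i j) \<and> adj i k < adj i j) =
    (f (adj i k) > f (adj i j) \<or> f (adj i k) = f (adj i j) \<and> k < j)"
    using assms(3) by (cases "k = i"; cases "k = Suc i"; cases "j = i"; cases "j = Suc i") auto
qed

text \<open>At position 1 a part precedes all parts equal to it. At position n it is larger by one
  and so still precedes these, while the parts it has now caught up with still win by
  position.\<close>

lemma leg'_rot:
  assumes "j \<in> {1..n}"
  shows "leg' n (rot n f) j = leg' n f (cyc n j)"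
proof (rule leg'_reindex[OF bij_betw_cyc assms])
  fix k assume "k \<in> {1..n}"
  then show "(f (cyc n k) > f (cyc n j) \<or> f (cyc n k) = f (cyc n j) \<and> cyc n k < cyc n j) =
    (rot n f k > rot n f j \<or> rot n f k = rot n f j \<and> k < j)"
    using assms by (cases "k = n"; cases "j = n") (auto simp: rot_def cyc_def)
qed

lemma qbracket_swap:
  assumes "1 \<le> i" "i < n" "f i < f (Suc i)"
  shows "qbracket n q t u (parts_sorted n (\<lambda>k. f (adj i k))) = qbracket n q t u (parts_sorted n f)"
proof -
  have "qbracket n q t u (parts_sorted n (\<lambda>k. f (adj i k))) =
      (\<Prod>k=1..n. \<Prod>j=1..f (adj i k). t ^ leg' n f (adj i k) - q powr (real j - 1 + u))"
    unfolding qbracket_parts_sorted using assms by (intro prod.cong refl) (simp only: leg'_swap)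
  also have "\<dots> = (\<Prod>k=1..n. \<Prod>j=1..f k. t ^ leg' n f k - q powr (real j - 1 + u))"
    by (rule prod.reindex_bij_betw[OF bij_betw_adj]) (use assms in auto)
  finally show ?thesis by (simp only: qbracket_parts_sorted)
qed

text \<open>The leg lengths being carried along, the only new factor belongs to the added box, for
  which j - 1 = f 1.\<close>

lemma qbracket_rot:
  assumes "n \<ge> 1"
  shows "qbracket n q t u (parts_sorted n (rot n f)) =
    qbracket n q t u (parts_sorted n f) * (t ^ leg' n f 1 - q powr (real (f 1) + u))"
proof -
  let ?g = "\<lambda>k. \<Prod>j=1..f k. t ^ leg' n f k - q powr (real j - 1 + u)"
  have cn: "cyc n n = 1" by (simp add: cyc_def)
  have "qbracket n q t u (parts_sorted n (rot n f)) =
      (\<Prod>k=1..n. ?g (cyc n k) * (if k = n then t ^ leg' n f 1 - q powr (real (f 1) + u) else 1))"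
    unfolding qbracket_parts_sorted
  proof (intro prod.cong refl)
    fix k assume k: "k \<in> {1..n}"
    show "(\<Prod>j=1..rot n f k. t ^ leg' n (rot n f) k - q powr (real j - 1 + u)) =
      ?g (cyc n k) * (if k = n then t ^ leg' n f 1 - q powr (real (f 1) + u) else 1)"
      using cn unfolding leg'_rot[OF k] rot_def by auto
  qed
  also have "\<dots> = (\<Prod>k=1..n. ?g (cyc n k)) * (t ^ leg' n f 1 - q powr (real (f 1) + u))"
    using assms by (simp add: prod.distrib prod.delta)
  also have "(\<Prod>k=1..n. ?g (cyc n k)) = (\<Prod>k=1..n. ?g k)"
    by (rule prod.reindex_bij_betw[OF bij_betw_cyc])
  finally show ?thesis by (simp only: qbracket_parts_sorted)
qed


subsection \<open>A partial order preserved by rotations and raising transpositions\<close>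

text \<open>Extend \<open>f\<close> to the integers by \<open>f (k + n) = f k + 1\<close>, so that \<open>rot\<close> is a shift of the indices.
  Then \<open>threshold n p c f\<close> is the number of all \<open>k \<le> p\<close> with \<open>c \<le> f k\<close>. The relation \<open>prec\<close> itself
  is preserved by neither of the two kinds of steps.\<close>

definition threshold :: "nat \<Rightarrow> nat \<Rightarrow> nat \<Rightarrow> (nat \<Rightarrow> nat) \<Rightarrow> nat"
  where "threshold n p c f = (\<Sum>k=1..n. f k + (if k \<le> p then 1 else 0) - c)"

definition below :: "nat \<Rightarrow> (nat \<Rightarrow> nat) \<Rightarrow> (nat \<Rightarrow> nat) \<Rightarrow> bool"
  where "below n g f \<longleftrightarrow> (\<Sum>k=1..n. g k) = (\<Sum>k=1..n. f k) \<and>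
    (\<forall>p\<le>n. \<forall>c. threshold n p c g \<le> threshold n p c f)"

lemma below_refl: "below n f f"
  by (simp add: below_def)

lemma sum_rot: "n \<ge> 1 \<Longrightarrow> (\<Sum>k=1..n. rot n f k) = Suc (\<Sum>k=1..n. f k)"
  using sum.reindex_bij_betw[OF bij_betw_cyc, of f n] by (simp add: rot_def sum.distrib)

text \<open>Rotation shifts the extended sequence, so p becomes p + 1, and p = n wraps around to p =
  1 at the next lower level. Level 0 has none below it, but there the count depends on the size
  alone.\<close>

lemma below_rot:
  assumes "n \<ge> 1" "below n g f"
  shows "below n (rot n g) (rot n f)"
proof -
  have less: "threshold n p c (rot n f) = threshold n (Suc p) c f" if "p < n" for p c f
  proof -
    have "threshold n p c (rot n f) = (\<Sum>k=1..n. f (cyc n k) + (if cyc n k \<le> Suc p then 1 else 0) - c)"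
      unfolding threshold_def using that by (intro sum.cong refl) (auto simp: rot_def cyc_def)
    then show ?thesis
      unfolding threshold_def by (simp only: sum.reindex_bij_betw[OF bij_betw_cyc, of "\<lambda>k. f k + (if k \<le> Suc p then 1 else 0) - c"])
  qed
  have eq: "threshold n n (Suc c) (rot n f) = threshold n 1 c f" for c f
  proof -
    have "threshold n n (Suc c) (rot n f) = (\<Sum>k=1..n. f (cyc n k) + (if cyc n k \<le> 1 then 1 else 0) - c)"
      unfolding threshold_def using assms(1) by (intro sum.cong refl) (auto simp: rot_def cyc_def)
    then show ?thesis
      unfolding threshold_def by (simp only: sum.reindex_bij_betw[OF bij_betw_cyc, of "\<lambda>k. f k + (if k \<le> 1 then 1 else 0) - c"])
  qed
  have eq0: "threshold n n 0 (rot n f) = (\<Sum>k=1..n. f k) + n + 1" for f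
    using sum_rot[OF assms(1), of f] by (simp add: threshold_def sum_Suc)
  have "threshold n p c (rot n g) \<le> threshold n p c (rot n f)" if "p \<le> n" for p c
  proof (cases "p < n")
    case True
    then show ?thesis using assms(2) by (simp add: less below_def)
  next
    case False
    then have "p = n" using that by simp
    then show ?thesis using assms by (cases c) (simp_all add: eq eq0 below_def)
  qed
  then show ?thesis
    using assms sum_rot[OF assms(1), of g] sum_rot[OF assms(1), of f] by (simp add: below_def)
qed

lemma threshold_Suc:
  assumes "p < n"
  shows "threshold n (Suc p) c f = threshold n p c f + (if c \<le> f (Suc p) then 1 else 0)"
proof -
  have "threshold n (Suc p) c f = (\<Sum>k=1..n. (f k + (if k \<le> p then 1 else 0) - c) +
      (if k = Suc p then (if c \<le> f (Suc p) then 1 else 0) else 0))"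
    unfolding threshold_def by (intro sum.cong refl) auto
  also have "\<dots> = threshold n p c f + (if c \<le> f (Suc p) then 1 else 0)"
    using assms by (simp only: threshold_def sum.distrib) simp
  finally show ?thesis .
qed

lemma threshold_split:
  assumes "1 \<le> i" "i < n"
  shows "threshold n p c f = (\<Sum>k\<in>{1..n} - {i, Suc i}. f k + (if k \<le> p then 1 else 0) - c) +
    ((f i + (if i \<le> p then 1 else 0) - c) + (f (Suc i) + (if Suc i \<le> p then 1 else 0) - c))"
proof -
  have "threshold n p c f = (\<Sum>k\<in>({1..n} - {i, Suc i}) \<union> {i, Suc i}. f k + (if k \<le> p then 1 else 0) - c)"
    unfolding threshold_def using assms by (intro sum.cong) auto
  then show ?thesis by (subst (asm) sum.union_disjoint) auto
qed

text \<open>The compositions occurring in \<open>T\<^sub>i x\<^sup>g\<close>.\<close>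

definition averaged :: "nat \<Rightarrow> (nat \<Rightarrow> nat) \<Rightarrow> (nat \<Rightarrow> nat) \<Rightarrow> bool"
  where "averaged i h g \<longleftrightarrow> (\<forall>k. k \<noteq> i \<and> k \<noteq> Suc i \<longrightarrow> h k = g k) \<and> h i + h (Suc i) = g i + g (Suc i) \<and>
    min (g i) (g (Suc i)) \<le> h i \<and> min (g i) (g (Suc i)) \<le> h (Suc i)"

text \<open>For p \<noteq> i the count treats positions i and i + 1 alike: by convexity averaging
  cannot increase it, and the exchange leaves it unchanged. Only p = i remains; it is compared with
  p = i - 1 if the larger part, now at position i, reaches the level c, and with p = i + 1
  otherwise.\<close>

lemma below_raise:
  assumes i: "1 \<le> i" "i < n" and f: "f i < f (Suc i)" and g: "below n g f" and h: "averaged i h g"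
  shows "below n h (\<lambda>k. f (adj i k))"
proof -
  let ?s = "\<lambda>k. f (adj i k)"
  have s: "?s k = f k" if "k \<noteq> i" "k \<noteq> Suc i" for k
    using that by (simp add: Transposition.transpose_def)
  have sum_split: "(\<Sum>k=1..n. u k) = (\<Sum>k\<in>{1..n} - {i, Suc i}. u k) + (u i + u (Suc i))" for u :: "nat \<Rightarrow> nat"
    using threshold_split[OF i, of 0 0 u] i by (simp add: threshold_def)
  have h_other: "(\<Sum>k\<in>{1..n} - {i, Suc i}. F k (h k)) = (\<Sum>k\<in>{1..n} - {i, Suc i}. F k (g k))" for F :: "nat \<Rightarrow> nat \<Rightarrow> nat"
    using h by (intro sum.cong) (auto simp: averaged_def)
  have s_other: "(\<Sum>k\<in>{1..n} - {i, Suc i}. F k (?s k)) = (\<Sum>k\<in>{1..n} - {i, Suc i}. F k (f k))" for F :: "nat \<Rightarrow> nat \<Rightarrow> nat"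
    by (intro sum.cong) (simp_all add: s)
  have hs: "h i + h (Suc i) = g i + g (Suc i)" "min (g i) (g (Suc i)) \<le> h i" "min (g i) (g (Suc i)) \<le> h (Suc i)"
    using h by (auto simp: averaged_def)
  have size: "(\<Sum>k=1..n. h k) = (\<Sum>k=1..n. ?s k)"
  proof -
    have "(\<Sum>k=1..n. h k) = (\<Sum>k=1..n. g k)"
      unfolding sum_split h_other[of "\<lambda>k x. x"] using hs by simp
    also have "\<dots> = (\<Sum>k=1..n. f k)" using g by (simp add: below_def)
    also have "\<dots> = (\<Sum>k=1..n. ?s k)"
      unfolding sum_split s_other[of "\<lambda>k x. x"] by simp
    finally show ?thesis .
  qed
  have hg: "threshold n p c h \<le> threshold n p c g" if "p \<noteq> i" for p c
    unfolding threshold_split[OF i] h_other[of "\<lambda>k x. x + (if k \<le> p then 1 else 0) - c"]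
    using hs that by auto
  have sf: "threshold n p c ?s = threshold n p c f" if "p \<noteq> i" for p c
    unfolding threshold_split[OF i] s_other[of "\<lambda>k x. x + (if k \<le> p then 1 else 0) - c"]
    using that by auto
  have gf: "threshold n p c g \<le> threshold n p c f" if "p \<le> n" for p c
    using g that by (simp add: below_def)
  have "threshold n p c h \<le> threshold n p c ?s" if p: "p \<le> n" for p c
  proof (cases "p = i")
    case False
    then show ?thesis using hg[of p c] gf[of p c] sf[of p c] p by simp
  next
    case True
    obtain r where r: "i = Suc r" using i by (cases i) auto
    note T = threshold_Suc[of r n c] threshold_Suc[of i n c]
    show ?thesis
    proof (cases "c \<le> f (Suc i)")
      case c: True
      have "threshold n i c h \<le> threshold n r c h + 1" using T(1)[of h] i by (simp add: r)
      also have "\<dots> \<le> threshold n r c f + 1" using hg[of r c] gf[of r c] i r by simp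
      also have "\<dots> = threshold n i c ?s" using T(1)[of ?s] c sf[of r c] i by (simp add: r)
      finally show ?thesis by (simp add: True)
    next
      case c: False
      have "threshold n i c h \<le> threshold n (Suc i) c h" using T(2)[of h] i by simp
      also have "\<dots> \<le> threshold n (Suc i) c f" using hg[of "Suc i" c] gf[of "Suc i" c] i by simp
      also have "\<dots> = threshold n r c f" using T[of f] c f i by (simp add: r)
      also have "\<dots> \<le> threshold n i c ?s" using T(1)[of ?s] sf[of r c] i by (simp add: r)
      finally show ?thesis by (simp add: True)
    qed
  qed
  then show ?thesis using size by (simp add: below_def)
qed

text \<open>Meant for leading coefficients: among the monomials of f only the leading one can
  produce the exchanged exponent under T_i.\<close>

lemma below_raise_leading:
  assumes i: "1 \<le> i" "i < n" and f: "f i < f (Suc i)" and g: "below n g f"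
    and h: "averaged i (\<lambda>k. f (adj i k)) g"
  shows "g = f"
proof -
  have other: "g k = f k" if "k \<noteq> i" "k \<noteq> Suc i" for k
  proof -
    have "f (adj i k) = g k" using h that unfolding averaged_def by blast
    then show ?thesis using that by (simp add: Transposition.transpose_def)
  qed
  have gs: "f (Suc i) + f i = g i + g (Suc i)" "min (g i) (g (Suc i)) \<le> f i"
    using h by (auto simp: averaged_def)
  \<comment> \<open>At this p and this level, positions i and i + 1 contribute 0 for f, hence also
    for g. So g i < f (i + 1) and g (i + 1) \<le> f (i + 1).\<close>
  have "threshold n i (f (Suc i)) g \<le> threshold n i (f (Suc i)) f"
    using g i by (simp add: below_def)
  moreover have "(\<Sum>k\<in>{1..n} - {i, Suc i}. g k + (if k \<le> i then 1 else 0) - f (Suc i)) =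
      (\<Sum>k\<in>{1..n} - {i, Suc i}. f k + (if k \<le> i then 1 else 0) - f (Suc i))"
    by (intro sum.cong refl) (simp add: other)
  ultimately have "(g i + 1 - f (Suc i)) + (g (Suc i) - f (Suc i)) \<le> 0"
    unfolding threshold_split[OF i] using f by simp
  with gs f have "g i = f i" "g (Suc i) = f (Suc i)" by auto
  with other show ?thesis by (metis ext)
qed

section \<open>Comparison with the dominance orders, and a rank for induction\<close>

lemma threshold_eq_sum:
  "p \<le> n \<Longrightarrow> threshold n p c f = threshold n 0 c f + (\<Sum>k=1..p. if c \<le> f k then 1 else 0)"
  by (induction p) (simp_all add: threshold_Suc)

lemma sum_eq_sum_thresholds:
  assumes "\<And>k. k \<in> {1..p} \<Longrightarrow> f k \<le> C"
  shows "(\<Sum>k=1..p. f k) = (\<Sum>c=1..C. \<Sum>k=1..p. if c \<le> f k then 1 else (0::nat))"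
proof -
  have "(\<Sum>c=1..C. \<Sum>k=1..p. if c \<le> f k then 1 else (0::nat)) = (\<Sum>k=1..p. \<Sum>c=1..C. if c \<le> f k then 1 else 0)"
    by (rule sum.swap)
  also have "\<dots> = (\<Sum>k=1..p. f k)"
  proof (intro sum.cong refl)
    fix k assume "k \<in> {1..p}"
    then have "{1..C} \<inter> {c. c \<le> f k} = {1..f k}" using assms[of k] by auto
    then show "(\<Sum>c=1..C. if c \<le> f k then 1 else 0) = f k" by (simp add: sum.If_cases)
  qed
  finally show ?thesis ..
qed

text \<open>The counts at p = 0 are the sums of max(f k - c, 0), and comparing them for all c
  amounts to dominance of the sorted parts. If the sorted parts agree, so do these counts;
  subtracting them leaves the number of k \<le> p with c \<le> f k, and summing over c \<ge> 1 gives
  the partial sums of f.\<close>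

lemma below_imp_prec:
  assumes b: "below n g f" and ne: "\<exists>i\<in>{1..n}. g i \<noteq> f i"
  shows "prec n g f"
proof -
  let ?P = "parts_sorted n"
  have maj: "(\<Sum>k=1..n. g k - c) \<le> (\<Sum>k=1..n. f k - c)" for c
    using b by (auto simp: below_def threshold_def dest: spec[of _ 0])
  have partial: "(\<Sum>i=1..p. ?P g i) \<le> (\<Sum>i=1..p. ?P f i)" if p: "p \<in> {1..n}" for p
  proof -
    \<comment> \<open>With c the p-th largest part of f, the sorted parts of f are at least c up to
      position p and at most c after it, so the estimates below are sharp for f.\<close>
    define c where "c = ?P f p"
    have split: "{1..n} = {1..p} \<union> {p<..n}" "{1..p} \<inter> {p<..n} = {}" using p by auto
    have "(\<Sum>i=1..p. ?P g i) \<le> (\<Sum>i=1..p. c + (?P g i - c))"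
      by (intro sum_mono) simp
    also have "\<dots> = p * c + (\<Sum>i=1..p. ?P g i - c)" by (simp add: sum.distrib)
    also have "\<dots> \<le> p * c + (\<Sum>i=1..n. ?P g i - c)"
      using p by (intro add_left_mono sum_mono2) auto
    also have "\<dots> \<le> p * c + (\<Sum>i=1..n. ?P f i - c)"
      using maj[of c] by (simp only: sum_parts_sorted[of "\<lambda>x. x - c"] add_le_cancel_left)
    also have "(\<Sum>i=1..n. ?P f i - c) = (\<Sum>i=1..p. ?P f i - c) + (\<Sum>i\<in>{p<..n}. ?P f i - c)"
      by (subst split(1), subst sum.union_disjoint) (auto simp: split(2))
    also have "(\<Sum>i\<in>{p<..n}. ?P f i - c) = 0"
      using p parts_sorted_antimono[of p _ n f] by (simp add: c_def)
    also have "p * c + ((\<Sum>i=1..p. ?P f i - c) + 0) = (\<Sum>i=1..p. c + (?P f i - c))"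
      by (simp add: sum.distrib)
    also have "\<dots> = (\<Sum>i=1..p. ?P f i)"
      using p parts_sorted_antimono[of _ p n f] by (intro sum.cong refl) (simp add: c_def)
    finally show ?thesis .
  qed
  have size: "(\<Sum>i=1..n. g i) = (\<Sum>i=1..n. f i)" using b by (simp add: below_def)
  show ?thesis
  proof (cases "?P g = ?P f")
    case False
    then obtain i where "?P g i \<noteq> ?P f i" by auto
    moreover from this have "i \<in> {1..n}" by (auto simp: parts_sorted_def split: if_splits)
    moreover have "0 \<le> (\<Sum>i=1..p. int (?P f i) - int (?P g i))" if "p \<in> {1..n}" for p
      using partial[OF that] by (simp add: sum_subtractf flip: of_nat_sum)
    ultimately have "dom_less n (?P g) (?P f)" unfolding dom_less_def by blast
    then show ?thesis using size by (simp add: prec_def)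
  next
    case True
    have t0: "threshold n 0 c g = threshold n 0 c f" for c
      using sum_parts_sorted[of "\<lambda>x. x - c" n g] sum_parts_sorted[of "\<lambda>x. x - c" n f] True
      by (simp add: threshold_def)
    have "(\<Sum>k=1..p. g k) \<le> (\<Sum>k=1..p. f k)" if p: "p \<in> {1..n}" for p
    proof -
      define C where "C = (\<Sum>k=1..n. f k)"
      have C: "f k \<le> C" "g k \<le> C" if "k \<in> {1..p}" for k
        using that p member_le_sum[of k "{1..n}" f] member_le_sum[of k "{1..n}" g] size by (auto simp: C_def)
      have "(\<Sum>k=1..p. if c \<le> g k then 1 else 0) \<le> (\<Sum>k=1..p. if c \<le> f k then 1 else (0::nat))" for c
        using b p t0[of c] threshold_eq_sum[of p n c f] threshold_eq_sum[of p n c g]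
        unfolding below_def by (metis add_le_cancel_left atLeastAtMost_iff)
      then have "(\<Sum>c=1..C. \<Sum>k=1..p. if c \<le> g k then 1 else (0::nat)) \<le> (\<Sum>c=1..C. \<Sum>k=1..p. if c \<le> f k then 1 else 0)"
        by (rule sum_mono)
      moreover note sum_eq_sum_thresholds[of p f C, OF C(1)] sum_eq_sum_thresholds[of p g C, OF C(2)]
      ultimately show ?thesis by (simp only:)
    qed
    then have "0 \<le> (\<Sum>i=1..p. int (f i) - int (g i))" if "p \<in> {1..n}" for p
      using that by (simp add: sum_subtractf flip: of_nat_sum)
    then have "dom_less n g f" using ne unfolding dom_less_def by blast
    then show ?thesis using size True by (simp add: prec_def)
  qed
qed

definition partial_sums :: "nat \<Rightarrow> (nat \<Rightarrow> nat) \<Rightarrow> nat"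
  where "partial_sums n f = (\<Sum>p=1..n. \<Sum>i=1..p. f i)"

lemma dom_less_partial_sums:
  assumes "dom_less n g f"
  shows "partial_sums n g < partial_sums n f"
proof -
  let ?S = "\<lambda>f p. \<Sum>i=1..p. f i :: nat"
  have le: "?S g p \<le> ?S f p" if "p \<le> n" for p
  proof (cases "p = 0")
    case False
    then have "0 \<le> (\<Sum>i=1..p. int (f i) - int (g i))" using assms that by (auto simp: dom_less_def)
    then show ?thesis by (simp add: sum_subtractf flip: of_nat_sum)
  qed simp
  obtain i where i: "i \<in> {1..n}" "g i \<noteq> f i" using assms by (auto simp: dom_less_def)
  then obtain r where r: "i = Suc r" by (cases i) auto
  have "\<exists>p\<in>{1..n}. ?S g p < ?S f p"
  proof (rule ccontr)
    assume "\<not> ?thesis"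
    then have eq: "?S g p = ?S f p" if "p \<le> n" for p
      using le[OF that] that by (cases "p = 0") (auto simp: not_less intro: antisym)
    from eq[of r] eq[of i] i r show False by simp
  qed
  with le show ?thesis unfolding partial_sums_def
    by (intro sum_strict_mono_ex1) simp_all
qed

text \<open>A numerical height for \<open>prec\<close>, which provides both a termination measure
  and a relation that is evidently transitive.\<close>

definition comp_rank :: "nat \<Rightarrow> (nat \<Rightarrow> nat) \<Rightarrow> nat \<times> nat"
  where "comp_rank n f = (partial_sums n (parts_sorted n f), partial_sums n f)"

lemma prec_comp_rank: "prec n g f \<Longrightarrow> (comp_rank n g, comp_rank n f) \<in> less_than <*lex*> less_than"
  by (auto simp: prec_def comp_rank_def dom_less_partial_sums)

section \<open>Supports\<close>

definition rot_expo :: "nat \<Rightarrow> expo \<Rightarrow> expo"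
  where "rot_expo n m = Poly_Mapping.map_key (cyc n) m + single n 1"

abbreviation swap_expo :: "nat \<Rightarrow> expo \<Rightarrow> expo"
  where "swap_expo i \<equiv> Poly_Mapping.map_key (adj i)"

lemma lookup_rot_expo: "n \<ge> 1 \<Longrightarrow> lookup (rot_expo n m) = rot n (lookup m)"
  by (rule ext) (simp add: rot_expo_def rot_def lookup_add lookup_map_key inj_cyc lookup_single when_def)

lemma lookup_swap_expo: "lookup (swap_expo i m) = (\<lambda>k. lookup m (adj i k))"
  by (rule ext) (simp add: lookup_map_key)

lemma psi_single: "n \<ge> 1 \<Longrightarrow> psi n q (single m c) = single (rot_expo n m) (q ^ lookup m 1 * c)"
  by (simp only: psi_def omega_single var_mult_single rot_expo_def)

lemma psi_add: "psi n q (f + g) = psi n q f + psi n q g"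
  by (simp add: psi_def omega_add distrib_left)

lemma averaged_refl: "averaged i f f"
  by (simp add: averaged_def)

lemma keys_var_mult: "\<mu> \<in> keys (var i * g) \<Longrightarrow> \<exists>\<nu>\<in>keys g. \<mu> = \<nu> + single i 1"
  using keys_mult[of "var i" g] by (auto simp: var_def add.commute split: if_splits)

lemma T_op_eq_ddiff: "T_op t i f = cst t * f + cst t * (var i * ddiff i f) - var (Suc i) * ddiff i f"
  by (simp add: T_op_def algebra_simps)

lemma ddiff_single_keys:
  fixes \<nu> :: expo
  assumes "\<mu> \<in> keys (ddiff i (single \<nu> c))"
  shows "\<And>k. k \<noteq> i \<Longrightarrow> k \<noteq> Suc i \<Longrightarrow> lookup \<mu> k = lookup \<nu> k"
    and "lookup \<mu> i + lookup \<mu> (Suc i) + 1 = lookup \<nu> i + lookup \<nu> (Suc i)"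
    and "min (lookup \<nu> i) (lookup \<nu> (Suc i)) \<le> lookup \<mu> i"
    and "min (lookup \<nu> i) (lookup \<nu> (Suc i)) \<le> lookup \<mu> (Suc i)"
proof -
  from ddiff_single_ex[of i \<nu> c] obtain g where g: "(var i - var (Suc i)) * g = swap_var i (single \<nu> c) - single \<nu> c"
    "\<forall>\<mu>\<in>keys g. (\<forall>k. k \<noteq> i \<and> k \<noteq> Suc i \<longrightarrow> lookup \<mu> k = lookup \<nu> k) \<and>
      lookup \<mu> i + lookup \<mu> (Suc i) + 1 = lookup \<nu> i + lookup \<nu> (Suc i) \<and>
      min (lookup \<nu> i) (lookup \<nu> (Suc i)) \<le> lookup \<mu> i \<and>
      min (lookup \<nu> i) (lookup \<nu> (Suc i)) \<le> lookup \<mu> (Suc i)" by blast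
  have "\<mu> \<in> keys g" using assms ddiff_eqI[OF g(1)] by simp
  with g(2) show "\<And>k. k \<noteq> i \<Longrightarrow> k \<noteq> Suc i \<Longrightarrow> lookup \<mu> k = lookup \<nu> k"
    and "lookup \<mu> i + lookup \<mu> (Suc i) + 1 = lookup \<nu> i + lookup \<nu> (Suc i)"
    and "min (lookup \<nu> i) (lookup \<nu> (Suc i)) \<le> lookup \<mu> i"
    and "min (lookup \<nu> i) (lookup \<nu> (Suc i)) \<le> lookup \<mu> (Suc i)" by blast+
qed

lemma keys_T_single:
  fixes \<nu> :: expo
  assumes "\<mu> \<in> keys (T_op t i (single \<nu> c))"
  shows "averaged i (lookup \<mu>) (lookup \<nu>)"
proof -
  let ?g = "ddiff i (single \<nu> c)"
  have "\<mu> \<in> keys (single \<nu> (t * c)) \<union> keys (cst t * (var i * ?g)) \<union> keys (var (Suc i) * ?g)"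
    using assms keys_diff[of "single \<nu> (t * c) + cst t * (var i * ?g)" "var (Suc i) * ?g"]
      keys_add[of "single \<nu> (t * c)" "cst t * (var i * ?g)"]
    unfolding T_op_eq_ddiff cst_mult_single by blast
  moreover have "keys (cst t * (var i * ?g)) \<subseteq> keys (var i * ?g)"
    by (auto simp: in_keys_iff lookup_cst_mult)
  ultimately consider "\<mu> = \<nu>" | \<kappa> where "\<kappa> \<in> keys ?g" "\<mu> = \<kappa> + single i 1"
    | \<kappa> where "\<kappa> \<in> keys ?g" "\<mu> = \<kappa> + single (Suc i) 1"
    using keys_var_mult[of \<mu> i ?g] keys_var_mult[of \<mu> "Suc i" ?g] by (auto split: if_splits)
  then show ?thesis
  proof cases
    case 1
    then show ?thesis by (simp add: averaged_refl)
  next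
    case 2
    then show ?thesis using ddiff_single_keys[OF 2(1)]
      by (auto simp: averaged_def lookup_add lookup_single when_def)
  next
    case 3
    then show ?thesis using ddiff_single_keys[OF 3(1)]
      by (auto simp: averaged_def lookup_add lookup_single when_def)
  qed
qed

text \<open>In the exchanged exponent the part at i + 1 is the smaller of the two, and every
  monomial of x_(i+1) times the quotient exceeds it there. So the coefficient comes from x_i times
  the quotient alone and can be read off from s_i x^\<nu> - x^\<nu>.\<close>

lemma lookup_T_single_raise:
  fixes \<nu> :: expo
  assumes less: "lookup \<nu> i < lookup \<nu> (Suc i)"
  shows "lookup (T_op t i (single \<nu> c)) (swap_expo i \<nu>) = t * c"
proof -
  let ?g = "ddiff i (single \<nu> c)" and ?\<sigma> = "swap_expo i \<nu>"
  have "lookup ?\<sigma> i \<noteq> lookup \<nu> i" using less by (simp add: lookup_map_key)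
  then have ne: "\<nu> \<noteq> ?\<sigma>" by metis
  have 0: "lookup (var (Suc i) * ?g) ?\<sigma> = 0"
  proof (rule ccontr)
    assume "lookup (var (Suc i) * ?g) ?\<sigma> \<noteq> 0"
    then obtain \<mu> where \<mu>: "\<mu> \<in> keys ?g" "?\<sigma> = \<mu> + single (Suc i) 1"
      using keys_var_mult[of ?\<sigma> "Suc i" ?g] by (auto simp: in_keys_iff)
    have "lookup \<nu> i = lookup ?\<sigma> (Suc i)" by (simp add: lookup_map_key)
    also have "\<dots> = lookup \<mu> (Suc i) + 1" by (simp add: \<mu>(2) lookup_add)
    finally show False using ddiff_single_keys(4)[OF \<mu>(1)] less by simp
  qed
  have "lookup ((var i - var (Suc i)) * ?g) ?\<sigma> = c"
    unfolding D_mult_ddiff using ne by (simp add: lookup_minus lookup_single when_def)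
  then have "lookup (var i * ?g) ?\<sigma> = c" using 0 by (simp add: left_diff_distrib lookup_minus)
  then show ?thesis
    using 0 ne by (simp add: T_op_eq_ddiff lookup_minus lookup_add lookup_cst_mult lookup_single when_def)
qed

lemma keys_additive:
  fixes A :: "mpol \<Rightarrow> mpol"
  assumes "Modules.additive A"
  shows "keys (A f) \<subseteq> (\<Union>m\<in>keys f. keys (A (single m (lookup f m))))"
proof -
  have "A f = (\<Sum>m\<in>keys f. A (single m (lookup f m)))"
    using additive.sum[OF assms] poly_mapping_eq_sum_single[of f] by metis
  then show ?thesis using keys_sum by metis
qed

definition supported_below :: "nat \<Rightarrow> expo \<Rightarrow> mpol \<Rightarrow> bool"
  where "supported_below n \<eta> f \<longleftrightarrow> lookup f \<eta> = 1 \<and>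
    (\<forall>\<nu>\<in>keys f. keys \<nu> \<subseteq> {1..n} \<and> below n (lookup \<nu>) (lookup \<eta>))"

lemma keys_rot_expo:
  assumes "n \<ge> 1" "keys m \<subseteq> {1..n}"
  shows "keys (rot_expo n m) \<subseteq> {1..n}"
proof
  fix k assume "k \<in> keys (rot_expo n m)"
  then have "lookup m (cyc n k) \<noteq> 0 \<or> k = n"
    using assms by (auto simp: in_keys_iff lookup_rot_expo rot_def split: if_splits)
  then show "k \<in> {1..n}" using assms by (auto simp: cyc_def subset_iff in_keys_iff split: if_splits)
qed

lemma inj_rot_expo: "n \<ge> 1 \<Longrightarrow> inj (rot_expo n)"
proof (rule injI)
  fix m m' assume n: "n \<ge> 1" and eq: "rot_expo n m = rot_expo n m'"
  have "lookup m (cyc n k) = lookup m' (cyc n k)" for k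
    using arg_cong[OF eq, of "\<lambda>m. lookup m k"] n by (simp add: lookup_rot_expo rot_def)
  then have "lookup m k = lookup m' k" for k
    using bij_cyc[OF n] by (metis bij_pointE)
  then show "m = m'" by (rule poly_mapping_eqI)
qed

lemma supported_below_psi:
  assumes n: "n \<ge> 1" and q: "q \<noteq> 0" and f: "supported_below n \<eta> f"
  shows "supported_below n (rot_expo n \<eta>) (cst (inverse (q ^ lookup \<eta> 1)) * psi n q f)"
proof -
  have "lookup (psi n q f) (rot_expo n m) = q ^ lookup m 1 * lookup f m" for m
  proof (induction f rule: mpol_induct)
    case (single m' c)
    then show ?case
      using n inj_rot_expo[OF n] by (auto simp: psi_single lookup_single when_def inj_eq simp del: One_nat_def)
  qed (simp add: psi_add lookup_add distrib_left)
  then have "lookup (cst (inverse (q ^ lookup \<eta> 1)) * psi n q f) (rot_expo n \<eta>) = 1"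
    using f q by (simp add: lookup_cst_mult supported_below_def)
  moreover have "keys \<nu> \<subseteq> {1..n} \<and> below n (lookup \<nu>) (lookup (rot_expo n \<eta>))"
    if "\<nu> \<in> keys (cst (inverse (q ^ lookup \<eta> 1)) * psi n q f)" for \<nu>
  proof -
    have "\<nu> \<in> keys (psi n q f)" using that by (auto simp: in_keys_iff lookup_cst_mult)
    moreover have "Modules.additive (psi n q)" by standard (rule psi_add)
    ultimately obtain m where m: "m \<in> keys f" "\<nu> = rot_expo n m"
      using keys_additive[of "psi n q" f] n by (fastforce simp: psi_single split: if_splits)
    then have "keys m \<subseteq> {1..n}" "below n (lookup m) (lookup \<eta>)" using f by (auto simp: supported_below_def)
    then show ?thesis using n m(2) by (simp add: keys_rot_expo lookup_rot_expo below_rot del: One_nat_def)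
  qed
  ultimately show ?thesis by (simp add: supported_below_def)
qed

lemma keys_averaged:
  assumes "1 \<le> i" "i < n" "averaged i (lookup \<mu>) (lookup \<nu>)" "keys \<nu> \<subseteq> {1..n}"
  shows "keys \<mu> \<subseteq> {1..n}"
proof
  fix k assume k: "k \<in> keys \<mu>"
  show "k \<in> {1..n}"
  proof (cases "k = i \<or> k = Suc i")
    case False
    then have "lookup \<mu> k = lookup \<nu> k" using assms(3) by (auto simp: averaged_def)
    with k have "k \<in> keys \<nu>" by (simp add: in_keys_iff)
    with assms(4) show ?thesis by blast
  qed (use assms in auto)
qed

text \<open>The leading monomial of the result arises only from that of f, with coefficient t by
  \<open>lookup_T_single_raise\<close>; division by t restores 1. The summand c f does not contain
  it.\<close>

lemma supported_below_raise:
  assumes t: "t \<noteq> 0" and i: "1 \<le> i" "i < n" and less: "lookup \<eta> i < lookup \<eta> (Suc i)"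
    and f: "supported_below n \<eta> f"
  shows "supported_below n (swap_expo i \<eta>) (cst (inverse t) * (T_op t i f + cst c * f))"
proof -
  let ?\<sigma> = "swap_expo i \<eta>"
  have ls: "lookup ?\<sigma> = (\<lambda>k. lookup \<eta> (adj i k))" by (rule lookup_swap_expo)
  have fk: "keys m \<subseteq> {1..n}" "below n (lookup m) (lookup \<eta>)" if "m \<in> keys f" for m
    using f that by (auto simp: supported_below_def)
  have lead: "m = \<eta>" if "m \<in> keys f" "averaged i (lookup ?\<sigma>) (lookup m)" for m
  proof -
    have "lookup m = lookup \<eta>"
      using below_raise_leading[OF i less fk(2)[OF that(1)]] that(2) unfolding ls .
    then show ?thesis by (simp only: lookup_inject)
  qed
  have ne: "?\<sigma> \<noteq> \<eta>"
  proof
    assume "?\<sigma> = \<eta>"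
    then have "lookup ?\<sigma> i = lookup \<eta> i" by (rule arg_cong)
    then have "lookup \<eta> (adj i i) = lookup \<eta> i" unfolding ls .
    with less show False by simp
  qed
  have f\<sigma>: "lookup f ?\<sigma> = 0"
  proof (rule ccontr)
    assume "lookup f ?\<sigma> \<noteq> 0"
    then have "?\<sigma> \<in> keys f" by (simp add: in_keys_iff)
    then show False using lead[OF _ averaged_refl] ne by simp
  qed
  have "T_op t i f = (\<Sum>m\<in>keys f. T_op t i (single m (lookup f m)))"
    using T_op_sum[of t i "\<lambda>m. single m (lookup f m)" "keys f"]
    by (simp only: poly_mapping_eq_sum_single[symmetric])
  then have "lookup (T_op t i f) ?\<sigma> = (\<Sum>m\<in>keys f. lookup (T_op t i (single m (lookup f m))) ?\<sigma>)"
    by (simp add: lookup_sum)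
  also have "\<dots> = (\<Sum>m\<in>keys f. if m = \<eta> then t else 0)"
  proof (intro sum.cong refl)
    fix m assume m: "m \<in> keys f"
    show "lookup (T_op t i (single m (lookup f m))) ?\<sigma> = (if m = \<eta> then t else 0)"
    proof (cases "m = \<eta>")
      case True
      then show ?thesis using less f by (simp add: lookup_T_single_raise supported_below_def)
    next
      case False
      then have "?\<sigma> \<notin> keys (T_op t i (single m (lookup f m)))"
        using lead[OF m keys_T_single] by (rule contrapos_nn)
      then show ?thesis using False by (simp add: in_keys_iff)
    qed
  qed
  also have "\<dots> = t" using f by (simp add: supported_below_def in_keys_iff)
  finally have "lookup (cst (inverse t) * (T_op t i f + cst c * f)) ?\<sigma> = 1"
    using t f\<sigma> by (simp add: lookup_cst_mult lookup_add)
  moreover have "keys \<nu> \<subseteq> {1..n} \<and> below n (lookup \<nu>) (lookup ?\<sigma>)"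
    if "\<nu> \<in> keys (cst (inverse t) * (T_op t i f + cst c * f))" for \<nu>
  proof -
    have "\<nu> \<in> keys (T_op t i f) \<or> \<nu> \<in> keys f"
      using that by (auto simp: in_keys_iff lookup_cst_mult lookup_add)
    then obtain m where m: "m \<in> keys f" "averaged i (lookup \<nu>) (lookup m)"
    proof
      assume "\<nu> \<in> keys (T_op t i f)"
      then obtain m where "m \<in> keys f" "\<nu> \<in> keys (T_op t i (single m (lookup f m)))"
        using keys_additive[OF additive_T_op[of t i], of f] by blast
      then show thesis using keys_T_single that by blast
    next
      assume "\<nu> \<in> keys f"
      then show thesis by (rule that) (rule averaged_refl)
    qed
    show ?thesis
      unfolding ls using keys_averaged[OF i m(2) fk(1)[OF m(1)]] below_raise[OF i less fk(2)[OF m(1)] m(2)] by (rule conjI)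
  qed
  ultimately show ?thesis by (simp add: supported_below_def)
qed


section \<open>Spectral vectors\<close>

definition spec :: "nat \<Rightarrow> real \<Rightarrow> real \<Rightarrow> (nat \<Rightarrow> nat) \<Rightarrow> nat \<Rightarrow> real"
  where "spec n q t f i = q ^ f i * t powi (- int (leg' n f i))"

lemma spec_eq: "spec n q t f i = q ^ f i * inverse t ^ leg' n f i"
  by (simp add: spec_def power_int_minus power_inverse)

lemma spec_rot: "j \<in> {1..n} \<Longrightarrow> spec n q t (rot n f) j = (if j = n then q else 1) * spec n q t f (cyc n j)"
  by (simp only: spec_eq leg'_rot) (simp add: rot_def)

lemma spec_swap:
  "1 \<le> i \<Longrightarrow> i < n \<Longrightarrow> f i < f (Suc i) \<Longrightarrow> j \<in> {1..n} \<Longrightarrow>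
    spec n q t (\<lambda>k. f (adj i k)) j = spec n q t f (adj i j)"
  by (simp only: spec_eq leg'_swap)

text \<open>For these \<open>t\<close>, which include \<open>(0, 1]\<close> and a neighbourhood of 1, the spectral vectors
  of distinct compositions are distinct.\<close>

definition generic :: "nat \<Rightarrow> real \<Rightarrow> real \<Rightarrow> bool"
  where "generic n q t \<longleftrightarrow> 0 < q \<and> q < 1 \<and> 0 < t \<and> q * t ^ n < 1"

lemma generic_power:
  assumes "generic n q t" "1 \<le> m" "d \<le> n"
  shows "q ^ m * t ^ d < 1"
proof -
  have qm: "q ^ m \<le> q" using assms power_decreasing[of 1 m q] by (simp add: generic_def)
  show ?thesis
  proof (cases "t \<le> 1")
    case True
    then have "q ^ m * t ^ d \<le> q * 1"
      using assms qm by (intro mult_mono) (auto simp: generic_def power_le_one)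
    then show ?thesis using assms by (simp add: generic_def)
  next
    case False
    then have "q ^ m * t ^ d \<le> q * t ^ n"
      using assms qm by (intro mult_mono power_increasing) (auto simp: generic_def)
    then show ?thesis using assms by (simp add: generic_def)
  qed
qed

text \<open>The larger part has the smaller leg length, so the quotient of the two values is q^m t^d
  with m \<ge> 1 and d \<le> n, which \<open>generic\<close> keeps below 1. This makes the
  denominators of the raising step nonzero.\<close>

lemma spec_less:
  assumes g: "generic n q t" and ij: "i \<in> {1..n}" "j \<in> {1..n}" and less: "f i < f j"
  shows "spec n q t f j < spec n q t f i"
proof -
  have t: "0 < t" "0 < q" using g by (auto simp: generic_def)
  have l: "leg' n f j < leg' n f i" using ij less by (intro leg'_mono) auto
  define d m where "d = leg' n f i - leg' n f j" and "m = f j - f i"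
  have dm: "leg' n f i = leg' n f j + d" "f j = f i + m" "1 \<le> m" "d \<le> n"
    using l less leg'_less[OF ij(1), of f] by (auto simp: d_def m_def)
  have "q ^ m < inverse t ^ d"
    using generic_power[OF g dm(3,4)] t by (simp add: power_inverse field_simps)
  then have "q ^ f i * inverse t ^ leg' n f j * q ^ m < q ^ f i * inverse t ^ leg' n f j * inverse t ^ d"
    using t by (intro mult_strict_left_mono) auto
  then show ?thesis by (simp add: spec_eq dm power_add mult_ac)
qed

text \<open>For t < 1 the spectral values increase strictly along the ranking, so they determine the
  leg lengths and then the parts. For t \<ge> 1 the value at i is above q^(f i + 1) and at most q^(f
  i), so it determines the part by itself.\<close>

lemma spec_inj:
  assumes g: "generic n q t" and eq: "\<And>i. i \<in> {1..n} \<Longrightarrow> spec n q t f i = spec n q t g i"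
    and i: "i \<in> {1..n}"
  shows "f i = g i"
proof (cases "t < 1")
  case True
  have t: "0 < t" "0 < q" "q < 1" using g by (auto simp: generic_def)
  have less: "spec n q t f k < spec n q t f i"
    if "k \<in> {1..n}" "i \<in> {1..n}" "f k > f i \<or> f k = f i \<and> k < i" for f i k
  proof -
    have "q ^ f k \<le> q ^ f i" using that t by (intro power_decreasing) auto
    moreover have "inverse t ^ leg' n f k < inverse t ^ leg' n f i"
      using leg'_mono[OF that(2,1,3)] True t by (intro power_strict_increasing) (auto simp: one_less_inverse)
    ultimately show ?thesis unfolding spec_eq using t by (intro mult_le_less_imp_less) auto
  qed
  have iff: "(f k > f i \<or> f k = f i \<and> k < i) = (spec n q t f k < spec n q t f i)"
    if "k \<in> {1..n}" "i \<in> {1..n}" for f i k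
  proof
    assume *: "spec n q t f k < spec n q t f i"
    show "f k > f i \<or> f k = f i \<and> k < i"
    proof (rule ccontr)
      assume "\<not> ?thesis"
      then have "k = i \<or> (f i > f k \<or> f i = f k \<and> i < k)" by auto
      then show False using * less[OF that(2,1), of f] by fastforce
    qed
  qed (rule less[OF that])
  have "leg' n f i = leg' n g i"
    unfolding leg'_eq[OF i] by (intro arg_cong[where f = card] Collect_cong) (use i in \<open>simp only: iff eq cong: conj_cong\<close>)
  then have "q ^ f i = q ^ g i" using eq[OF i] t by (simp add: spec_eq)
  then show ?thesis
    using t power_strict_decreasing[of "f i" "g i" q] power_strict_decreasing[of "g i" "f i" q]
    by (cases "f i" "g i" rule: linorder_cases) auto
next
  case False
  have t: "1 \<le> t" "0 < q" "q < 1" using False g by (auto simp: generic_def)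
  have ne: "spec n q t g i < spec n q t f i" if "f i < g i" for f g
  proof -
    have "q ^ g i \<le> q ^ Suc (f i)" using that t by (intro power_decreasing) auto
    moreover have "inverse t ^ leg' n g i \<le> 1" using t by (intro power_le_one) (auto simp: inverse_le_1_iff)
    ultimately have "spec n q t g i \<le> q ^ Suc (f i) * 1"
      unfolding spec_eq using t by (intro mult_mono) auto
    also have "\<dots> < q ^ f i * inverse t ^ leg' n f i"
      using generic_power[OF g, of 1 "leg' n f i"] leg'_less[OF i, of f] t
      by (simp add: power_inverse field_simps)
    finally show ?thesis by (simp add: spec_eq)
  qed
  show ?thesis using ne[of f g] ne[of g f] eq[OF i] by (cases "f i" "g i" rule: linorder_cases) auto
qed


section \<open>Creation of the non-symmetric Macdonald polynomials\<close>

text \<open>Families in t rather than single polynomials, so that the limit at t = 1 can be taken.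
  The scalar factors in front keep the leading coefficient 1; the quotient with spectral values is
  the c of \<open>Y_intertwiner\<close>.\<close>

inductive creation :: "nat \<Rightarrow> real \<Rightarrow> expo \<Rightarrow> (real \<Rightarrow> mpol) \<Rightarrow> bool"
  for n :: nat and q :: real
  where
    zero: "creation n q 0 (\<lambda>t. 1)"
  | rotate: "creation n q \<eta> F \<Longrightarrow>
      creation n q (rot_expo n \<eta>) (\<lambda>t. cst (inverse (q ^ lookup \<eta> 1)) * psi n q (F t))"
  | raise: "creation n q \<eta> F \<Longrightarrow> 1 \<le> i \<Longrightarrow> i < n \<Longrightarrow> lookup \<eta> i < lookup \<eta> (Suc i) \<Longrightarrow>
      creation n q (swap_expo i \<eta>) (\<lambda>t. cst (inverse t) * (T_op t i (F t) +
        cst ((t - 1) * spec n q t (lookup \<eta>) i / (spec n q t (lookup \<eta>) (Suc i) - spec n q t (lookup \<eta>) i)) * F t))"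

lemma creation_supported:
  assumes "creation n q \<eta> F" "n \<ge> 1" "q \<noteq> 0" "t \<noteq> 0"
  shows "supported_below n \<eta> (F t)"
  using assms(1)
proof induction
  case zero
  show ?case by (simp add: supported_below_def lookup_one below_refl)
next
  case (rotate \<eta> F)
  then show ?case using assms by (intro supported_below_psi) auto
next
  case (raise \<eta> F i)
  then show ?case using assms by (intro supported_below_raise) auto
qed

lemma creation_keys:
  assumes "creation n q \<eta> F" "n \<ge> 1" "q \<noteq> 0"
  shows "keys \<eta> \<subseteq> {1..n}"
  using creation_supported[OF assms, of 1] by (auto simp: supported_below_def in_keys_iff)

lemma leg'_0: "i \<in> {1..n} \<Longrightarrow> leg' n (\<lambda>_. 0) i = i - 1"
proof -
  have "{k\<in>{1..<i}. (0::nat) \<ge> 0} = {1..<i}" "{k\<in>{i<..n}. (0::nat) > 0} = {}" by auto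
  then show ?thesis by (simp only: leg'_def) simp
qed

lemma T_chain_1: "i \<le> j \<Longrightarrow> T_chain t i j 1 = cst (t ^ (j - i))"
proof (induction j rule: dec_induct)
  case (step j)
  have "T_chain t i j (cst t) = cst t * T_chain t i j 1"
    using T_chain_cst_mult[of t i j t 1] by simp
  with step show ?case by (simp add: T_chain_snoc T_op_1 Suc_diff_le cst_mult)
qed simp

lemma inv_T_1:
  assumes "t \<noteq> 0"
  shows "inv (T_op t i) 1 = cst (inverse t)"
proof -
  have "T_op t i (cst (inverse t)) = 1"
    using T_op_cst_mult[of t i "inverse t" 1] assms by (simp add: T_op_1 cst_cancel)
  then show ?thesis using T_op_inverse(2)[OF assms] by metis
qed

lemma Ti_chain_1:
  assumes "t \<noteq> 0" "i \<le> j"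
  shows "Ti_chain t i j 1 = cst (inverse t ^ (j - i))"
  using assms(2)
proof (induction j rule: dec_induct)
  case (step j)
  have "Ti_chain t i j (cst (inverse t)) = cst (inverse t) * Ti_chain t i j 1"
    using Ti_chain_cst_mult[of t i j "inverse t" 1] assms by simp
  with step assms show ?case by (simp add: Ti_chain_snoc inv_T_1 Suc_diff_le cst_mult)
qed simp

lemma Y_1: 
  assumes "t \<noteq> 0" "j \<in> {1..n}"
  shows "Y_op n q t j 1 = cst (spec n q t (\<lambda>_. 0) j)"
proof -
  have "T_chain t j n (cst c) = cst (c * t ^ (n - j))" for c
    using T_chain_cst_mult[of t j n c 1] assms by (simp add: T_chain_1 cst_mult)
  then have "Y_op n q t j 1 = cst (t powi (int j - int n) * (inverse t ^ (j - 1) * t ^ (n - j)))"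
    using assms by (simp add: Y_op_eq Ti_chain_1 cst_mult)
  also have "int j - int n = - int (n - j)" using assms by auto
  also have "t powi (- int (n - j)) * (inverse t ^ (j - 1) * t ^ (n - j)) = inverse t ^ (j - 1)"
    using assms by (simp only: power_int_minus power_int_of_nat) simp
  finally show ?thesis using assms by (simp add: spec_eq leg'_0)
qed

lemma creation_Y:
  assumes "creation n q \<eta> F" "n \<ge> 1" "generic n q t" "j \<in> {1..n}"
  shows "Y_op n q t j (F t) = cst (spec n q t (lookup \<eta>) j) * F t"
  using assms(1,4)
proof (induction arbitrary: j)
  case zero
  have "lookup (0 :: expo) = (\<lambda>_. 0)" by auto
  with zero assms show ?case by (simp add: Y_1 generic_def)
next
  case (rotate \<eta> F)
  have tq: "t \<noteq> 0" "q \<noteq> 0" using assms by (auto simp: generic_def)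
  have cj: "cyc n j \<in> {1..n}" using rotate.prems bij_betw_apply[OF bij_betw_cyc] by blast
  have "Y_op n q t j (psi n q (F t)) = cst (spec n q t (lookup (rot_expo n \<eta>)) j) * psi n q (F t)"
  proof (cases "j = n")
    case True
    then have "cyc n j = 1" by (simp add: cyc_def)
    then show ?thesis
      using rotate.IH[OF cj] rotate.prems
      by (simp only: True Y_n_psi[OF tq assms(2)] psi_cst_mult[OF assms(2)] lookup_rot_expo[OF assms(2)] spec_rot)
        (simp add: cst_mult mult.assoc)
  next
    case False
    then have "cyc n j = Suc j" "j < n" "1 \<le> j" using rotate.prems by (auto simp: cyc_def)
    then show ?thesis
      using rotate.IH[OF cj] False tq assms(2) rotate.prems
      by (simp add: Y_psi psi_cst_mult lookup_rot_expo spec_rot)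
  qed
  then show ?case using tq assms by (simp add: Y_cst_mult mult.left_commute)
next
  case (raise \<eta> F i)
  let ?e = "spec n q t (lookup \<eta>)"
  have t: "t \<noteq> 0" using assms by (auto simp: generic_def)
  have "?e (Suc i) < ?e i" using raise.hyps assms by (intro spec_less) auto
  then have "(t - 1) * ?e i / (?e (Suc i) - ?e i) * (?e (Suc i) - ?e i) = (t - 1) * ?e i" by simp
  from Y_intertwiner[where e = ?e, OF t raise.hyps(2,3) _ this, of q "F t" j] raise.IH raise.prems
  show ?case using t assms(2) raise.hyps
    by (simp add: Y_cst_mult lookup_swap_expo spec_swap mult.left_commute)
qed

text \<open>A positive last part comes from a rotation, and undoing it decreases the size. If the
  last part is 0 but another is not, there is a descent; undoing the exchange there keeps the size
  and lowers the rank.\<close>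

lemma creation_ex:
  assumes n: "n \<ge> 1" and q: "q \<noteq> 0" and k: "keys \<eta> \<subseteq> {1..n}"
  shows "\<exists>F. creation n q \<eta> F"
proof -
  define R where "R = inv_image (less_than <*lex*> (less_than <*lex*> less_than))
    (\<lambda>\<eta>. (\<Sum>k=1..n. lookup \<eta> k, comp_rank n (lookup \<eta>)))"
  have "wf R" unfolding R_def by (intro wf_inv_image wf_lex_prod wf_less_than)
  then show ?thesis using k
  proof (induction \<eta> rule: wf_induct_rule)
    case (less \<eta>)
    consider "\<eta> = 0" | "\<eta> \<noteq> 0" "lookup \<eta> n > 0" | "\<eta> \<noteq> 0" "lookup \<eta> n = 0" by blast
    then show ?case
    proof cases
      case 1
      then show ?thesis using creation.zero by blast
    next
      case 2
      define \<zeta> where "\<zeta> = Poly_Mapping.map_key (inv (cyc n)) (\<eta> - single n 1)"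
      have "inj (inv (cyc n))" using bij_cyc[OF n] by (simp add: bij_imp_bij_inv bij_is_inj)
      then have l\<zeta>: "lookup \<zeta> k = lookup \<eta> (inv (cyc n) k) - (if inv (cyc n) k = n then 1 else 0)" for k
        by (simp add: \<zeta>_def lookup_map_key lookup_minus lookup_single when_def)
      have rot: "rot_expo n \<zeta> = \<eta>"
        using 2 n by (intro poly_mapping_eqI) (simp add: lookup_rot_expo rot_def l\<zeta> inv_f_f inj_cyc)
      have "k \<in> {1..n}" if "k \<in> keys \<zeta>" for k
      proof -
        have "inv (cyc n) k \<in> keys \<eta>" using that by (simp add: in_keys_iff l\<zeta>)
        then have "cyc n (inv (cyc n) k) \<in> {1..n}"
          using less.prems bij_betw_apply[OF bij_betw_cyc] by blast
        then show ?thesis using bij_cyc[OF n] by (simp add: bij_is_surj surj_f_inv_f)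
      qed
      then have "keys \<zeta> \<subseteq> {1..n}" by blast
      moreover have "(\<zeta>, \<eta>) \<in> R"
        using sum_rot[OF n, of "lookup \<zeta>"] n by (simp add: R_def flip: rot lookup_rot_expo)
      ultimately obtain F where "creation n q \<zeta> F" using less.IH by blast
      from creation.rotate[OF this] show ?thesis unfolding rot by blast
    next
      case 3
      have "\<exists>i. 1 \<le> i \<and> i < n \<and> lookup \<eta> (Suc i) < lookup \<eta> i"
      proof (rule ccontr)
        assume *: "\<not> ?thesis"
        have "lookup \<eta> k \<le> lookup \<eta> n" if "1 \<le> k" "k \<le> n" for k
          using that(2,1)
        proof (induction rule: inc_induct)
          case (step m)
          then show ?case using * by (metis le_SucI le_trans not_less)
        qed simp
        then have "lookup \<eta> k = 0" for k
          using 3(2) less.prems by (cases "k \<in> {1..n}") (auto simp: in_keys_iff)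
        then have "\<eta> = 0" by (intro poly_mapping_eqI) simp
        with 3 show False by simp
      qed
      then obtain i where i: "1 \<le> i" "i < n" and gt: "lookup \<eta> (Suc i) < lookup \<eta> i" by blast
      define \<zeta> where "\<zeta> = swap_expo i \<eta>"
      have sw: "swap_expo i \<zeta> = \<eta>" by (simp add: \<zeta>_def)
      have less': "lookup \<zeta> i < lookup \<zeta> (Suc i)" using gt by (simp add: \<zeta>_def lookup_map_key)
      have keys: "keys \<zeta> \<subseteq> {1..n}"
      proof
        fix k assume "k \<in> keys \<zeta>"
        then have "adj i k \<in> keys \<eta>" by (simp add: \<zeta>_def in_keys_iff lookup_map_key)
        then have "adj i (adj i k) \<in> {1..n}"
          using less.prems bij_betw_apply[OF bij_betw_adj[OF i]] by blast
        then show "k \<in> {1..n}" by simp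
      qed
      have "below n (lookup \<zeta>) (lookup \<eta>)"
        using below_raise[OF i less' below_refl averaged_refl] by (simp add: sw flip: lookup_swap_expo)
      moreover from this have "(\<Sum>k=1..n. lookup \<zeta> k) = (\<Sum>k=1..n. lookup \<eta> k)" by (simp add: below_def)
      moreover have "\<exists>k\<in>{1..n}. lookup \<zeta> k \<noteq> lookup \<eta> k"
        using i gt by (intro bexI[of _ i]) (auto simp: \<zeta>_def lookup_map_key)
      ultimately have "(\<zeta>, \<eta>) \<in> R"
        using prec_comp_rank[OF below_imp_prec] by (simp add: R_def)
      then obtain F where "creation n q \<zeta> F" using less.IH keys by blast
      from creation.raise[OF this i less'] show ?thesis unfolding sw by blast
    qed
  qed
qed

section \<open>Existence and uniqueness\<close>

definition in_span :: "(expo \<Rightarrow> mpol) \<Rightarrow> expo set \<Rightarrow> mpol \<Rightarrow> bool"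
  where "in_span P S p \<longleftrightarrow> (\<exists>A c. finite A \<and> A \<subseteq> S \<and> p = (\<Sum>\<mu>\<in>A. cst (c \<mu>) * P \<mu>))"

lemma in_span_0: "in_span P S 0"
  unfolding in_span_def by (rule exI[of _ "{}"]) simp

lemma in_span_base: "\<mu> \<in> S \<Longrightarrow> in_span P S (P \<mu>)"
  unfolding in_span_def by (rule exI[of _ "{\<mu>}"], rule exI[of _ "\<lambda>_. 1"]) simp

lemma in_span_cst_mult: "in_span P S p \<Longrightarrow> in_span P S (cst a * p)"
proof -
  assume "in_span P S p"
  then obtain A c where "finite A" "A \<subseteq> S" "p = (\<Sum>\<mu>\<in>A. cst (c \<mu>) * P \<mu>)"
    unfolding in_span_def by blast
  then show ?thesis unfolding in_span_def
    by (intro exI[of _ A] exI[of _ "\<lambda>\<mu>. a * c \<mu>"]) (simp add: sum_distrib_left cst_mult mult.assoc)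
qed

lemma in_span_add: "in_span P S p \<Longrightarrow> in_span P S p' \<Longrightarrow> in_span P S (p + p')"
proof -
  have ext: "(\<Sum>\<mu>\<in>A. cst (c \<mu>) * P \<mu>) = (\<Sum>\<mu>\<in>B. cst (if \<mu> \<in> A then c \<mu> else 0) * P \<mu>)"
    if "finite B" "A \<subseteq> B" for A B :: "expo set" and c :: "expo \<Rightarrow> real"
    using that by (intro sum.mono_neutral_cong_left) (simp_all split: if_splits)
  assume "in_span P S p" "in_span P S p'"
  then obtain A c A' c' where A: "finite A" "A \<subseteq> S" "p = (\<Sum>\<mu>\<in>A. cst (c \<mu>) * P \<mu>)"
    "finite A'" "A' \<subseteq> S" "p' = (\<Sum>\<mu>\<in>A'. cst (c' \<mu>) * P \<mu>)"
    unfolding in_span_def by blast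
  have "p + p' = (\<Sum>\<mu>\<in>A \<union> A'. cst ((if \<mu> \<in> A then c \<mu> else 0) + (if \<mu> \<in> A' then c' \<mu> else 0)) * P \<mu>)"
  proof -
    have "p = (\<Sum>\<mu>\<in>A \<union> A'. cst (if \<mu> \<in> A then c \<mu> else 0) * P \<mu>)"
      unfolding A(3) by (rule ext) (use A in auto)
    moreover have "p' = (\<Sum>\<mu>\<in>A \<union> A'. cst (if \<mu> \<in> A' then c' \<mu> else 0) * P \<mu>)"
      unfolding A(6) by (rule ext) (use A in auto)
    ultimately show ?thesis by (simp only: cst_add distrib_right sum.distrib)
  qed
  moreover have "finite (A \<union> A')" "A \<union> A' \<subseteq> S" using A by auto
  ultimately show ?thesis unfolding in_span_def by (intro exI conjI)
qed

lemma in_span_sum: "(\<And>x. x \<in> B \<Longrightarrow> in_span P S (f x)) \<Longrightarrow> in_span P S (sum f B)"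
  by (induction B rule: infinite_finite_induct) (simp_all add: in_span_add in_span_0)

lemma in_span_mono: "in_span P S p \<Longrightarrow> S \<subseteq> S' \<Longrightarrow> in_span P S' p"
  unfolding in_span_def by (elim exE conjE, intro exI conjI) (assumption, blast, assumption)

lemma in_span_diff: "in_span P S p \<Longrightarrow> in_span P S p' \<Longrightarrow> in_span P S (p - p')"
  using in_span_add[of P S p "cst (- 1) * p'"] in_span_cst_mult[of P S p' "- 1"] by (simp add: cst_minus)

lemma in_span_single: "in_span P S (single \<nu> 1) \<Longrightarrow> in_span P S (single \<nu> c)"
  using in_span_cst_mult[of P S "single \<nu> 1" c] by simp

abbreviation rank_less :: "nat \<Rightarrow> expo \<Rightarrow> expo \<Rightarrow> bool"
  where "rank_less n \<mu> \<nu> \<equiv> (comp_rank n (lookup \<mu>), comp_rank n (lookup \<nu>)) \<in> less_than <*lex*> less_than"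

lemma rank_less_trans: "rank_less n \<kappa> \<mu> \<Longrightarrow> rank_less n \<mu> \<nu> \<Longrightarrow> rank_less n \<kappa> \<nu>"
  by (auto simp: comp_rank_def)

lemma expo_eqI:
  fixes \<mu> \<nu> :: expo
  assumes "keys \<mu> \<subseteq> S" "keys \<nu> \<subseteq> S" and eq: "\<And>k. k \<in> S \<Longrightarrow> lookup \<mu> k = lookup \<nu> k"
  shows "\<mu> = \<nu>"
proof (rule poly_mapping_eqI)
  fix k
  show "lookup \<mu> k = lookup \<nu> k"
  proof (cases "k \<in> S")
    case False
    then have "k \<notin> keys \<mu>" "k \<notin> keys \<nu>" using assms by blast+
    then show ?thesis by (simp add: in_keys_iff)
  qed (rule eq)
qed

lemma supported_below_prec:
  assumes "supported_below n \<eta> f" "\<nu> \<in> keys f" "\<nu> \<noteq> \<eta>" "keys \<eta> \<subseteq> {1..n}"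
  shows "keys \<nu> \<subseteq> {1..n}" and "prec n (lookup \<nu>) (lookup \<eta>)"
proof -
  have \<nu>: "keys \<nu> \<subseteq> {1..n}" "below n (lookup \<nu>) (lookup \<eta>)"
    using assms(1,2) unfolding supported_below_def by blast+
  show "keys \<nu> \<subseteq> {1..n}" by fact
  have "\<exists>k\<in>{1..n}. lookup \<nu> k \<noteq> lookup \<eta> k"
    using expo_eqI[OF \<nu>(1) assms(4)] assms(3) by blast
  with \<nu>(2) show "prec n (lookup \<nu>) (lookup \<eta>)" by (rule below_imp_prec)
qed

text \<open>Inversion of a triangular system by well-founded induction: P \<nu> - x^\<nu> involves
  only monomials of smaller rank.\<close>

lemma monomial_in_span:
  assumes P: "\<And>\<mu>. keys \<mu> \<subseteq> {1..n} \<Longrightarrow> supported_below n \<mu> (P \<mu>)"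
    and k: "keys \<nu> \<subseteq> {1..n}"
  shows "in_span P {\<mu>. keys \<mu> \<subseteq> {1..n} \<and> (\<mu> = \<nu> \<or> rank_less n \<mu> \<nu>)} (single \<nu> 1)"
proof -
  have "wf (inv_image (less_than <*lex*> less_than) (\<lambda>\<mu>::expo. comp_rank n (lookup \<mu>)))"
    by (intro wf_inv_image wf_lex_prod wf_less_than)
  then show ?thesis using k
  proof (induction \<nu> rule: wf_induct_rule)
    case (less \<nu>)
    let ?S = "{\<mu>. keys \<mu> \<subseteq> {1..n} \<and> (\<mu> = \<nu> \<or> rank_less n \<mu> \<nu>)}"
    note sup = P[OF less.prems]
    have "\<nu> \<in> keys (P \<nu>)" using sup by (simp add: supported_below_def in_keys_iff)
    then have "(\<Sum>m\<in>keys (P \<nu>). single m (lookup (P \<nu>) m)) =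
        single \<nu> (lookup (P \<nu>) \<nu>) + (\<Sum>m\<in>keys (P \<nu>) - {\<nu>}. single m (lookup (P \<nu>) m))"
      by (intro sum.remove) simp_all
    then have "P \<nu> = single \<nu> (lookup (P \<nu>) \<nu>) + (\<Sum>m\<in>keys (P \<nu>) - {\<nu>}. single m (lookup (P \<nu>) m))"
      by (simp only: poly_mapping_eq_sum_single[symmetric])
    moreover have "lookup (P \<nu>) \<nu> = 1" using sup by (simp add: supported_below_def)
    ultimately have eq: "single \<nu> 1 = P \<nu> - (\<Sum>m\<in>keys (P \<nu>) - {\<nu>}. single m (lookup (P \<nu>) m))"
      by (metis add_diff_cancel_right')
    have "in_span P ?S (\<Sum>m\<in>keys (P \<nu>) - {\<nu>}. single m (lookup (P \<nu>) m))"
    proof (rule in_span_sum, rule in_span_single)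
      fix m assume m: "m \<in> keys (P \<nu>) - {\<nu>}"
      then have km: "keys m \<subseteq> {1..n}" and "prec n (lookup m) (lookup \<nu>)"
        using supported_below_prec[OF sup _ _ less.prems] by auto
      then have r: "rank_less n m \<nu>" by (intro prec_comp_rank)
      then have "in_span P {\<mu>. keys \<mu> \<subseteq> {1..n} \<and> (\<mu> = m \<or> rank_less n \<mu> m)} (single m 1)"
        using km by (intro less.IH) simp_all
      then show "in_span P ?S (single m 1)"
      proof (rule in_span_mono, intro subsetI)
        fix \<mu> assume "\<mu> \<in> {\<mu>. keys \<mu> \<subseteq> {1..n} \<and> (\<mu> = m \<or> rank_less n \<mu> m)}"
        then show "\<mu> \<in> ?S" using r rank_less_trans[of n \<mu> m \<nu>] by blast
      qed
    qed
    moreover have "in_span P ?S (P \<nu>)" using less.prems by (intro in_span_base) simp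
    ultimately show ?case unfolding eq by (intro in_span_diff)
  qed
qed

text \<open>Applying \<open>Y\<^sub>i - e\<^sub>i(\<mu>)\<close> removes the term of \<open>\<mu>\<close> and multiplies \<open>D\<close> by a nonzero constant.\<close>

lemma eigenvector_in_span_eq_0:
  assumes t: "t \<noteq> 0" and n: "n \<ge> 1" and "finite A"
    and P: "\<And>\<mu> i. \<mu> \<in> A \<Longrightarrow> i \<in> {1..n} \<Longrightarrow> Y_op n q t i (P \<mu>) = cst (e \<mu> i) * P \<mu>"
    and Y: "\<And>i. i \<in> {1..n} \<Longrightarrow> Y_op n q t i D = cst (e' i) * D"
    and D: "D = (\<Sum>\<mu>\<in>A. cst (c \<mu>) * P \<mu>)"
    and ne: "\<And>\<mu>. \<mu> \<in> A \<Longrightarrow> \<exists>i\<in>{1..n}. e \<mu> i \<noteq> e' i"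
  shows "D = 0"
  using \<open>finite A\<close> P D ne
proof (induction A arbitrary: c rule: finite_induct)
  case (insert \<mu> A)
  obtain i where i: "i \<in> {1..n}" "e \<mu> i \<noteq> e' i" using insert.prems(3) by blast
  define b where "b = inverse (e' i - e \<mu> i)"
  have "cst (e' i - e \<mu> i) * D = Y_op n q t i D - cst (e \<mu> i) * D"
    using Y[OF i(1)] by (simp add: cst_diff algebra_simps)
  also have "\<dots> = (\<Sum>\<kappa>\<in>insert \<mu> A. cst (c \<kappa>) * (cst (e \<kappa> i) * P \<kappa>)) - cst (e \<mu> i) * (\<Sum>\<kappa>\<in>insert \<mu> A. cst (c \<kappa>) * P \<kappa>)"
    unfolding insert.prems(2) additive.sum[OF additive_Y[OF t]]
    using insert.prems(1) i t n by (simp add: Y_cst_mult)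
  also have "\<dots> = (\<Sum>\<kappa>\<in>insert \<mu> A. cst (c \<kappa> * (e \<kappa> i - e \<mu> i)) * P \<kappa>)"
    unfolding sum_distrib_left sum_subtractf[symmetric]
    by (intro sum.cong refl) (simp add: cst_mult cst_diff algebra_simps)
  also have "\<dots> = (\<Sum>\<kappa>\<in>A. cst (c \<kappa> * (e \<kappa> i - e \<mu> i)) * P \<kappa>)"
    using insert.hyps by simp
  finally have "cst b * (cst (e' i - e \<mu> i) * D) = (\<Sum>\<kappa>\<in>A. cst (b * (c \<kappa> * (e \<kappa> i - e \<mu> i))) * P \<kappa>)"
    by (simp add: sum_distrib_left cst_mult mult.assoc)
  then have "D = (\<Sum>\<kappa>\<in>A. cst (b * (c \<kappa> * (e \<kappa> i - e \<mu> i))) * P \<kappa>)"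
    using i(2) by (simp add: b_def mult.assoc[symmetric] cst_cancel)
  then show ?case using insert.prems by (intro insert.IH) auto
qed simp

lemma creation_is_nonsym_macdonald:
  assumes c: "creation n q \<eta> F" and n: "n \<ge> 1" and g: "generic n q t"
  shows "is_nonsym_macdonald n q t \<eta> (F t)"
proof -
  have tq: "t \<noteq> 0" "q \<noteq> 0" using g by (auto simp: generic_def)
  note sup = creation_supported[OF c n tq(2,1)] and k = creation_keys[OF c n tq(2)]
  have "lookup (F t) \<eta> = 1" using sup by (simp add: supported_below_def)
  then show ?thesis
    unfolding is_nonsym_macdonald_def
    using supported_below_prec[OF sup _ _ k] creation_Y[OF c n g] by (auto simp: spec_def)
qed

text \<open>The leading terms of two candidates cancel, so their difference lies in the span of
  created polynomials of smaller rank. It is a joint eigenvector with the spectral vector of \<eta>,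
  which none of these has, and so it is 0.\<close>

lemma nonsym_macdonald_gen_creation:
  assumes c: "creation n q \<eta> F" and n: "n \<ge> 1" and g: "generic n q t"
  shows "nonsym_macdonald_gen n q t \<eta> = F t"
  unfolding nonsym_macdonald_gen_def
proof (rule the_equality)
  show "is_nonsym_macdonald n q t \<eta> (F t)" by (rule creation_is_nonsym_macdonald[OF assms])
next
  fix E assume E: "is_nonsym_macdonald n q t \<eta> E"
  have tq: "t \<noteq> 0" "q \<noteq> 0" using g by (auto simp: generic_def)
  define P where "P \<mu> = (SOME F. creation n q \<mu> F) t" for \<mu>
  have P: "supported_below n \<mu> (P \<mu>)"
    "\<And>i. i \<in> {1..n} \<Longrightarrow> Y_op n q t i (P \<mu>) = cst (spec n q t (lookup \<mu>) i) * P \<mu>" if "keys \<mu> \<subseteq> {1..n}" for \<mu>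
  proof -
    have "creation n q \<mu> (SOME F. creation n q \<mu> F)"
      using creation_ex[OF n tq(2) that] by (rule someI_ex)
    then show "supported_below n \<mu> (P \<mu>)"
      "\<And>i. i \<in> {1..n} \<Longrightarrow> Y_op n q t i (P \<mu>) = cst (spec n q t (lookup \<mu>) i) * P \<mu>"
      unfolding P_def using creation_supported creation_Y n g tq by blast+
  qed
  note sup = creation_supported[OF c n tq(2,1)] and k = creation_keys[OF c n tq(2)]
  let ?S = "{\<mu>. keys \<mu> \<subseteq> {1..n} \<and> rank_less n \<mu> \<eta>}"
  have key: "keys \<nu> \<subseteq> {1..n} \<and> rank_less n \<nu> \<eta>" if "\<nu> \<in> keys (E - F t)" for \<nu>
  proof -
    have "\<nu> \<noteq> \<eta>"
      using that E sup by (auto simp: in_keys_iff lookup_minus is_nonsym_macdonald_def supported_below_def)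
    moreover have "\<nu> \<in> keys E \<or> \<nu> \<in> keys (F t)"
      using that by (auto simp: in_keys_iff lookup_minus)
    ultimately show ?thesis
      using E supported_below_prec[OF sup _ _ k] prec_comp_rank
      unfolding is_nonsym_macdonald_def by blast
  qed
  have "in_span P ?S (\<Sum>m\<in>keys (E - F t). single m (lookup (E - F t) m))"
  proof (rule in_span_sum, rule in_span_single)
    fix m assume "m \<in> keys (E - F t)"
    then have m: "keys m \<subseteq> {1..n}" "rank_less n m \<eta>" using key by auto
    show "in_span P ?S (single m 1)"
    proof (rule in_span_mono[OF monomial_in_span[OF P(1) m(1)]], assumption, intro subsetI)
      fix \<mu> assume "\<mu> \<in> {\<mu>. keys \<mu> \<subseteq> {1..n} \<and> (\<mu> = m \<or> rank_less n \<mu> m)}"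
      then show "\<mu> \<in> ?S" using m rank_less_trans[of n \<mu> m \<eta>] by blast
    qed
  qed
  then obtain A c where A: "finite A" "A \<subseteq> ?S" "E - F t = (\<Sum>\<mu>\<in>A. cst (c \<mu>) * P \<mu>)"
    unfolding in_span_def poly_mapping_eq_sum_single[symmetric] by blast
  have "E - F t = 0"
  proof (rule eigenvector_in_span_eq_0[where e' = "spec n q t (lookup \<eta>)" and e = "\<lambda>\<mu>. spec n q t (lookup \<mu>)",
        OF tq(1) n A(1) _ _ A(3)])
    fix \<mu> i assume "\<mu> \<in> A" "i \<in> {1..n}"
    then show "Y_op n q t i (P \<mu>) = cst (spec n q t (lookup \<mu>) i) * P \<mu>" using A(2) P(2) by blast
  next
    fix i assume i: "i \<in> {1..n}"
    then have "Y_op n q t i E = cst (spec n q t (lookup \<eta>) i) * E"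
      using E unfolding is_nonsym_macdonald_def spec_def by blast
    then show "Y_op n q t i (E - F t) = cst (spec n q t (lookup \<eta>) i) * (E - F t)"
      using creation_Y[OF assms i] by (simp add: additive.diff[OF additive_Y[OF tq(1)]] right_diff_distrib)
  next
    fix \<mu> assume "\<mu> \<in> A"
    then have \<mu>: "rank_less n \<mu> \<eta>" "keys \<mu> \<subseteq> {1..n}" using A(2) by auto
    show "\<exists>i\<in>{1..n}. spec n q t (lookup \<mu>) i \<noteq> spec n q t (lookup \<eta>) i"
    proof (rule ccontr)
      assume "\<not> ?thesis"
      then have eq: "lookup \<mu> i = lookup \<eta> i" if "i \<in> {1..n}" for i
        using spec_inj[OF g _ that, of "lookup \<mu>" "lookup \<eta>"] by blast
      have "\<mu> = \<eta>" by (rule expo_eqI[OF \<mu>(2) k eq])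
      with \<mu>(1) show False by (simp add: comp_rank_def)
    qed
  qed
  then show "E = F t" by simp
qed


subsection \<open>The limit at 1\<close>

text \<open>Continuity of each coefficient would not do as an invariant: linear maps need not
  preserve it when the supports vary without bound. Finite combinations of fixed polynomials avoid
  this.\<close>

inductive cont_family :: "(real \<Rightarrow> mpol) \<Rightarrow> bool"
  where
    base: "isCont c 1 \<Longrightarrow> cont_family (\<lambda>t. cst (c t) * G)"
  | add: "cont_family F \<Longrightarrow> cont_family F' \<Longrightarrow> cont_family (\<lambda>t. F t + F' t)"

lemma cont_family_lookup: "cont_family F \<Longrightarrow> isCont (\<lambda>t. lookup (F t) m) 1"
  by (induction rule: cont_family.induct) (auto simp: lookup_cst_mult lookup_add intro!: continuous_intros)

lemma cont_family_scale: "cont_family F \<Longrightarrow> isCont a 1 \<Longrightarrow> cont_family (\<lambda>t. cst (a t) * F t)"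
proof (induction rule: cont_family.induct)
  case (base c G)
  then have "cont_family (\<lambda>t. cst (a t * c t) * G)"
    by (intro cont_family.base continuous_intros)
  then show ?case by (simp add: cst_mult mult.assoc)
next
  case (add F F')
  then show ?case by (simp add: distrib_left cont_family.add)
qed

lemma cont_family_linear:
  assumes "cont_family F" "\<And>f g. A (f + g) = A f + A g" "\<And>c f. A (cst c * f) = cst c * A f"
  shows "cont_family (\<lambda>t. A (F t))"
  using assms(1) by (induction rule: cont_family.induct) (simp_all add: assms cont_family.intros)

lemma ddiff_add: "ddiff i (f + g) = ddiff i f + ddiff i g"
  by (rule ddiff_eqI) (simp add: distrib_left D_mult_ddiff swap_var_add)

lemma ddiff_cst_mult: "ddiff i (cst c * f) = cst c * ddiff i f"
  by (rule ddiff_eqI) (simp add: mult.left_commute D_mult_ddiff swap_var_mult right_diff_distrib)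

lemma creation_cont_family:
  assumes "creation n q \<eta> F" "n \<ge> 1" "0 < q" "q < 1"
  shows "cont_family F"
  using assms(1)
proof induction
  case zero
  have "cont_family (\<lambda>t. cst 1 * 1)" by (rule cont_family.base) simp
  then show ?case by simp
next
  case (rotate \<eta> F)
  have "cont_family (\<lambda>t. psi n q (F t))"
    using rotate.IH by (rule cont_family_linear) (use assms in \<open>simp_all add: psi_add psi_cst_mult\<close>)
  then show ?case by (rule cont_family_scale) simp
next
  case (raise \<eta> F i)
  let ?e = "\<lambda>t. spec n q t (lookup \<eta>)"
  have c_spec: "isCont (\<lambda>t. ?e t j) 1" for j
    unfolding spec_eq by (intro continuous_intros) simp_all
  \<comment> \<open>At t = 1 the two spectral values are powers of q with distinct exponents, so the
    denominator does not vanish in the limit.\<close>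
  have "?e 1 (Suc i) < ?e 1 i"
    using raise.hyps assms by (intro spec_less) (auto simp: generic_def)
  then have c: "isCont (\<lambda>t. (t - 1) * ?e t i / (?e t (Suc i) - ?e t i)) 1"
    by (intro continuous_intros c_spec) simp
  \<comment> \<open>T_i itself depends on t, so it is split into fixed linear maps with coefficients
    1 and t.\<close>
  have "cont_family (\<lambda>t. ddiff i (F t))"
    using raise.IH by (rule cont_family_linear) (simp_all add: ddiff_add ddiff_cst_mult)
  then have "cont_family (\<lambda>t. var i * ddiff i (F t))" "cont_family (\<lambda>t. - var (Suc i) * ddiff i (F t))"
    by (rule cont_family_linear; simp add: algebra_simps)+
  then have "cont_family (\<lambda>t. (cst t * F t + cst t * (var i * ddiff i (F t))) + - var (Suc i) * ddiff i (F t))"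
    by (intro cont_family.add cont_family_scale raise.IH) simp_all
  then have "cont_family (\<lambda>t. T_op t i (F t))"
    by (simp add: T_op_eq_ddiff)
  then have "cont_family (\<lambda>t. T_op t i (F t) + cst ((t - 1) * ?e t i / (?e t (Suc i) - ?e t i)) * F t)"
    using raise.IH c by (intro cont_family.add cont_family_scale)
  then show ?case by (rule cont_family_scale) (intro continuous_intros, simp)
qed

lemma nonsym_macdonald_creation:
  assumes c: "creation n q \<eta> F" and n: "n \<ge> 1" and g: "generic n q t"
  shows "nonsym_macdonald n q t \<eta> = F t"
proof (cases "t = 1")
  case False
  then show ?thesis using nonsym_macdonald_gen_creation[OF assms] by (simp add: nonsym_macdonald_def)
next
  case True
  have q: "0 < q" "q < 1" using g by (auto simp: generic_def)
  \<comment> \<open>\<open>generic\<close> is an open condition that holds at 1, hence it holds on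
    both sides of 1, where the limit is taken.\<close>
  have "((\<lambda>u. q * u ^ n) \<longlongrightarrow> q * 1 ^ n) (at 1)" by (intro tendsto_intros)
  then have "eventually (\<lambda>u. q * u ^ n < 1) (at 1)" by (rule order_tendstoD(2)) (use q in simp)
  moreover have "eventually (\<lambda>u. 0 < u) (at (1::real))"
    by (rule order_tendstoD(1)[OF tendsto_ident_at]) simp
  ultimately have "eventually (\<lambda>u. generic n q u) (at 1)"
    by eventually_elim (use q in \<open>simp add: generic_def\<close>)
  then have ev: "eventually (\<lambda>u. nonsym_macdonald_gen n q u \<eta> = F u) (at 1)"
    by eventually_elim (rule nonsym_macdonald_gen_creation[OF c n])
  have lim: "((\<lambda>u. lookup (nonsym_macdonald_gen n q u \<eta>) \<nu>) \<longlongrightarrow> lookup (F 1) \<nu>) (at 1)" for \<nu>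
  proof (rule Lim_transform_eventually)
    show "((\<lambda>u. lookup (F u) \<nu>) \<longlongrightarrow> lookup (F 1) \<nu>) (at 1)"
      using cont_family_lookup[OF creation_cont_family[OF c n q]] by (simp add: isCont_def)
    show "eventually (\<lambda>u. lookup (F u) \<nu> = lookup (nonsym_macdonald_gen n q u \<eta>) \<nu>) (at 1)"
      using ev by eventually_elim simp
  qed
  have "(THE E. \<forall>\<nu>. ((\<lambda>u. lookup (nonsym_macdonald_gen n q u \<eta>) \<nu>) \<longlongrightarrow> lookup E \<nu>) (at 1)) = F 1"
  proof (rule the_equality)
    fix E assume E: "\<forall>\<nu>. ((\<lambda>u. lookup (nonsym_macdonald_gen n q u \<eta>) \<nu>) \<longlongrightarrow> lookup E \<nu>) (at 1)"
    show "E = F 1"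
    proof (rule poly_mapping_eqI)
      fix \<nu>
      show "lookup E \<nu> = lookup (F 1) \<nu>"
        by (rule tendsto_unique[OF at_neq_bot E[rule_format] lim])
    qed
  qed (use lim in blast)
  then show ?thesis using True by (simp add: nonsym_macdonald_def)
qed

section \<open>The one-variable moments\<close>

lemma qpoch_inf_rec:
  assumes "0 < q" "q < 1"
  shows "qpoch_inf z q = (1 - z) * qpoch_inf (z * q) q"
proof -
  have conv: "convergent_prod (\<lambda>i. 1 - z * q ^ i)" for z
    using assms
    by (intro abs_convergent_prod_imp_convergent_prod summable_imp_abs_convergent_prod)
      (simp add: abs_mult summable_mult)
  have "(\<lambda>n. \<Prod>i\<le>Suc n. 1 - z * q ^ i) \<longlonglongrightarrow> qpoch_inf z q"
    unfolding qpoch_inf_def using convergent_prod_LIMSEQ[OF conv] by (rule LIMSEQ_Suc)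
  moreover have "(\<Prod>i\<le>Suc n. 1 - z * q ^ i) = (1 - z) * (\<Prod>i\<le>n. 1 - z * q * q ^ i)" for n
    by (subst prod.atMost_Suc_shift) (simp add: mult.assoc)
  moreover have "(\<lambda>n. (1 - z) * (\<Prod>i\<le>n. 1 - z * q * q ^ i)) \<longlonglongrightarrow> (1 - z) * qpoch_inf (z * q) q"
    unfolding qpoch_inf_def using convergent_prod_LIMSEQ[OF conv] by (intro tendsto_intros)
  ultimately show ?thesis by (simp add: LIMSEQ_unique)
qed

definition weight :: "real \<Rightarrow> real \<Rightarrow> real \<Rightarrow> real \<Rightarrow> real"
  where "weight q x y u = u powr (x - 1) * (qpoch_inf (q * u) q / qpoch_inf (q powr y * u) q)"

definition moment :: "real \<Rightarrow> real \<Rightarrow> real \<Rightarrow> nat \<Rightarrow> real"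
  where "moment q x y k = qint q (\<lambda>u. weight q x y u * u ^ k)"

definition phi :: "real \<Rightarrow> real \<Rightarrow> nat \<Rightarrow> real"
  where "phi q y j = qpoch_inf (q ^ Suc j) q / qpoch_inf (q powr y * q ^ j) q"

context
  fixes q x y :: real
  assumes q: "0 < q" "q < 1" and y: "\<And>m::nat. y \<noteq> - real m" and x: "x > 0"
begin

text \<open>The first factors of the two infinite products are split off; the assumption on y makes
  that of the denominator nonzero.\<close>

lemma phi_rec: "phi q y j * (1 - q powr y * q ^ j) = (1 - q ^ Suc j) * phi q y (Suc j)"
proof -
  have "q powr y * q ^ j = q powr (y + real j)"
    using q by (simp add: powr_add powr_realpow)
  moreover have "q powr (y + real j) \<noteq> 1"
    using q y[of j] by (auto simp: powr_def)
  ultimately have "1 - q powr y * q ^ j \<noteq> 0" by simp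
  then show ?thesis
    using qpoch_inf_rec[OF q, of "q ^ Suc j"] qpoch_inf_rec[OF q, of "q powr y * q ^ j"]
    by (simp add: phi_def mult_ac)
qed

lemma weight_term: "weight q x y (q ^ j) * (q ^ j) ^ k * q ^ j = (q powr (x + real k)) ^ j * phi q y j"
proof -
  have "(q ^ j) powr (x - 1) * (q ^ j) ^ k * q ^ j = (q powr (x + real k)) ^ j"
  proof -
    have "(q ^ j) powr (x - 1) = q powr (real j * (x - 1))"
      using q by (simp only: powr_realpow[symmetric] powr_powr)
    moreover have "(q ^ j) ^ k = q powr (real j * real k)"
      using q by (simp only: power_mult[symmetric] of_nat_mult[symmetric] powr_realpow)
    moreover have "q ^ j = q powr real j" using q by (simp only: powr_realpow)
    moreover have "(q powr (x + real k)) ^ j = q powr ((x + real k) * real j)"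
      using q by (simp only: powr_realpow[symmetric] powr_powr powr_gt_zero)
    moreover have "real j * (x - 1) + real j * real k + real j = (x + real k) * real j"
      by (simp add: algebra_simps)
    ultimately show ?thesis by (simp only: powr_add[symmetric])
  qed
  then show ?thesis by (simp add: weight_def phi_def mult_ac)
qed

text \<open>By \<open>phi_rec\<close> consecutive values of \<open>phi\<close> differ by a factor
  tending to 1, so the ratio of consecutive terms tends to r; c lies strictly between r and
  1.\<close>

lemma summable_phi:
  assumes r: "0 < r" "r < 1"
  shows "summable (\<lambda>j. r ^ j * phi q y j)"
proof -
  define c where "c = (1 + r) / 2"
  have c: "r < c" "c < 1" using r by (auto simp: c_def)
  have lim: "(\<lambda>j. q ^ j) \<longlonglongrightarrow> 0" using q by (intro LIMSEQ_realpow_zero) auto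
  have "(\<lambda>j. r * \<bar>1 - q powr y * q ^ j\<bar> / (1 - q * q ^ j)) \<longlonglongrightarrow> r * \<bar>1 - q powr y * 0\<bar> / (1 - q * 0)"
    by (intro tendsto_mult tendsto_divide tendsto_rabs tendsto_diff tendsto_const lim) simp
  then have "eventually (\<lambda>j. r * \<bar>1 - q powr y * q ^ j\<bar> / (1 - q * q ^ j) < c) sequentially"
    by (rule order_tendstoD(2)) (use c in simp)
  then obtain N where N: "r * \<bar>1 - q powr y * q ^ j\<bar> / (1 - q * q ^ j) < c" if "j \<ge> N" for j
    by (auto simp: eventually_sequentially)
  show ?thesis
  proof (rule summable_ratio_test[OF c(2)])
    fix j assume j: "N \<le> j"
    have pos: "0 < 1 - q * q ^ j"
      using q power_Suc_less_one[of q j] by simp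
    have "phi q y (Suc j) = phi q y j * (1 - q powr y * q ^ j) / (1 - q * q ^ j)"
      using phi_rec[of j] pos by (simp add: field_simps)
    then have "norm (r ^ Suc j * phi q y (Suc j)) =
        r * \<bar>1 - q powr y * q ^ j\<bar> / (1 - q * q ^ j) * norm (r ^ j * phi q y j)"
      using r pos by (simp add: abs_mult)
    also have "\<dots> \<le> c * norm (r ^ j * phi q y j)"
      using N[OF j] by (intro mult_right_mono) auto
    finally show "norm (r ^ Suc j * phi q y (Suc j)) \<le> c * norm (r ^ j * phi q y j)" .
  qed
qed

lemma q_powr_less_1: "q powr (x + real k) < 1" "0 < q powr (x + real k)"
  using q x powr_less_mono'[of q 0 "x + real k"] by simp_all

lemma summable_moment: "summable (\<lambda>j. weight q x y (q ^ j) * (q ^ j) ^ k * q ^ j)"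
  unfolding weight_term by (intro summable_phi q_powr_less_1)

text \<open>An index shift in the series of (1 - u) u^k against the weight: by
  \<open>phi_rec\<close> the factor 1 - u taken at q u becomes 1 - q^y u taken at u, and the term
  lost at u = 1 vanishes.\<close>

lemma moment_rec:
  "moment q x y k - moment q x y (Suc k) =
    q powr (x + real k) * (moment q x y k - q powr y * moment q x y (Suc k))"
proof -
  define r where "r = q powr (x + real k)"
  have rq: "q powr (x + real (Suc k)) = r * q"
  proof -
    have "x + real (Suc k) = (x + real k) + 1" by simp
    then show ?thesis using q by (simp only: powr_add[of q "x + real k" 1] r_def powr_one)
  qed
  define a where "a = (\<lambda>j. r ^ j * phi q y j)"
  define b where "b = (\<lambda>j. (r * q) ^ j * phi q y j)"
  have sa: "summable a" unfolding a_def r_def by (intro summable_phi q_powr_less_1)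
  have sb: "summable b" unfolding b_def rq[symmetric] by (intro summable_phi q_powr_less_1)
  have mom: "moment q x y k = (1 - q) * suminf a" "moment q x y (Suc k) = (1 - q) * suminf b"
    by (simp_all only: moment_def qint_def weight_term a_def b_def r_def[symmetric] rq)
  have "a (Suc j) - b (Suc j) = r * (a j - q powr y * b j)" for j
  proof -
    have alg: "r * R - r * q * (R * Q) = r * R * (1 - q * Q)" "r * R * (u * (1 - Y * Q)) = r * (R * u - Y * (R * Q * u))"
      for R Q Y u :: real by (simp_all add: algebra_simps)
    have "a (Suc j) - b (Suc j) = (r * r ^ j - r * q * (r ^ j * q ^ j)) * phi q y (Suc j)"
      unfolding a_def b_def power_mult_distrib power_Suc left_diff_distrib by (simp only: mult_ac)
    also have "\<dots> = r * r ^ j * ((1 - q ^ Suc j) * phi q y (Suc j))"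
      unfolding alg by (simp only: mult.assoc power_Suc)
    also have "(1 - q ^ Suc j) * phi q y (Suc j) = phi q y j * (1 - q powr y * q ^ j)"
      by (rule phi_rec[symmetric])
    also have "r * r ^ j * (phi q y j * (1 - q powr y * q ^ j)) = r * (a j - q powr y * b j)"
      unfolding a_def b_def power_mult_distrib by (rule alg)
    finally show ?thesis .
  qed
  moreover have sc: "summable (\<lambda>j. a j - q powr y * b j)"
    by (intro summable_diff summable_mult sa sb)
  ultimately have "suminf (\<lambda>j. a (Suc j) - b (Suc j)) = r * suminf (\<lambda>j. a j - q powr y * b j)"
    by (simp only: suminf_mult[OF sc])
  moreover have "suminf (\<lambda>j. a j - q powr y * b j) = suminf a - q powr y * suminf b"
    by (simp only: suminf_diff[OF sa summable_mult[OF sb], symmetric] suminf_mult[OF sb])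
  moreover have "suminf (\<lambda>j. a (Suc j) - b (Suc j)) = suminf (\<lambda>j. a j - b j) - (a 0 - b 0)"
    by (rule suminf_split_head) (intro summable_diff sa sb)
  moreover have "suminf (\<lambda>j. a j - b j) = suminf a - suminf b"
    by (rule suminf_diff[OF sa sb, symmetric])
  moreover have "a 0 - b 0 = 0" by (simp add: a_def b_def)
  ultimately have "suminf a - suminf b = r * (suminf a - q powr y * suminf b)" by simp
  from arg_cong[OF this, of "\<lambda>z. (1 - q) * z"] show ?thesis
    unfolding mom r_def[symmetric] by (simp only: right_diff_distrib mult.left_commute)
qed

end


section \<open>Iterated \<open>q\<close>-integrals of polynomials\<close>

lemma qint_sum:
  assumes "\<And>a. a \<in> A \<Longrightarrow> summable (\<lambda>j. g a (q ^ j) * q ^ j)"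
  shows "qint q (\<lambda>u. \<Sum>a\<in>A. d a * g a u) = (\<Sum>a\<in>A. d a * qint q (g a))"
proof -
  have "(suminf (\<lambda>j. (\<Sum>a\<in>A. d a * g a (q ^ j)) * q ^ j)) = (suminf (\<lambda>j. \<Sum>a\<in>A. d a * (g a (q ^ j) * q ^ j)))"
    by (simp add: sum_distrib_right mult.assoc)
  also have "\<dots> = (\<Sum>a\<in>A. suminf (\<lambda>j. d a * (g a (q ^ j) * q ^ j)))"
    by (intro suminf_sum summable_mult assms)
  also have "\<dots> = (\<Sum>a\<in>A. d a * (suminf (\<lambda>j. g a (q ^ j) * q ^ j)))"
    by (intro sum.cong refl suminf_mult assms)
  finally show ?thesis by (simp add: qint_def sum_distrib_left mult.left_commute)
qed

text \<open>With separated variables the integral is evaluated from the inside out, so that no two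
  infinite sums are interchanged.\<close>

lemma qint_iter_sum_prod:
  assumes "\<And>a i. a \<in> A \<Longrightarrow> summable (\<lambda>j. h a i (q ^ j) * q ^ j)"
  shows "qint_iter q n (\<lambda>s. \<Sum>a\<in>A. c a * (\<Prod>i=1..n. h a i (s i))) =
    (\<Sum>a\<in>A. c a * (\<Prod>i=1..n. qint q (h a i)))"
proof (induction n arbitrary: c)
  case (Suc n)
  have "(\<Prod>i=1..Suc n. h a i ((s(Suc n := u)) i)) = (\<Prod>i=1..n. h a i (s i)) * h a (Suc n) u" for a s u
    by (simp add: prod.nat_ivl_Suc')
  then have "qint q (\<lambda>u. \<Sum>a\<in>A. c a * (\<Prod>i=1..Suc n. h a i ((s(Suc n := u)) i))) =
      qint q (\<lambda>u. \<Sum>a\<in>A. (c a * (\<Prod>i=1..n. h a i (s i))) * h a (Suc n) u)" for s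
    by (simp only: mult.assoc)
  also have "\<dots> s = (\<Sum>a\<in>A. (c a * (\<Prod>i=1..n. h a i (s i))) * qint q (h a (Suc n)))" for s
    by (intro qint_sum assms)
  also have "\<dots> s = (\<Sum>a\<in>A. (c a * qint q (h a (Suc n))) * (\<Prod>i=1..n. h a i (s i)))" for s
    by (simp only: mult_ac)
  finally have "qint_iter q (Suc n) (\<lambda>s. \<Sum>a\<in>A. c a * (\<Prod>i=1..Suc n. h a i (s i))) =
      qint_iter q n (\<lambda>s. \<Sum>a\<in>A. (c a * qint q (h a (Suc n))) * (\<Prod>i=1..n. h a i (s i)))"
    by simp
  also have "\<dots> = (\<Sum>a\<in>A. (c a * qint q (h a (Suc n))) * (\<Prod>i=1..n. qint q (h a i)))"
    by (rule Suc.IH)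
  finally show ?case by (simp add: prod.nat_ivl_Suc' mult_ac)
qed simp

text \<open>A q-integral samples only powers of q. There all s_i are nonzero, which turns the
  product containing s_j / s_i into a polynomial.\<close>

lemma qint_iter_cong:
  assumes "\<And>s. (\<And>i. i \<in> {1..n} \<Longrightarrow> \<exists>j. s i = q ^ j) \<Longrightarrow> f s = g s"
  shows "qint_iter q n f = qint_iter q n g"
  using assms
proof (induction n arbitrary: f g)
  case (Suc n)
  have "qint q (\<lambda>u. f (s(Suc n := u))) = qint q (\<lambda>u. g (s(Suc n := u)))"
    if s: "\<And>i. i \<in> {1..n} \<Longrightarrow> \<exists>j. s i = q ^ j" for s
  proof -
    have "f (s(Suc n := q ^ j)) = g (s(Suc n := q ^ j))" for j
    proof (rule Suc.prems)
      fix i assume "i \<in> {1..Suc n}"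
      then show "\<exists>k. (s(Suc n := q ^ j)) i = q ^ k"
        using s[of i] by (cases "i = Suc n") (simp_all, blast)
    qed
    then show ?thesis by (simp add: qint_def)
  qed
  then have "qint_iter q n (\<lambda>s. qint q (\<lambda>u. f (s(Suc n := u)))) = qint_iter q n (\<lambda>s. qint q (\<lambda>u. g (s(Suc n := u))))"
    by (rule Suc.IH)
  then show ?case by simp
qed simp

definition vars_in :: "nat \<Rightarrow> mpol \<Rightarrow> bool"
  where "vars_in n p \<longleftrightarrow> (\<forall>m\<in>keys p. keys m \<subseteq> {1..n})"

lemma vars_in_mult: "vars_in n f \<Longrightarrow> vars_in n g \<Longrightarrow> vars_in n (f * g)"
proof -
  assume fg: "vars_in n f" "vars_in n g"
  have "keys m \<subseteq> {1..n}" if m: "m \<in> keys (f * g)" for m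
  proof -
    obtain a b where "m = a + b" "a \<in> keys f" "b \<in> keys g" using keys_mult[of f g] m by blast
    moreover have "keys (a + b) \<subseteq> keys a \<union> keys b" by (rule keys_add)
    ultimately show ?thesis using fg unfolding vars_in_def by blast
  qed
  then show ?thesis by (simp add: vars_in_def)
qed

lemma vars_in_cst [simp]: "vars_in n (cst c)"
  by (simp add: vars_in_def cst_def)

lemma vars_in_1 [simp]: "vars_in n 1"
  using vars_in_cst[of n 1] by simp

lemma vars_in_var: "i \<in> {1..n} \<Longrightarrow> vars_in n (var i)"
  by (simp add: vars_in_def var_def)

lemma vars_in_diff: "vars_in n f \<Longrightarrow> vars_in n g \<Longrightarrow> vars_in n (f - g)"
  using keys_diff[of f g] unfolding vars_in_def by blast

lemma vars_in_prod: "(\<And>a. a \<in> A \<Longrightarrow> vars_in n (f a)) \<Longrightarrow> vars_in n (prod f A)"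
  by (induction A rule: infinite_finite_induct) (simp_all add: vars_in_mult)

text \<open>Stated for an arbitrary sequence \<mu>, because from here on only the recursion between
  consecutive moments matters.\<close>

definition moment_functional :: "nat \<Rightarrow> (nat \<Rightarrow> real) \<Rightarrow> mpol \<Rightarrow> real"
  where "moment_functional n \<mu> = linext (\<lambda>m. \<Prod>i=1..n. \<mu> (lookup m i))"

lemma qint_iter_eq_moment_functional:
  assumes q: "0 < q" "q < 1" and y: "\<And>m::nat. y \<noteq> - real m" and x: "x > 0" and p: "vars_in n p"
  shows "qint_iter q n (\<lambda>s. (\<Prod>i=1..n. weight q x y (s i)) * ev p s) = moment_functional n (moment q x y) p"
proof -
  have "(\<Prod>i=1..n. weight q x y (s i)) * ev p s =
      (\<Sum>m\<in>keys p. lookup p m * (\<Prod>i=1..n. weight q x y (s i) * s i ^ lookup m i))" for s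
  proof -
    have "ev p s = (\<Sum>m\<in>keys p. lookup p m * (\<Prod>i=1..n. s i ^ lookup m i))"
      unfolding ev_def using p
      by (intro sum.cong refl arg_cong2[where f = "(*)"] expo_prod_superset) (auto simp: vars_in_def)
    then show ?thesis by (simp add: sum_distrib_left prod.distrib mult_ac)
  qed
  then have "qint_iter q n (\<lambda>s. (\<Prod>i=1..n. weight q x y (s i)) * ev p s) =
      qint_iter q n (\<lambda>s. \<Sum>m\<in>keys p. lookup p m * (\<Prod>i=1..n. weight q x y (s i) * s i ^ lookup m i))"
    by simp
  also have "\<dots> = (\<Sum>m\<in>keys p. lookup p m * (\<Prod>i=1..n. qint q (\<lambda>u. weight q x y u * u ^ lookup m i)))"
    by (rule qint_iter_sum_prod[where h = "\<lambda>m i u. weight q x y u * u ^ lookup m i"])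
      (rule summable_moment[OF q y x])
  finally show ?thesis by (simp add: moment_functional_def linext_def moment_def)
qed

section \<open>The moment functional\<close>

lemma additive_moment_functional: "Modules.additive (moment_functional n \<mu>)"
  unfolding moment_functional_def by (rule additive_linext)

lemma moment_functional_cst_mult: "moment_functional n \<mu> (cst c * f) = c * moment_functional n \<mu> f"
  by (simp add: moment_functional_def linext_cst_mult)

lemma moment_functional_swap:
  assumes "1 \<le> i" "i < n"
  shows "moment_functional n \<mu> (swap_var i f) = moment_functional n \<mu> f"
proof (rule additive_eqI[where A = "\<lambda>f. moment_functional n \<mu> (swap_var i f)"])
  fix m :: expo and c :: real
  have "(\<Prod>k=1..n. \<mu> (lookup m (adj i k))) = (\<Prod>k=1..n. \<mu> (lookup m k))"
    by (rule prod.reindex_bij_betw[OF bij_betw_adj[OF assms]])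
  then show "moment_functional n \<mu> (swap_var i (single m c)) = moment_functional n \<mu> (single m c)"
    by (simp add: moment_functional_def lookup_map_key)
qed (use additive_moment_functional in \<open>simp_all add: Modules.additive_def swap_var_add\<close>)

text \<open>On a monomial only the exponent k of x_1 matters: multiplication by x_1 and
  \<open>psi\<close> both replace \<mu> k by \<mu> (k + 1), omega merely permutes the exponents, and
  the q^k that it brings is the one in the recursion.\<close>

lemma moment_functional_omega:
  assumes n: "n \<ge> 1" and rec: "\<And>k. \<mu> k - \<mu> (Suc k) = a * q ^ k * (\<mu> k - b * \<mu> (Suc k))"
  shows "moment_functional n \<mu> f - moment_functional n \<mu> (var 1 * f) =
    a * (moment_functional n \<mu> (omega_op n q f) - b * moment_functional n \<mu> (psi n q f))"
proof (rule additive_eqI[where A = "\<lambda>f. moment_functional n \<mu> f - moment_functional n \<mu> (var 1 * f)"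
      and B = "\<lambda>f. a * (moment_functional n \<mu> (omega_op n q f) - b * moment_functional n \<mu> (psi n q f))"])
  fix m :: expo and c :: real
  define R where "R = (\<Prod>k\<in>{1..n} - {1}. \<mu> (lookup m k))"
  have split: "(\<Prod>k=1..n. F k) = F 1 * (\<Prod>k\<in>{1..n} - {1}. F k)" for F :: "nat \<Rightarrow> real"
    using n by (intro prod.remove) auto
  have cong: "(\<Prod>k\<in>{1..n} - {1}. \<mu> (lookup m k + (if k = 1 then 1 else 0))) = R"
    unfolding R_def by (intro prod.cong) auto
  have 1: "(\<Prod>k=1..n. \<mu> (lookup m k)) = \<mu> (lookup m 1) * R"
    unfolding split R_def ..
  have shift: "(\<Prod>k=1..n. \<mu> (lookup m k + (if k = 1 then 1 else 0))) = \<mu> (Suc (lookup m 1)) * R"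
    unfolding split cong by simp
  have 2: "(\<Prod>k=1..n. \<mu> (lookup (m + single 1 1) k)) = \<mu> (Suc (lookup m 1)) * R"
    unfolding shift[symmetric] by (intro prod.cong refl) (simp add: lookup_add lookup_single when_def)
  have 3: "(\<Prod>k=1..n. \<mu> (lookup (Poly_Mapping.map_key (cyc n) m) k)) = \<mu> (lookup m 1) * R"
    unfolding lookup_map_key[OF inj_cyc[OF n]] 1[symmetric] by (rule prod.reindex_bij_betw[OF bij_betw_cyc])
  have "(\<Prod>k=1..n. \<mu> (lookup (rot_expo n m) k)) =
      (\<Prod>k=1..n. \<mu> (lookup m (cyc n k) + (if cyc n k = 1 then 1 else 0)))"
    unfolding lookup_rot_expo[OF n] by (intro prod.cong refl) (auto simp: rot_def cyc_def)
  also have "\<dots> = (\<Prod>k=1..n. \<mu> (lookup m k + (if k = 1 then 1 else 0)))"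
    by (rule prod.reindex_bij_betw[OF bij_betw_cyc])
  finally have 4: "(\<Prod>k=1..n. \<mu> (lookup (rot_expo n m) k)) = \<mu> (Suc (lookup m 1)) * R"
    unfolding shift .
  have "moment_functional n \<mu> (single m c) - moment_functional n \<mu> (var 1 * single m c) =
      c * R * (\<mu> (lookup m 1) - \<mu> (Suc (lookup m 1)))"
    unfolding var_mult_single moment_functional_def linext_single 1 2 by (simp add: algebra_simps)
  also have "\<dots> = c * R * (a * q ^ lookup m 1 * (\<mu> (lookup m 1) - b * \<mu> (Suc (lookup m 1))))"
    by (simp only: rec)
  also have "\<dots> = a * (moment_functional n \<mu> (omega_op n q (single m c)) - b * moment_functional n \<mu> (psi n q (single m c)))"
    unfolding omega_single[OF n] psi_single[OF n] moment_functional_def linext_single 3 4 by (simp add: algebra_simps)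
  finally show "moment_functional n \<mu> (single m c) - moment_functional n \<mu> (var 1 * single m c) =
    a * (moment_functional n \<mu> (omega_op n q (single m c)) - b * moment_functional n \<mu> (psi n q (single m c)))" .
qed (use additive_moment_functional in \<open>simp_all add: Modules.additive_def omega_add psi_add distrib_left algebra_simps\<close>)


section \<open>The Vandermonde weight\<close>

text \<open>The factor s_i^(2l) (q^(1-l) s_j / s_i; q)_(2l), made homogeneous; the exponents of q
  run from 1 - l to l.\<close>

definition vand :: "real \<Rightarrow> nat \<Rightarrow> mpol \<Rightarrow> mpol \<Rightarrow> mpol"
  where "vand q l X Y = (\<Prod>k<2 * l. X - cst (q powi (1 - int l + int k)) * Y)"

lemma vand_0 [simp]: "vand q 0 X Y = 1"
  by (simp add: vand_def)

lemma vand_Suc: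
  "vand q (Suc m) X Y = (X - cst (q powi (- int m)) * Y) * (X - cst (q ^ Suc m) * Y) * vand q m X Y"
proof -
  define g where "g k = X - cst (q powi (1 - int (Suc m) + int k)) * Y" for k
  have "vand q (Suc m) X Y = (\<Prod>k<Suc (Suc (2 * m)). g k)"
    by (simp add: vand_def g_def)
  also have "\<dots> = g 0 * (\<Prod>k<Suc (2 * m). g (Suc k))" by (rule prod.lessThan_Suc_shift)
  also have "(\<Prod>k<Suc (2 * m). g (Suc k)) = (\<Prod>k<2 * m. g (Suc k)) * g (Suc (2 * m))" by simp
  also have "(\<Prod>k<2 * m. g (Suc k)) = vand q m X Y"
    unfolding vand_def g_def by (intro prod.cong refl) (simp add: algebra_simps)
  also have "g (Suc (2 * m)) = X - cst (q ^ Suc m) * Y"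
  proof -
    have "1 - int (Suc m) + int (Suc (2 * m)) = int (Suc m)" by simp
    then show ?thesis unfolding g_def by (simp only: power_int_of_nat)
  qed
  also have "g 0 = X - cst (q powi (- int m)) * Y" by (simp add: g_def)
  finally show ?thesis by (simp only: mult_ac)
qed

lemma cst_powi_inverse: "q \<noteq> 0 \<Longrightarrow> cst (q ^ m) * cst (q powi (- int m)) = 1"
  by (simp flip: cst_mult add: power_int_minus)

text \<open>Taking q out of each factor moves the exponents 1 - m, ..., m to -m, ..., m - 1, and
  exchanging X and Y negates exponents, so the factors match up to constants, which collect to q^m.
  The induction treats them in pairs.\<close>

lemma vand_rotate:
  assumes "q \<noteq> 0"
  shows "vand q m (cst q * X) Y = cst (q ^ m) * vand q m Y X"
proof (induction m)
  case (Suc m)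
  have 1: "cst (q ^ m) * cst (q powi (- int m)) = 1" by (rule cst_powi_inverse[OF assms])
  have 2: "cst (q ^ Suc m) = cst q * cst (q ^ m)" by (simp add: cst_mult)
  have "(cst q * X - cst (q powi (- int m)) * Y) * (cst q * X - cst (q ^ Suc m) * Y) =
      cst q * ((Y - cst (q powi (- int m)) * X) * (Y - cst (q ^ Suc m) * X))"
    using 1 unfolding 2 by algebra
  then show ?case unfolding vand_Suc Suc.IH 2 by (simp only: mult_ac)
qed simp

definition vand_sym :: "real \<Rightarrow> nat \<Rightarrow> mpol \<Rightarrow> mpol \<Rightarrow> mpol"
  where "vand_sym q m X Y = (\<Prod>e=1..m. (X - cst (q ^ e) * Y) * (X - cst (q powi (- int e)) * Y))"

lemma vand_sym_commute:
  assumes "q \<noteq> 0"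
  shows "vand_sym q m X Y = vand_sym q m Y X"
  unfolding vand_sym_def
proof (intro prod.cong refl)
  fix e
  show "(X - cst (q ^ e) * Y) * (X - cst (q powi (- int e)) * Y) =
      (Y - cst (q ^ e) * X) * (Y - cst (q powi (- int e)) * X)"
    using cst_powi_inverse[OF assms, of e] by algebra
qed

text \<open>The exponents -m, ..., m + 1 consist of 0, of m + 1 and of the pairs e, -e, and each
  pair gives a factor symmetric in X and Y. With t = q^(m+1) the rest is (X - Y)(X - t Y), which is
  what T_i calls for.\<close>

lemma vand_factor: "vand q (Suc m) X Y = (X - Y) * (X - cst (q ^ Suc m) * Y) * vand_sym q m X Y"
proof (induction m)
  case 0
  show ?case by (simp add: vand_Suc vand_sym_def)
next
  case (Suc m)
  have "vand_sym q (Suc m) X Y = (X - cst (q ^ Suc m) * Y) * (X - cst (q powi (- int (Suc m))) * Y) * vand_sym q m X Y"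
    unfolding vand_sym_def by (simp add: mult_ac)
  then show ?case unfolding vand_Suc[of q "Suc m"] Suc.IH by (simp only: mult_ac)
qed

lemma swap_var_prod: "swap_var i (prod f A) = (\<Prod>a\<in>A. swap_var i (f a))"
  by (induction A rule: infinite_finite_induct) (simp_all add: swap_var_mult)

lemma omega_prod: "n \<ge> 1 \<Longrightarrow> omega_op n q (prod f A) = (\<Prod>a\<in>A. omega_op n q (f a))"
  by (induction A rule: infinite_finite_induct) (simp_all add: omega_mult)

lemma swap_var_vand: "swap_var i (vand q l X Y) = vand q l (swap_var i X) (swap_var i Y)"
  by (simp add: vand_def swap_var_prod swap_var_diff swap_var_mult)

lemma swap_var_vand_sym: "swap_var i (vand_sym q l X Y) = vand_sym q l (swap_var i X) (swap_var i Y)"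
  by (simp add: vand_sym_def swap_var_prod swap_var_diff swap_var_mult)

lemma omega_vand: "n \<ge> 1 \<Longrightarrow> omega_op n q (vand q l X Y) = vand q l (omega_op n q X) (omega_op n q Y)"
  by (simp add: vand_def omega_prod omega_diff omega_mult)

definition vand_weight :: "nat \<Rightarrow> real \<Rightarrow> nat \<Rightarrow> mpol"
  where "vand_weight n q l = (\<Prod>i=1..n. \<Prod>j\<in>{i<..n}. vand q l (var i) (var j))"

lemma vars_in_vand_weight: "vars_in n (vand_weight n q l)"
  unfolding vand_weight_def vand_def
  by (intro vars_in_prod vars_in_diff vars_in_mult vars_in_cst vars_in_var) auto

text \<open>Exchanging i and i + 1 permutes the pairs a < b other than (i, i + 1) and keeps them
  ordered, so their product is symmetric.\<close>

lemma vand_weight_swap: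
  assumes "1 \<le> i" "i < n"
  shows "\<exists>Q. vand_weight n q l = vand q l (var i) (var (Suc i)) * Q \<and> swap_var i Q = Q"
proof -
  define S where "S = (SIGMA a:{1..n}. {a<..n}) - {(i, Suc i)}"
  define g where "g = (\<lambda>(a, b). vand q l (var a) (var b))"
  have fin: "finite (SIGMA a:{1..n}. {a<..n})" by simp
  have "vand_weight n q l = prod g (SIGMA a:{1..n}. {a<..n})"
    unfolding vand_weight_def g_def by (subst prod.Sigma) simp_all
  also have "\<dots> = g (i, Suc i) * prod g S"
    unfolding S_def by (rule prod.remove[OF fin]) (use assms in auto)
  finally have 1: "vand_weight n q l = vand q l (var i) (var (Suc i)) * prod g S" by (simp add: g_def)
  define \<tau> where "\<tau> = (\<lambda>(a, b). (adj i a, adj i b))"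
  have \<tau>S: "\<tau> p \<in> S" if "p \<in> S" for p
  proof -
    obtain a b where p: "p = (a, b)" by (cases p)
    have "1 \<le> a" "a < b" "b \<le> n" "a \<noteq> i \<or> b \<noteq> Suc i"
      using that by (auto simp: S_def p)
    then show ?thesis using assms p
      by (auto simp: S_def \<tau>_def Transposition.transpose_def split: if_splits)
  qed
  have \<tau>\<tau>: "\<tau> (\<tau> p) = p" for p by (cases p) (simp add: \<tau>_def)
  have "bij_betw \<tau> S S"
    by (rule bij_betw_byWitness[where f' = \<tau>]) (use \<tau>S \<tau>\<tau> in auto)
  then have "prod (\<lambda>p. g (\<tau> p)) S = prod g S" by (rule prod.reindex_bij_betw)
  moreover have "swap_var i (g p) = g (\<tau> p)" for p
    by (cases p) (simp add: g_def \<tau>_def swap_var_vand)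
  ultimately have "swap_var i (prod g S) = prod g S" by (simp add: swap_var_prod)
  with 1 show ?thesis by blast
qed

text \<open>Pairs a < b with a > 1 are just shifted. A pair (1, b) becomes q x_n and x_(b-1), in the
  wrong order; \<open>vand_rotate\<close> restores it at the price of q^l, for n - 1 values of
  b.\<close>

lemma vand_weight_omega:
  assumes n: "n \<ge> 1" and q: "q \<noteq> 0"
  shows "omega_op n q (vand_weight n q l) = cst ((q ^ l) ^ (n - 1)) * vand_weight n q l"
proof -
  obtain m where m: "n = Suc m" using n by (cases n) auto
  let ?V = "\<lambda>a b. vand q l (var a) (var b)"
  let ?W = "\<Prod>a=1..m. \<Prod>b\<in>{a<..m}. ?V a b"
  have "vand_weight n q l = (\<Prod>a=1..m. \<Prod>b\<in>{a<..Suc m}. ?V a b)"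
    unfolding vand_weight_def m by (simp add: prod.nat_ivl_Suc')
  also have "\<dots> = (\<Prod>a=1..m. (\<Prod>b\<in>{a<..m}. ?V a b) * ?V a (Suc m))"
  proof (intro prod.cong refl)
    fix a assume "a \<in> {1..m}"
    then have "{a<..Suc m} = insert (Suc m) {a<..m}" by auto
    then show "(\<Prod>b\<in>{a<..Suc m}. ?V a b) = (\<Prod>b\<in>{a<..m}. ?V a b) * ?V a (Suc m)" by (simp add: mult.commute)
  qed
  finally have W: "vand_weight n q l = ?W * (\<Prod>a=1..m. ?V a n)" by (simp only: prod.distrib m)
  have re: "(\<Prod>a\<in>Suc ` A. G a) = (\<Prod>a\<in>A. G (Suc a))" for A and G :: "nat \<Rightarrow> mpol"
    by (simp add: prod.reindex)
  have "{1..n} = insert 1 (Suc ` {1..m})" unfolding m by (auto simp: image_Suc_atLeastAtMost)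
  then have "vand_weight n q l = (\<Prod>b\<in>{1<..n}. ?V 1 b) * (\<Prod>a\<in>Suc ` {1..m}. \<Prod>b\<in>{a<..n}. ?V a b)"
    unfolding vand_weight_def by (simp add: image_iff)
  also have "{1<..n} = Suc ` {1..m}" unfolding m image_Suc_atLeastAtMost by auto
  also have "(\<Prod>a\<in>Suc ` {1..m}. \<Prod>b\<in>{a<..n}. ?V a b) = (\<Prod>a=1..m. \<Prod>b\<in>{a<..m}. ?V (Suc a) (Suc b))"
  proof -
    have "{Suc a<..n} = Suc ` {a<..m}" for a
      unfolding m using image_Suc_atLeastAtMost[of "Suc a" m] by (simp add: atLeastSucAtMost_greaterThanAtMost)
    then show ?thesis by (simp only: re)
  qed
  finally have "omega_op n q (vand_weight n q l) = (\<Prod>b=1..m. vand q l (omega_op n q (var 1)) (omega_op n q (var (Suc b)))) *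
      (\<Prod>a=1..m. \<Prod>b\<in>{a<..m}. vand q l (omega_op n q (var (Suc a))) (omega_op n q (var (Suc b))))"
    by (simp only: re omega_mult[OF n] omega_prod[OF n] omega_vand[OF n])
  also have "(\<Prod>b=1..m. vand q l (omega_op n q (var 1)) (omega_op n q (var (Suc b)))) =
      (\<Prod>b=1..m. cst (q ^ l) * ?V b n)"
  proof (intro prod.cong refl)
    fix b assume "b \<in> {1..m}"
    then have "omega_op n q (var (Suc b)) = var b" using m by (intro omega_var_Suc) auto
    then show "vand q l (omega_op n q (var 1)) (omega_op n q (var (Suc b))) = cst (q ^ l) * ?V b n"
      by (simp only: omega_var_1[OF n] vand_rotate[OF q])
  qed
  also have "(\<Prod>a=1..m. \<Prod>b\<in>{a<..m}. vand q l (omega_op n q (var (Suc a))) (omega_op n q (var (Suc b)))) = ?W"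
    using m by (intro prod.cong refl) (simp add: omega_var_Suc)
  also have "(\<Prod>b=1..m. cst (q ^ l) * ?V b n) = cst ((q ^ l) ^ m) * (\<Prod>b=1..m. ?V b n)"
    by (simp add: prod.distrib cst_power)
  finally show ?thesis unfolding W by (simp add: m mult_ac)
qed

lemma ev_vand_weight:
  assumes q: "q > 0" and s: "\<And>i. i \<in> {1..n} \<Longrightarrow> \<exists>j. s i = q ^ j"
  shows "ev (vand_weight n q l) s =
    (\<Prod>i=1..n. \<Prod>j\<in>{i<..n}. s i ^ (2 * l) * qpoch (q powi (1 - int l) * (s j / s i)) q (2 * l))"
  unfolding vand_weight_def ev_prod
proof (intro prod.cong refl)
  fix i j assume "i \<in> {1..n}"
  then have "s i \<noteq> 0" using s[of i] q by auto
  then have "s i * (1 - q powi (1 - int l) * (s j / s i) * q ^ k) = s i - q powi (1 - int l + int k) * s j" for k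
  proof -
    have "q powi (1 - int l + int k) = q powi (1 - int l) * q ^ k"
      using q power_int_add[of q "1 - int l" "int k"] by simp
    then show ?thesis using \<open>s i \<noteq> 0\<close> by (simp only:) (simp add: field_simps)
  qed
  note eq = this
  have "s i ^ (2 * l) = (\<Prod>k<2 * l. s i)" by simp
  then have "s i ^ (2 * l) * qpoch (q powi (1 - int l) * (s j / s i)) q (2 * l) =
      (\<Prod>k<2 * l. s i * (1 - q powi (1 - int l) * (s j / s i) * q ^ k))"
    by (simp only: qpoch_def prod.distrib)
  then show "ev (vand q l (var i) (var j)) s =
      s i ^ (2 * l) * qpoch (q powi (1 - int l) * (s j / s i)) q (2 * l)"
    by (simp only: eq vand_def ev_prod ev_diff ev_mult ev_cst ev_var)
qed


section \<open>The integral functional\<close>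

definition selberg :: "nat \<Rightarrow> real \<Rightarrow> nat \<Rightarrow> (nat \<Rightarrow> real) \<Rightarrow> mpol \<Rightarrow> real"
  where "selberg n q l \<mu> f = moment_functional n \<mu> (vand_weight n q l * f)"

lemma selberg_cst_mult: "selberg n q l \<mu> (cst c * f) = c * selberg n q l \<mu> f"
  using moment_functional_cst_mult[of n \<mu> c "vand_weight n q l * f"] by (simp add: selberg_def mult.left_commute)

lemma selberg_add: "selberg n q l \<mu> (f + g) = selberg n q l \<mu> f + selberg n q l \<mu> g"
  by (simp add: selberg_def distrib_left additive.add[OF additive_moment_functional])

text \<open>The factor x_i - x_(i+1) of the weight absorbs the denominator of T_i f, and in the term
  with s_i f the two variables are exchanged under the integral. With x = x_i and y = x_(i+1) there
  remains (y - t x)(t y - x) + (x - t y)(1 - t) y = t (x - y)(x - t y). For l = 0 the pair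
  contributes no such factors, but then T_i is s_i.\<close>

lemma selberg_T:
  assumes q: "q \<noteq> 0" and i: "1 \<le> i" "i < n"
  shows "selberg n q l \<mu> (T_op (q ^ l) i f) = q ^ l * selberg n q l \<mu> f"
proof -
  let ?M = "moment_functional n \<mu>" and ?x = "var i" and ?y = "var (Suc i)" and ?t = "cst (q ^ l)"
  obtain Q0 where W: "vand_weight n q l = vand q l ?x ?y * Q0" and Q0: "swap_var i Q0 = Q0"
    using vand_weight_swap[OF i] by blast
  show ?thesis
  proof (cases l)
    case 0
    have "?M (swap_var i (Q0 * f)) = ?M (Q0 * f)" by (rule moment_functional_swap[OF i])
    then show ?thesis by (simp add: selberg_def 0 T_op_1_left W[unfolded 0] swap_var_mult Q0)
  next
    case (Suc m)
    define Q where "Q = vand_sym q m ?x ?y * Q0"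
    have Q: "swap_var i Q = Q"
      using vand_sym_commute[OF q, of m ?x ?y] by (simp add: Q_def swap_var_mult Q0 swap_var_vand_sym)
    have WQ: "vand_weight n q l = (?x - ?y) * ((?x - ?t * ?y) * Q)"
    proof -
      have "vand q l ?x ?y = (?x - ?y) * (?x - ?t * ?y) * vand_sym q m ?x ?y"
        unfolding Suc by (rule vand_factor)
      then show ?thesis unfolding W Q_def by (simp only: mult_ac)
    qed
    have "vand_weight n q l * T_op (q ^ l) i f = (?x - ?t * ?y) * Q * ((?x - ?y) * T_op (q ^ l) i f)"
      unfolding WQ by (simp only: mult_ac)
    also have "\<dots> = (?x - ?t * ?y) * Q * ((?t * ?x - ?y) * swap_var i f) + (?x - ?t * ?y) * Q * ((1 - ?t) * ?y * f)"
      unfolding D_mult_T by (simp only: distrib_left)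
    finally have "selberg n q l \<mu> (T_op (q ^ l) i f) =
        ?M ((?x - ?t * ?y) * Q * ((?t * ?x - ?y) * swap_var i f)) + ?M ((?x - ?t * ?y) * Q * ((1 - ?t) * ?y * f))"
      by (simp only: selberg_def additive.add[OF additive_moment_functional])
    also have "?M ((?x - ?t * ?y) * Q * ((?t * ?x - ?y) * swap_var i f)) =
        ?M (swap_var i ((?x - ?t * ?y) * Q * ((?t * ?x - ?y) * swap_var i f)))"
      by (rule moment_functional_swap[OF i, symmetric])
    also have "swap_var i ((?x - ?t * ?y) * Q * ((?t * ?x - ?y) * swap_var i f)) =
        (?y - ?t * ?x) * Q * ((?t * ?y - ?x) * f)"
      by (simp add: swap_var_mult swap_var_diff Q)
    also have "?M ((?y - ?t * ?x) * Q * ((?t * ?y - ?x) * f)) + ?M ((?x - ?t * ?y) * Q * ((1 - ?t) * ?y * f)) =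
        ?M ((?y - ?t * ?x) * Q * ((?t * ?y - ?x) * f) + (?x - ?t * ?y) * Q * ((1 - ?t) * ?y * f))"
      by (rule additive.add[OF additive_moment_functional, symmetric])
    also have "(?y - ?t * ?x) * Q * ((?t * ?y - ?x) * f) + (?x - ?t * ?y) * Q * ((1 - ?t) * ?y * f) =
        ?t * (vand_weight n q l * f)"
      unfolding WQ by algebra
    also have "?M \<dots> = q ^ l * selberg n q l \<mu> f"
      by (simp only: moment_functional_cst_mult selberg_def)
    finally show ?thesis .
  qed
qed

lemma selberg_omega:
  assumes n: "n \<ge> 1" and q: "q \<noteq> 0"
    and rec: "\<And>k. \<mu> k - \<mu> (Suc k) = a * q ^ k * (\<mu> k - b * \<mu> (Suc k))"
  shows "selberg n q l \<mu> f - selberg n q l \<mu> (var 1 * f) =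
    a * (q ^ l) ^ (n - 1) * (selberg n q l \<mu> (omega_op n q f) - b * selberg n q l \<mu> (psi n q f))"
proof -
  let ?W = "vand_weight n q l" and ?M = "moment_functional n \<mu>"
  have 1: "omega_op n q (?W * f) = cst ((q ^ l) ^ (n - 1)) * (?W * omega_op n q f)"
    unfolding omega_mult[OF n] vand_weight_omega[OF n q] by (rule mult.assoc)
  have 2: "psi n q (?W * f) = cst ((q ^ l) ^ (n - 1)) * (?W * psi n q f)"
    unfolding psi_def 1 by (simp only: mult_ac)
  have 3: "?W * (var 1 * f) = var 1 * (?W * f)" by (rule mult.left_commute)
  show ?thesis
    unfolding selberg_def 3 moment_functional_omega[OF n rec] 1 2 moment_functional_cst_mult
    by (simp add: algebra_simps)
qed

lemma ev_T_delta:
  assumes "1 \<le> i"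
  shows "ev (T_op t i f) (\<lambda>i. t ^ (i - 1)) = t * ev f (\<lambda>i. t ^ (i - 1))"
proof -
  obtain k where "i = Suc k" using assms by (cases i) auto
  then show ?thesis by (simp add: T_op_def ev_add ev_mult ev_diff)
qed

lemma generic_power_q:
  assumes "0 < q" "q < 1"
  shows "generic n q (q ^ l)"
proof -
  have "q * (q ^ l) ^ n \<le> q * 1"
    using assms by (intro mult_left_mono power_le_one) (auto simp: power_le_one)
  also have "\<dots> < 1" using assms by simp
  finally show ?thesis using assms by (simp add: generic_def)
qed

text \<open>Stated without division, so that the induction does not care whether brackets of
  intermediate compositions vanish.\<close>

lemma creation_selberg:
  assumes c: "creation n q \<eta> F" and n: "n \<ge> 1" and q: "0 < q" "q < 1"
    and rec: "\<And>k. \<mu> k - \<mu> (Suc k) = q powr x * q ^ k * (\<mu> k - q powr y * \<mu> (Suc k))"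
    and t: "t = q ^ l"
    and u: "q powr u = q powr x * t ^ (n - 1)" and v: "q powr v = q powr (x + y) * (t ^ (n - 1))\<^sup>2"
  shows "selberg n q l \<mu> (F t) * qbracket n q t v (parts_sorted n (lookup \<eta>)) =
    ev (F t) (\<lambda>i. t ^ (i - 1)) * qbracket n q t u (parts_sorted n (lookup \<eta>)) * selberg n q l \<mu> 1"
proof -
  let ?L = "selberg n q l \<mu>" and ?E = "\<lambda>f. ev f (\<lambda>i. t ^ (i - 1))"
  have t01: "0 < t" "t \<le> 1" "t \<noteq> 0" using q by (auto simp: t power_le_one)
  have g: "generic n q t" unfolding t by (rule generic_power_q[OF q])
  have LT: "?L (T_op t i f) = t * ?L f" if "1 \<le> i" "i < n" for i f
    unfolding t using q that by (intro selberg_T) auto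
  from c show ?thesis
  proof induction
    case zero
    have "lookup (0::expo) = (\<lambda>_. 0)" by auto
    then show ?case by (simp add: qbracket_parts_sorted)
  next
    case (raise \<eta> F i)
    let ?c = "(t - 1) * spec n q t (lookup \<eta>) i / (spec n q t (lookup \<eta>) (Suc i) - spec n q t (lookup \<eta>) i)"
    have 1: "?L (cst (inverse t) * (T_op t i (F t) + cst ?c * F t)) = inverse t * (t + ?c) * ?L (F t)"
      using raise.hyps by (simp add: selberg_cst_mult selberg_add LT distrib_right mult.assoc)
    have 2: "?E (cst (inverse t) * (T_op t i (F t) + cst ?c * F t)) = inverse t * (t + ?c) * ?E (F t)"
      using ev_T_delta[OF raise.hyps(2), of t "F t"] by (simp add: ev_add ev_mult distrib_right mult.assoc)
    have 3: "qbracket n q t w (parts_sorted n (lookup (swap_expo i \<eta>))) = qbracket n q t w (parts_sorted n (lookup \<eta>))" for w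
      unfolding lookup_swap_expo by (rule qbracket_swap) (use raise.hyps in auto)
    show ?case unfolding 1 2 3 using raise.IH by (simp only: mult.assoc)
  next
    case (rotate \<eta> F)
    define h where "h = lookup \<eta> 1"
    define k where "k = leg' n (lookup \<eta>) 1"
    define T where "T = t ^ (n - 1)"
    define e where "e = spec n q t (lookup \<eta>) 1"
    have T: "T > 0" using t01 by (simp add: T_def)
    have e: "e * t ^ k = q ^ h" "e \<noteq> 0"
      using t01 q by (simp_all add: e_def spec_eq h_def k_def power_inverse)
    have "1 \<in> {1..n}" using n by simp
    then have Y: "Y_op n q t 1 (F t) = cst e * F t"
      unfolding e_def by (rule creation_Y[OF rotate.hyps n g])
    have L1: "?L (omega_op n q (F t)) = e * ?L (F t)" and L2: "?L (psi n q (F t)) = T * e * ?L (var 1 * F t)"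
      unfolding T_def using functional_omega[of t n ?L q "F t" e] t01 n LT Y selberg_cst_mult by blast+
    have E2: "?E (psi n q (F t)) = T * e * ?E (F t)"
      unfolding T_def using functional_omega(2)[of t n ?E q "F t" e] t01 n Y ev_T_delta
      by (simp add: ev_mult)
    have "?L (F t) - ?L (var 1 * F t) = q powr x * T * (e * ?L (F t) - q powr y * ?L (psi n q (F t)))"
      using selberg_omega[OF n _ rec, of l "F t"] q(1) unfolding t[symmetric] L1 T_def[symmetric] by simp
    \<comment> \<open>The integral of x_1 f is eliminated by means of \<open>L2\<close>. The factors
      with 1 - ... are those of the added box in \<open>B\<close>, for v and for u.\<close>
    then have key: "?L (psi n q (F t)) * (1 - q powr x * q powr y * T\<^sup>2 * e) =
        T * e * ?L (F t) * (1 - q powr x * T * e)"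
      using L2 by algebra
    \<comment> \<open>The added box contributes t^k - q^(h + w) = t^k (1 - e q^w), because e = q^h
      t^(-k).\<close>
    have B: "qbracket n q t w (parts_sorted n (lookup (rot_expo n \<eta>))) =
        qbracket n q t w (parts_sorted n (lookup \<eta>)) * (t ^ k * (1 - e * q powr w))" for w
    proof -
      have "t ^ k - q powr (real h + w) = t ^ k * (1 - e * q powr w)"
        using q by (simp add: powr_add powr_realpow right_diff_distrib mult.assoc[symmetric] mult.commute[of "t ^ k"] e(1))
      then show ?thesis unfolding lookup_rot_expo[OF n] qbracket_rot[OF n] h_def k_def by simp
    qed
    have u': "q powr u = q powr x * T" and v': "q powr v = q powr x * q powr y * T\<^sup>2"
      using u v by (simp_all add: T_def powr_add)
    let ?Bv = "qbracket n q t v (parts_sorted n (lookup \<eta>))" and ?Bu = "qbracket n q t u (parts_sorted n (lookup \<eta>))"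
    let ?q = "inverse (q ^ lookup \<eta> 1)"
    have "?L (cst ?q * psi n q (F t)) * (?Bv * (t ^ k * (1 - e * q powr v))) =
        ?q * t ^ k * ?Bv * (?L (psi n q (F t)) * (1 - q powr x * q powr y * T\<^sup>2 * e))"
      unfolding selberg_cst_mult v' by (simp only: mult_ac)
    also have "\<dots> = ?q * t ^ k * T * e * (1 - q powr x * T * e) * (?L (F t) * ?Bv)"
      unfolding key by (simp only: mult_ac)
    also have "\<dots> = ?q * t ^ k * T * e * (1 - q powr x * T * e) * (?E (F t) * ?Bu * ?L 1)"
      unfolding rotate.IH ..
    also have "\<dots> = ?E (cst ?q * psi n q (F t)) * (?Bu * (t ^ k * (1 - e * q powr u))) * ?L 1"
      unfolding ev_mult ev_cst E2 u' by (simp only: mult_ac)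
    finally show ?case unfolding B .
  qed
qed

theorem proposition4p8:
  fixes n lam :: nat and q t a b x y :: real and \<eta> :: expo
  assumes "n \<ge> 1" and "0 < q" and "q < 1"
    and "t = q ^ lam"
    and "x = - b - real lam * (real n - 1)"
    and "y = a + b + 1"
    and "Poly_Mapping.keys \<eta> \<subseteq> {1..n}"
    and "x > 0"
    and "\<And>m::nat. a + b + 1 \<noteq> - real m"
    and "qbracket n q t (x + y + 2 * real lam * (real n - 1))
           (parts_sorted n (Poly_Mapping.lookup \<eta>)) \<noteq> 0"
  shows
    "qint_iter q n (\<lambda>s.
        (\<Prod>i=1..n. s i powr (x - 1) * (qpoch_inf (q * s i) q / qpoch_inf (q powr (a + b + 1) * s i) q))
        * ev (nonsym_macdonald n q t \<eta>) s
        * (\<Prod>i=1..n. \<Prod>j\<in>{i<..n}. s i ^ (2 * lam) * qpoch (q powi (1 - int lam) * (s j / s i)) q (2 * lam)))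
     = ev (nonsym_macdonald n q t \<eta>) (\<lambda>i. t ^ (i - 1))
       * (qbracket n q t (x + real lam * (real n - 1)) (parts_sorted n (Poly_Mapping.lookup \<eta>))
          / qbracket n q t (x + y + 2 * real lam * (real n - 1)) (parts_sorted n (Poly_Mapping.lookup \<eta>)))
       * qint_iter q n (\<lambda>s.
          (\<Prod>i=1..n. s i powr (x - 1) * (qpoch_inf (q * s i) q / qpoch_inf (q powr (a + b + 1) * s i) q))
          * (\<Prod>i=1..n. \<Prod>j\<in>{i<..n}. s i ^ (2 * lam) * qpoch (q powi (1 - int lam) * (s j / s i)) q (2 * lam)))"
proof -
  note n = assms(1) and q = assms(2,3) and t = assms(4) and x = assms(8)
  have y: "\<And>m::nat. y \<noteq> - real m" unfolding assms(6) by (rule assms(9))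
  have q0: "q \<noteq> 0" using q by simp
  define \<mu> where "\<mu> = moment q x y"
  let ?L = "selberg n q lam \<mu>"
  obtain F where c: "creation n q \<eta> F" using creation_ex[OF n q0 assms(7)] by blast
  have g: "generic n q t" unfolding t by (rule generic_power_q[OF q])
  define E where "E = F t"
  have E: "nonsym_macdonald n q t \<eta> = E"
    unfolding E_def by (rule nonsym_macdonald_creation[OF c n g])
  have "t \<noteq> 0" using q by (simp add: t)
  then have "supported_below n \<eta> E" unfolding E_def by (rule creation_supported[OF c n q0])
  then have vE: "vars_in n E" unfolding supported_below_def vars_in_def by blast
  \<comment> \<open>Used for f = E and for f = 1, the two integrals of the theorem.\<close>
  have int: "qint_iter q n (\<lambda>s. (\<Prod>i=1..n. weight q x y (s i)) * ev f s *
      (\<Prod>i=1..n. \<Prod>j\<in>{i<..n}. s i ^ (2 * lam) * qpoch (q powi (1 - int lam) * (s j / s i)) q (2 * lam))) = ?L f"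
    if "vars_in n f" for f
  proof -
    have "?L f = qint_iter q n (\<lambda>s. (\<Prod>i=1..n. weight q x y (s i)) * ev (vand_weight n q lam * f) s)"
      unfolding selberg_def \<mu>_def
      by (rule qint_iter_eq_moment_functional[OF q y x, symmetric]) (intro vars_in_mult vars_in_vand_weight that)
    also have "\<dots> = qint_iter q n (\<lambda>s. (\<Prod>i=1..n. weight q x y (s i)) * ev f s *
      (\<Prod>i=1..n. \<Prod>j\<in>{i<..n}. s i ^ (2 * lam) * qpoch (q powi (1 - int lam) * (s j / s i)) q (2 * lam)))"
    proof (rule qint_iter_cong)
      fix s assume s: "\<And>i. i \<in> {1..n} \<Longrightarrow> \<exists>j. s i = q ^ j"
      have "p * (v * u) = p * u * v" for p u v :: real by simp
      then show "(\<Prod>i=1..n. weight q x y (s i)) * ev (vand_weight n q lam * f) s =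
          (\<Prod>i=1..n. weight q x y (s i)) * ev f s *
          (\<Prod>i=1..n. \<Prod>j\<in>{i<..n}. s i ^ (2 * lam) * qpoch (q powi (1 - int lam) * (s j / s i)) q (2 * lam))"
        by (simp only: ev_mult ev_vand_weight[of q n s lam, OF q(1) s])
    qed
    finally show ?thesis ..
  qed
  have "real (lam * (n - 1)) = real lam * (real n - 1)" using n by (simp add: of_nat_diff)
  then have tn: "q powr (real lam * (real n - 1)) = t ^ (n - 1)"
    using q powr_realpow[of q "lam * (n - 1)"] by (simp only: t power_mult)
  have u: "q powr (x + real lam * (real n - 1)) = q powr x * t ^ (n - 1)"
    by (simp only: powr_add tn)
  have "2 * real lam * (real n - 1) = real lam * (real n - 1) + real lam * (real n - 1)" by simp
  then have v: "q powr (x + y + 2 * real lam * (real n - 1)) = q powr (x + y) * (t ^ (n - 1))\<^sup>2"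
    by (simp only: powr_add[of q "x + y"] powr_add[of q "real lam * (real n - 1)"] tn power2_eq_square)
  have rec: "\<mu> k - \<mu> (Suc k) = q powr x * q ^ k * (\<mu> k - q powr y * \<mu> (Suc k))" for k
    using moment_rec[OF q y x, of k] unfolding \<mu>_def powr_add powr_realpow[OF q(1)] .
  have main: "?L E * qbracket n q t (x + y + 2 * real lam * (real n - 1)) (parts_sorted n (lookup \<eta>)) =
      ev E (\<lambda>i. t ^ (i - 1)) * qbracket n q t (x + real lam * (real n - 1)) (parts_sorted n (lookup \<eta>)) * ?L 1"
    unfolding E_def by (rule creation_selberg[OF c n q rec t u v])
  have L1: "?L 1 = qint_iter q n (\<lambda>s. (\<Prod>i=1..n. weight q x y (s i)) *
      (\<Prod>i=1..n. \<Prod>j\<in>{i<..n}. s i ^ (2 * lam) * qpoch (q powi (1 - int lam) * (s j / s i)) q (2 * lam)))"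
    using int[of 1] by simp
  have divide: "p = e * (u / v) * w" if "p * v = e * u * w" "v \<noteq> 0" for p e u v w :: real
    using that by (simp add: field_simps)
  show ?thesis
    unfolding E assms(6)[symmetric] weight_def[symmetric] int[OF vE] L1[symmetric]
    by (rule divide[OF main assms(10)])
qed

end
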